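(* Let $r>0$, $s>1$, $t>0$. Let $\mathcal{G}$ be a map from a subset of $\mathcal{X}$ containing $\tilde C_r^s(\mathcal{X})$ into $\mathcal{Y}$, and assume that there exist $M<\infty$ and an open set $O_{\mathbb{C}}\subseteq\mathcal{X}_{\mathbb{C}}$ containing $\tilde C_r^{s}(\mathcal{X})$ such that $\mathcal{G}$ extends to a holomorphic map $\mathcal{G}:O_{\mathbb{C}}\to\mathcal{Y}_{\mathbb{C}}$ with $\sup_{a\in O_{\mathbb{C}}}\|\mathcal{G}(a)\|_{\mathcal{Y}^t_{\mathbb{C}}}\le M$. Fix $\delta>0$ (arbitrarily small). Then there is a constant $C>0$ such that for every $N\in\mathbb{N}$ there exists a multivariate polynomial $p_N$ such that $$\sup_{a\in C_r^s(\mathcal{X})}\big\|\mathcal{G}(a)-\mathcal{D}(p_N(\mathcal{E}(a)))\big\|_{\mathcal{Y}}\le C N^{-\min\{s-1,t\}+\delta}.$$ Furthermore, $p_N$ belongs to an $N$-dimensional space of multivariate polynomials, and its components are interpolation polynomials whose computation requires the evaluation of $\langle\mathcal{G}(a),\tilde\eta_j\rangle$ at at most $N$ tuples $(a,j)\in C_r^s(\mathcal{X})\times\mathbb{N}$.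
   Context: $\mathbb{N}=\{1,2,\dots\}$. $\mathcal{X},\mathcal{Y}$ are separable real Hilbert spaces; the subscript $\mathbb{C}$ denotes complexification. $(\psi_j)_{j\in\mathbb{N}}$ is a frame of $\mathcal{X}$ with canonical dual frame $(\tilde\psi_j)_{j\in\mathbb{N}}$, and $(\eta_j)_{j\in\mathbb{N}}$ is a frame of $\mathcal{Y}$ with canonical dual frame $(\tilde\eta_j)_{j\in\mathbb{N}}$. (A sequence $(\psi_j)$ is a frame of $\mathcal{X}$ if the analysis operator $F:\mathcal{X}\to\ell^2(\mathbb{N})$, $v\mapsto(\langle v,\psi_j\rangle)_j$, is bounded and boundedly invertible onto its range; the canonical dual frame is $\tilde\psi_j=(F'F)^{-1}\psi_j$ with $F'$ the adjoint of $F$.) Encoder and decoder: $\mathcal{E}:\mathcal{X}\to\ell^2(\mathbb{N})$, $\mathcal{E}(x)=(\langle x,\tilde\psi_j\rangle)_{j\in\mathbb{N}}$; $\mathcal{D}:\ell^2(\mathbb{N})\to\mathcal{Y}$, $\mathcal{D}((y_j)_j)=\sum_{j\in\mathbb{N}}y_j\eta_j$. $(w_j)_{j\in\mathbb{N}}$ is a fixed strictly positive, monotonically decreasing sequence with $(w_j^{1+\epsilon})_j\in\ell^1(\mathbb{N})$ for all $\epsilon>0$. For $t\ge0$, $\|y\|_{\mathcal{Y}^t}^2=\sum_j|\langle y,\tilde\eta_j\rangle|^2w_j^{-2t}$, $\mathcal{Y}^t=\{y\in\mathcal{Y}:\|y\|_{\mathcal{Y}^t}<\infty\}$, and $\mathcal{Y}^t_{\mathbb{C}}$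 is its complexification (same norm formula). With $U=[-1,1]^{\mathbb{N}}$ and $\sigma_r^s:U\to\mathcal{X}$, $\sigma_r^s(\boldsymbol y)=r\sum_{j\in\mathbb{N}}w_j^sy_j\psi_j$, set $\tilde C_r^s(\mathcal{X})=\{\sigma_r^s(\boldsymbol y):\boldsymbol y\in U\}$ and $C_r^s(\mathcal{X})=\{a\in\mathcal{X}:\sup_{j}|\langle a,\tilde\psi_j\rangle|w_j^{-s}\le r\}$ (so $C_r^s(\mathcal{X})\subseteq\tilde C_r^s(\mathcal{X})$). A multivariate polynomial $p_N:\mathbb{R}^n\to\mathbb{R}^m$ (for some $n,m\in\mathbb{N}$) is viewed as a map on sequences by applying it to the first $n$ components of the input and padding the output with infinitely many zeros. The interpolation polynomials meant are sparse-grid (Smolyak) interpolation polynomials in the (rescaled) encoded coordinates $y_j=\langle a,\tilde\psi_j\rangle/(rw_j^s)$: for a sequence of distinct points $(\chi_j)_{j\ge0}$ in $[-1,1]$ and a finitely supported multiindex $\boldsymbol\nu$, $I_{\boldsymbol\nu}u(\boldsymbol y)=\sum_{\boldsymbol\mu\le\boldsymbol\nu}u((\chi_{\mu_j})_j)\prod_{j}\prod_{i=0,\,i\ne\mu_j}^{\nu_j}\frac{y_j-\chi_i}{\chi_{\mu_j}-\chi_i}$, and for a finite downward closed set $\Lambda$ of such multiindices, $I_\Lambda=\sum_{\boldsymbol\nu\in\Lambda}\varsigma_{\Lambda,\boldsymbol\nu}I_{\boldsymbol\nu}$ with $\varsigma_{\Lambda,\boldsymbol\nu}=\sum_{\{\boldsymbol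 e\in\{0,1\}^{\mathbb{N}}:\boldsymbol\nu+\boldsymbol e\in\Lambda\}}(-1)^{|\boldsymbol e|}$, which uses $|\Lambda|$ evaluations of $u$.
   Formalization: The evaluation tuples (a,j) are shown to lie in C̃_r^s(X)×ℕ, and in C_r^s(X)×ℕ when (ψ_j) is biorthogonal to its canonical dual (Riesz basis); for redundant frames the claim with C_r^s(X) is false in general. *)

theory Defs
  imports "HOL-Analysis.Analysis" "HOL-Library.Function_Algebras"
begin

text \<open>
  The positive integers that index frames, weights and coordinates are shifted by one:
  all index sets are the type \<^typ>\<open>nat\<close>.
\<close>

section \<open>Square-summable sequences and frames\<close>

definition ell2 :: "(nat \<Rightarrow> real) set"
  where "ell2 = {c. summable (\<lambda>j. (c j)\<^sup>2)}"

definition ell2_norm :: "(nat \<Rightarrow> real) \<Rightarrow> real"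
  where "ell2_norm c = sqrt (\<Sum>j. (c j)\<^sup>2)"

definition analysis :: "(nat \<Rightarrow> 'x::real_inner) \<Rightarrow> 'x \<Rightarrow> (nat \<Rightarrow> real)"
  where "analysis \<psi> v = (\<lambda>j. v \<bullet> \<psi> j)"

definition is_frame :: "(nat \<Rightarrow> 'x::real_inner) \<Rightarrow> bool"
  where "is_frame \<psi> \<longleftrightarrow>
    range (analysis \<psi>) \<subseteq> ell2 \<and>
    (\<exists>B. \<forall>v. ell2_norm (analysis \<psi> v) \<le> B * norm v) \<and>
    inj (analysis \<psi>) \<and>
    (\<exists>B. \<forall>c \<in> range (analysis \<psi>). norm (inv (analysis \<psi>) c) \<le> B * ell2_norm c)"

text \<open>
  Hilbert space adjoint of the analysis operator: the vector representing the functional that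
  sends \<open>v\<close> to the \<open>\<ell>\<^sup>2\<close> inner product of the analysis of \<open>v\<close> with \<open>c\<close>.
  It is meaningful for \<open>c \<in> ell2\<close> when \<open>\<psi>\<close> is a frame of a complete space.
\<close>
definition analysis_adjoint :: "(nat \<Rightarrow> 'x::real_inner) \<Rightarrow> (nat \<Rightarrow> real) \<Rightarrow> 'x"
  where "analysis_adjoint \<psi> c = (THE x. \<forall>v. v \<bullet> x = (\<Sum>j. analysis \<psi> v j * c j))"

definition canonical_dual :: "(nat \<Rightarrow> 'x::real_inner) \<Rightarrow> nat \<Rightarrow> 'x"
  where "canonical_dual \<psi> j = inv (analysis_adjoint \<psi> \<circ> analysis \<psi>) (\<psi> j)"

definition encoder :: "(nat \<Rightarrow> 'x::real_inner) \<Rightarrow> 'x \<Rightarrow> (nat \<Rightarrow> real)"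
  where "encoder \<psi> x = (\<lambda>j. x \<bullet> canonical_dual \<psi> j)"

definition decoder :: "(nat \<Rightarrow> 'y::real_normed_vector) \<Rightarrow> (nat \<Rightarrow> real) \<Rightarrow> 'y"
  where "decoder \<eta> c = (\<Sum>j. c j *\<^sub>R \<eta> j)"


section \<open>Weights, smoothness spaces and input sets\<close>

definition admissible_weights :: "(nat \<Rightarrow> real) \<Rightarrow> bool"
  where "admissible_weights w \<longleftrightarrow>
    (\<forall>j. 0 < w j) \<and> decseq w \<and> (\<forall>\<epsilon>>0. summable (\<lambda>j. w j powr (1 + \<epsilon>)))"

definition unit_cube :: "(nat \<Rightarrow> real) set"
  where "unit_cube = {y. \<forall>j. y j \<in> {-1..1}}"

definition sigma_map :: "real \<Rightarrow> real \<Rightarrow> (nat \<Rightarrow> real) \<Rightarrow> (nat \<Rightarrow> 'x::real_normed_vector) \<Rightarrow> (nat \<Rightarrow> real) \<Rightarrow> 'x"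
  where "sigma_map r s w \<psi> y = r *\<^sub>R (\<Sum>j. (w j powr s * y j) *\<^sub>R \<psi> j)"

definition C_tilde :: "real \<Rightarrow> real \<Rightarrow> (nat \<Rightarrow> real) \<Rightarrow> (nat \<Rightarrow> 'x::real_normed_vector) \<Rightarrow> 'x set"
  where "C_tilde r s w \<psi> = sigma_map r s w \<psi> ` unit_cube"

definition C_cube :: "real \<Rightarrow> real \<Rightarrow> (nat \<Rightarrow> real) \<Rightarrow> (nat \<Rightarrow> 'x::real_inner) \<Rightarrow> 'x set"
  where "C_cube r s w \<psi> = {a. \<forall>j. \<bar>a \<bullet> canonical_dual \<psi> j\<bar> * w j powr (- s) \<le> r}"


section \<open>Complexification\<close>

text \<open>
  The complexification of a real Hilbert space \<^typ>\<open>'a\<close> is \<^typ>\<open>'a \<times> 'a\<close>, the pair \<open>(x, y)\<close>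
  standing for \<open>x + \<i> y\<close>; the library norm on pairs is its Hilbert space norm.
\<close>

definition cscale :: "complex \<Rightarrow> 'a \<times> 'a \<Rightarrow> 'a \<times> 'a::real_vector"
  where "cscale z h =
    (Re z *\<^sub>R fst h - Im z *\<^sub>R snd h, Im z *\<^sub>R fst h + Re z *\<^sub>R snd h)"

text \<open>Holomorphy on an open set: complex Frechet differentiability at every point.\<close>
definition holomorphic_map_on ::
    "('a::real_normed_vector \<times> 'a \<Rightarrow> 'b::real_normed_vector \<times> 'b) \<Rightarrow> ('a \<times> 'a) set \<Rightarrow> bool"
  where "holomorphic_map_on f S \<longleftrightarrow>
    (\<forall>a\<in>S. \<exists>D. (f has_derivative D) (at a) \<and> (\<forall>z h. D (cscale z h) = cscale z (D h)))"

definition inner_complexified :: "'y \<times> 'y \<Rightarrow> 'y::real_inner \<Rightarrow> complex"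
  where "inner_complexified y v = Complex (fst y \<bullet> v) (snd y \<bullet> v)"

definition Yt_complex :: "(nat \<Rightarrow> real) \<Rightarrow> (nat \<Rightarrow> 'y::real_inner) \<Rightarrow> real \<Rightarrow> ('y \<times> 'y) set"
  where "Yt_complex w \<eta> t =
    {y. summable (\<lambda>j. (cmod (inner_complexified y (canonical_dual \<eta> j)))\<^sup>2 * w j powr (- 2 * t))}"

definition Yt_complex_norm :: "(nat \<Rightarrow> real) \<Rightarrow> (nat \<Rightarrow> 'y::real_inner) \<Rightarrow> real \<Rightarrow> 'y \<times> 'y \<Rightarrow> real"
  where "Yt_complex_norm w \<eta> t y =
    sqrt (\<Sum>j. (cmod (inner_complexified y (canonical_dual \<eta> j)))\<^sup>2 * w j powr (- 2 * t))"


section \<open>Multivariate polynomials acting on sequences\<close>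

instantiation "fun" :: (type, real_vector) real_vector
begin

definition scaleR_fun :: "real \<Rightarrow> ('a \<Rightarrow> 'b) \<Rightarrow> 'a \<Rightarrow> 'b"
  where "scaleR_fun c f = (\<lambda>x. c *\<^sub>R f x)"

instance
  by standard (simp_all add: scaleR_fun_def fun_eq_iff scaleR_add_right scaleR_add_left)

end

definition polynomial_fun :: "nat \<Rightarrow> ((nat \<Rightarrow> real) \<Rightarrow> real) \<Rightarrow> bool"
  where "polynomial_fun n f \<longleftrightarrow>
    (\<exists>(A :: (nat \<Rightarrow> nat) set) c. finite A \<and> (\<forall>x. f x = (\<Sum>\<nu>\<in>A. c \<nu> * (\<Prod>i<n. x i ^ \<nu> i))))"

text \<open>
  A polynomial map from \<open>n\<close> to \<open>m\<close> real variables, viewed as a map on sequences that reads the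
  first \<open>n\<close> components of its argument and pads its value with zeros.
\<close>
definition polynomial_map :: "nat \<Rightarrow> nat \<Rightarrow> ((nat \<Rightarrow> real) \<Rightarrow> (nat \<Rightarrow> real)) \<Rightarrow> bool"
  where "polynomial_map n m p \<longleftrightarrow>
    (\<forall>j<m. polynomial_fun n (\<lambda>x. p x j)) \<and> (\<forall>x. \<forall>j\<ge>m. p x j = 0)"


section \<open>Sparse-grid interpolation\<close>

text \<open>
  Multiindices are functions \<^typ>\<open>nat \<Rightarrow> nat\<close> with finite support, ordered pointwise by the
  library order on functions.
\<close>

definition multiindex_set :: "(nat \<Rightarrow> nat) set \<Rightarrow> bool"
  where "multiindex_set \<Lambda> \<longleftrightarrow>
    finite \<Lambda> \<and> (\<forall>\<nu>\<in>\<Lambda>. finite {j. \<nu> j \<noteq> 0}) \<and> (\<forall>\<nu>\<in>\<Lambda>. \<forall>\<mu>\<le>\<nu>. \<mu> \<in> \<Lambda>)"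

text \<open>
  In the product over the coordinates, those with \<open>\<nu> j = 0\<close> contribute an empty product;
  it therefore ranges over the support of \<open>\<nu>\<close> only.
\<close>
definition tensor_interp ::
    "(nat \<Rightarrow> real) \<Rightarrow> (nat \<Rightarrow> nat) \<Rightarrow> ((nat \<Rightarrow> real) \<Rightarrow> real) \<Rightarrow> (nat \<Rightarrow> real) \<Rightarrow> real"
  where "tensor_interp \<xi> \<nu> u y =
    (\<Sum>\<mu>\<in>{..\<nu>}. u (\<lambda>j. \<xi> (\<mu> j)) *
       (\<Prod>j\<in>{j. \<nu> j \<noteq> 0}. \<Prod>i\<in>{..\<nu> j} - {\<mu> j}. (y j - \<xi> i) / (\<xi> (\<mu> j) - \<xi> i)))"

definition combination_coeff :: "(nat \<Rightarrow> nat) set \<Rightarrow> (nat \<Rightarrow> nat) \<Rightarrow> real"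
  where "combination_coeff \<Lambda> \<nu> =
    (\<Sum>e\<in>{e. range e \<subseteq> {0, 1} \<and> (\<lambda>j. \<nu> j + e j) \<in> \<Lambda>}. (- 1) ^ (\<Sum>j\<in>{j. e j \<noteq> 0}. e j))"

definition sparse_interp ::
    "(nat \<Rightarrow> real) \<Rightarrow> (nat \<Rightarrow> nat) set \<Rightarrow> ((nat \<Rightarrow> real) \<Rightarrow> real) \<Rightarrow> (nat \<Rightarrow> real) \<Rightarrow> real"
  where "sparse_interp \<xi> \<Lambda> u y = (\<Sum>\<nu>\<in>\<Lambda>. combination_coeff \<Lambda> \<nu> * tensor_interp \<xi> \<nu> u y)"

text \<open>
  Component \<open>j < m\<close> interpolates the \<open>j\<close>-th output coefficient of \<open>H \<circ> sigma_map\<close> on the sparse grid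
  of \<open>\<Lambda> j\<close>, expressed in the encoded coordinates after rescaling them to the unit cube.
\<close>
definition interpolation_map ::
    "(nat \<Rightarrow> real) \<Rightarrow> nat \<Rightarrow> (nat \<Rightarrow> (nat \<Rightarrow> nat) set) \<Rightarrow> real \<Rightarrow> real \<Rightarrow> (nat \<Rightarrow> real) \<Rightarrow>
     (nat \<Rightarrow> 'x::real_inner) \<Rightarrow> (nat \<Rightarrow> 'y::real_inner) \<Rightarrow> ('x \<Rightarrow> 'y) \<Rightarrow> (nat \<Rightarrow> real) \<Rightarrow> (nat \<Rightarrow> real)"
  where "interpolation_map \<xi> m \<Lambda> r s w \<psi> \<eta> H x j =
    (if j < m
     then sparse_interp \<xi> (\<Lambda> j) (\<lambda>y. H (sigma_map r s w \<psi> y) \<bullet> canonical_dual \<eta> j)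
            (\<lambda>k. x k / (r * w k powr s))
     else 0)"

text \<open>The pairs \<open>(a, j)\<close> for which the interpolation formula refers to
  \<open>H a \<bullet> canonical_dual \<eta> j\<close>.\<close>
definition evaluation_tuples ::
    "(nat \<Rightarrow> real) \<Rightarrow> nat \<Rightarrow> (nat \<Rightarrow> (nat \<Rightarrow> nat) set) \<Rightarrow> real \<Rightarrow> real \<Rightarrow> (nat \<Rightarrow> real) \<Rightarrow>
     (nat \<Rightarrow> 'x::real_normed_vector) \<Rightarrow> ('x \<times> nat) set"
  where "evaluation_tuples \<xi> m \<Lambda> r s w \<psi> =
    {(sigma_map r s w \<psi> (\<lambda>k. \<xi> (\<mu> k)), j) | \<mu> \<nu> j. j < m \<and> \<nu> \<in> \<Lambda> j \<and> \<mu> \<le> \<nu>}"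

text \<open>
  Sparse-grid points are images under \<open>sigma_map\<close> of points of the unit cube, hence lie in
  \<open>C_tilde\<close>. For a redundant frame such an image need not lie in the smaller set \<open>C_cube\<close>
  (even the image of a finitely supported point may fail to); the two sets agree when the frame
  is biorthogonal to its canonical dual, that is, when it is a Riesz basis.
\<close>
definition biorthogonal_to_dual :: "(nat \<Rightarrow> 'x::real_inner) \<Rightarrow> bool"
  where "biorthogonal_to_dual \<psi> \<longleftrightarrow>
    (\<forall>j k. \<psi> k \<bullet> canonical_dual \<psi> j = (if j = k then 1 else 0))"

end

theory Submission
  imports Defs "HOL-Complex_Analysis.Complex_Analysis" "HOL-Real_Asymp.Real_Asymp"
begin

text \<open>
  In the encoded coordinates the coefficients \<open>c\<^sub>j\<close> of \<open>G\<close> are holomorphic on polyrectangles around the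
  cube. The nodes are the real parts of a rotated van der Corput sequence on the unit circle; their
  nodal polynomials are within polynomial factors of those of Chebyshev nodes, so one-dimensional
  Newton terms decay geometrically by Cauchy's formula. Sparse interpolation on \<open>\<Lambda>\<close> is the sum over
  \<open>\<Lambda>\<close> of the tensorised Newton terms \<open>\<Delta>\<^sub>\<nu>\<close>, and \<open>\<Delta>\<^sub>\<nu> c\<close> has \<open>t\<close>-weighted norm at most \<open>M a\<^sub>\<nu>\<close> with
  \<open>\<Sum> a\<^sub>\<nu> powr q < \<infinity>\<close>, where \<open>q \<le> 1\<close> may be any exponent above \<open>1 / s\<close>.

  Let \<open>\<alpha> < min (s - 1) t\<close>, \<open>q = 1 / (1 + \<alpha>)\<close>, and let \<open>g\<close> be a summable monotone majorant of
  \<open>a powr q\<close>. Computing \<open>\<Delta>\<^sub>\<nu> c\<^sub>j\<close> only for \<open>j < J\<^sub>\<nu>\<close> with \<open>J\<^sub>\<nu>\<close> about \<open>N g\<^sub>\<nu> / \<Sum> g\<close> costs at most \<open>N\<close>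
  evaluations; as \<open>w\<^sub>J powr t\<close> is \<open>O(J powr - \<alpha>)\<close>, the error is at most a constant times
  \<open>\<Sum> a\<^sub>\<nu> (N g\<^sub>\<nu>) powr - \<alpha> \<le> N powr - \<alpha> \<Sum> g\<^sub>\<nu>\<close>.
\<close>

section \<open>Frames\<close>

text \<open>The obstacle is that arbitrarily many coordinates may be active at once, so a leading
  constant per active coordinate, such as a Lebesgue constant, would multiply up without control.
  Constants are tolerated only in the first \<open>J\<close> coordinates; there the admissible
  radius is small, the crude estimate yields no decay, and the special nodes do the work. Beyond
  \<open>J\<close>, trivial bounds on the factors of the nodal polynomials suffice, and they leave
  no leading constant. The output is a whole sequence of coefficients. It is reduced to scalar
  functions by testing with arbitrary real weights \<beta>: Cauchy estimates are applied to the sums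
  of \<open>\<beta> j\<close> times the coefficients, and at the end \<beta> is taken to be the
  interpolation error itself, cut off below \<open>J \<nu>\<close>. The exponent is limited from two
  sides: \<alpha> < s - 1 is the same as s q > 1 for q = 1 / (1 + \<alpha>), which makes the
  surpluses summable to the power q, while \<alpha> < t is what the decay of the weights
  allows.\<close>

definition bessel_bound :: "(nat \<Rightarrow> 'x::real_inner) \<Rightarrow> real \<Rightarrow> bool"
  where "bessel_bound \<psi> B \<longleftrightarrow>
    0 \<le> B \<and> (\<forall>v. summable (\<lambda>j. (v \<bullet> \<psi> j)\<^sup>2) \<and> (\<Sum>j. (v \<bullet> \<psi> j)\<^sup>2) \<le> (B * norm v)\<^sup>2)"

definition frame_operator :: "(nat \<Rightarrow> 'x::real_inner) \<Rightarrow> 'x \<Rightarrow> 'x"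
  where "frame_operator \<psi> v = (\<Sum>j. (v \<bullet> \<psi> j) *\<^sub>R \<psi> j)"

lemma is_frame_imp_bessel_bound:
  assumes "is_frame \<psi>"
  obtains B where "bessel_bound \<psi> B"
proof -
  obtain B where B: "\<And>v. ell2_norm (analysis \<psi> v) \<le> B * norm v"
    using assms unfolding is_frame_def by blast
  have sm: "summable (\<lambda>j. (v \<bullet> \<psi> j)\<^sup>2)" for v
    using assms unfolding is_frame_def analysis_def ell2_def by blast
  \<comment> \<open>In the trivial space the constant \<open>B\<close> may be negative, hence the
    absolute value.\<close>
  have "bessel_bound \<psi> \<bar>B\<bar>"
    unfolding bessel_bound_def
  proof (intro conjI allI sm)
    fix v
    have nn: "0 \<le> (\<Sum>j. (v \<bullet> \<psi> j)\<^sup>2)" by (intro suminf_nonneg sm) auto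
    have "sqrt (\<Sum>j. (v \<bullet> \<psi> j)\<^sup>2) \<le> \<bar>B\<bar> * norm v"
      using B[of v] mult_right_mono[OF abs_ge_self[of B] norm_ge_zero[of v]]
      by (simp add: ell2_norm_def analysis_def)
    then show "(\<Sum>j. (v \<bullet> \<psi> j)\<^sup>2) \<le> (\<bar>B\<bar> * norm v)\<^sup>2"
      by (rule sqrt_le_D)
  qed simp
  then show ?thesis by (rule that)
qed

lemma is_frame_lower_bound:
  assumes "is_frame \<psi>"
  obtains c where "c > 0" "\<And>v. c * (norm v)\<^sup>2 \<le> (\<Sum>j. (v \<bullet> \<psi> j)\<^sup>2)"
proof -
  obtain B where B: "\<And>c. c \<in> range (analysis \<psi>) \<Longrightarrow> norm (inv (analysis \<psi>) c) \<le> B * ell2_norm c"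
    and inj: "inj (analysis \<psi>)"
    using assms unfolding is_frame_def by blast
  define K where "K = \<bar>B\<bar> + 1"
  have K: "K > 0" by (simp add: K_def)
  have sm: "summable (\<lambda>j. (v \<bullet> \<psi> j)\<^sup>2)" for v
    using assms unfolding is_frame_def analysis_def ell2_def by blast
  have "(1 / K\<^sup>2) * (norm v)\<^sup>2 \<le> (\<Sum>j. (v \<bullet> \<psi> j)\<^sup>2)" for v
  proof -
    have nn: "0 \<le> (\<Sum>j. (v \<bullet> \<psi> j)\<^sup>2)" by (intro suminf_nonneg sm) auto
    have "norm v \<le> B * sqrt (\<Sum>j. (v \<bullet> \<psi> j)\<^sup>2)"
      using B[of "analysis \<psi> v"] inj by (simp add: ell2_norm_def) (simp add: analysis_def)
    also have "\<dots> \<le> K * sqrt (\<Sum>j. (v \<bullet> \<psi> j)\<^sup>2)"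
      by (intro mult_right_mono) (auto simp: K_def nn)
    finally have "(norm v)\<^sup>2 \<le> (K * sqrt (\<Sum>j. (v \<bullet> \<psi> j)\<^sup>2))\<^sup>2"
      by (intro power_mono) auto
    also have "\<dots> = K\<^sup>2 * (\<Sum>j. (v \<bullet> \<psi> j)\<^sup>2)"
      using nn by (simp add: power_mult_distrib)
    finally show ?thesis using K by (simp add: field_simps)
  qed
  then show ?thesis using that[of "1 / K\<^sup>2"] K by simp
qed

text \<open>Synthesis is bounded by duality: pairing the sum \<open>x\<close> with itself and
  applying Cauchy-Schwarz bounds \<open>(norm x)\<^sup>2\<close> by the size of \<open>c\<close>
  times that of the analysis of \<open>x\<close>, which is at most \<open>B * norm x\<close>; one
  factor \<open>norm x\<close> then cancels.\<close>

lemma bessel_bound_sum: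
  assumes "bessel_bound \<psi> B" "finite F"
  shows "norm (\<Sum>j\<in>F. c j *\<^sub>R \<psi> j) \<le> B * sqrt (\<Sum>j\<in>F. (c j)\<^sup>2)"
proof -
  define x where "x = (\<Sum>j\<in>F. c j *\<^sub>R \<psi> j)"
  have sm: "summable (\<lambda>j. (x \<bullet> \<psi> j)\<^sup>2)" and bd: "(\<Sum>j. (x \<bullet> \<psi> j)\<^sup>2) \<le> (B * norm x)\<^sup>2"
    and B0: "0 \<le> B"
    using assms(1) unfolding bessel_bound_def by auto
  have 1: "(norm x)\<^sup>2 = (\<Sum>j\<in>F. c j * (x \<bullet> \<psi> j))"
    unfolding power2_norm_eq_inner
    by (subst (2) x_def) (simp add: inner_sum_right)
  have "(\<Sum>j\<in>F. (x \<bullet> \<psi> j)\<^sup>2) \<le> (\<Sum>j. (x \<bullet> \<psi> j)\<^sup>2)"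
    by (intro sum_le_suminf sm assms) auto
  then have 2: "(\<Sum>j\<in>F. (x \<bullet> \<psi> j)\<^sup>2) \<le> (B * norm x)\<^sup>2" using bd by simp
  have "((norm x)\<^sup>2)\<^sup>2 \<le> (\<Sum>j\<in>F. (c j)\<^sup>2) * (\<Sum>j\<in>F. (x \<bullet> \<psi> j)\<^sup>2)"
    unfolding 1 by (rule Cauchy_Schwarz_ineq_sum)
  also have "\<dots> \<le> (\<Sum>j\<in>F. (c j)\<^sup>2) * (B * norm x)\<^sup>2"
    by (intro mult_left_mono 2 sum_nonneg) auto
  finally have "((norm x)\<^sup>2)\<^sup>2 \<le> (sqrt (\<Sum>j\<in>F. (c j)\<^sup>2) * (B * norm x))\<^sup>2"
    by (simp add: power_mult_distrib sum_nonneg)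
  then have "(norm x)\<^sup>2 \<le> sqrt (\<Sum>j\<in>F. (c j)\<^sup>2) * (B * norm x)"
    by (rule power2_le_imp_le) (use B0 in \<open>auto intro!: mult_nonneg_nonneg sum_nonneg\<close>)
  then have *: "norm x * norm x \<le> (B * sqrt (\<Sum>j\<in>F. (c j)\<^sup>2)) * norm x"
    by (simp add: power2_eq_square mult_ac)
  show ?thesis
  proof (cases "x = 0")
    case True
    then show ?thesis
      unfolding x_def[symmetric] using B0 by (auto intro!: mult_nonneg_nonneg sum_nonneg)
  next
    case False
    with * have "norm x \<le> B * sqrt (\<Sum>j\<in>F. (c j)\<^sup>2)"
      using mult_right_le_imp_le by (metis zero_less_norm_iff)
    then show ?thesis by (simp add: x_def)
  qed
qed

lemma bessel_bound_norm_le: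
  assumes "bessel_bound \<psi> B"
  shows "norm (\<psi> j) \<le> B"
  using bessel_bound_sum[OF assms, of "{j}" "\<lambda>_. 1"] by simp

lemma bessel_bound_summable:
  fixes \<psi> :: "nat \<Rightarrow> 'x::{real_inner, banach}"
  assumes "bessel_bound \<psi> B" "summable (\<lambda>j. (c j)\<^sup>2)"
  shows "summable (\<lambda>j. c j *\<^sub>R \<psi> j)"
  unfolding summable_Cauchy
proof (intro allI impI)
  fix e :: real assume e: "e > 0"
  have B0: "0 \<le> B" using assms unfolding bessel_bound_def by auto
  define d where "d = (e / (B + 1))\<^sup>2"
  have d: "d > 0" using e B0 by (simp add: d_def)
  obtain N where N: "\<And>m n. m \<ge> N \<Longrightarrow> norm (\<Sum>j\<in>{m..<n}. (c j)\<^sup>2) < d"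
    using assms(2) d unfolding summable_Cauchy by blast
  have "norm (\<Sum>j\<in>{m..<n}. c j *\<^sub>R \<psi> j) < e" if "m \<ge> N" for m n
  proof -
    have "norm (\<Sum>j\<in>{m..<n}. c j *\<^sub>R \<psi> j) \<le> B * sqrt (\<Sum>j\<in>{m..<n}. (c j)\<^sup>2)"
      by (rule bessel_bound_sum[OF assms(1)]) simp
    also have "\<dots> \<le> B * sqrt d"
      using N[OF that, of n] B0 by (intro mult_left_mono real_sqrt_le_mono) auto
    also have "\<dots> = B * (e / (B + 1))" using e B0 by (simp add: d_def)
    also have "\<dots> < e" using e B0 by (simp add: field_simps)
    finally show ?thesis .
  qed
  then show "\<exists>N. \<forall>m\<ge>N. \<forall>n. norm (\<Sum>j\<in>{m..<n}. c j *\<^sub>R \<psi> j) < e" by blast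
qed

lemma bessel_bound_sums_frame_operator:
  fixes \<psi> :: "nat \<Rightarrow> 'x::{real_inner, banach}"
  assumes "bessel_bound \<psi> B"
  shows "(\<lambda>j. (v \<bullet> \<psi> j) *\<^sub>R \<psi> j) sums frame_operator \<psi> v"
  unfolding frame_operator_def
  by (intro summable_sums bessel_bound_summable[OF assms])
    (use assms in \<open>auto simp: bessel_bound_def\<close>)

lemma inner_frame_operator_sums:
  fixes \<psi> :: "nat \<Rightarrow> 'x::{real_inner, banach}"
  assumes "bessel_bound \<psi> B"
  shows "(\<lambda>j. (v \<bullet> \<psi> j) * (u \<bullet> \<psi> j)) sums (u \<bullet> frame_operator \<psi> v)"
  using bounded_linear.sums[OF bounded_linear_inner_right bessel_bound_sums_frame_operator[OF assms, of v], of u]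
  by simp

lemma inner_frame_operator_commute:
  fixes \<psi> :: "nat \<Rightarrow> 'x::{real_inner, banach}"
  assumes "bessel_bound \<psi> B"
  shows "u \<bullet> frame_operator \<psi> v = frame_operator \<psi> u \<bullet> v"
  using sums_unique2[OF inner_frame_operator_sums[OF assms, of v u]]
    inner_frame_operator_sums[OF assms, of u v]
  by (simp add: mult.commute inner_commute)

lemma norm_frame_operator_le:
  fixes \<psi> :: "nat \<Rightarrow> 'x::{real_inner, banach}"
  assumes "bessel_bound \<psi> B"
  shows "norm (frame_operator \<psi> v) \<le> B\<^sup>2 * norm v"
proof -
  have sm: "summable (\<lambda>j. (v \<bullet> \<psi> j)\<^sup>2)" and bd: "(\<Sum>j. (v \<bullet> \<psi> j)\<^sup>2) \<le> (B * norm v)\<^sup>2"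
    and B0: "0 \<le> B"
    using assms(1) unfolding bessel_bound_def by auto
  have lim: "(\<lambda>n. \<Sum>j<n. (v \<bullet> \<psi> j) *\<^sub>R \<psi> j) \<longlonglongrightarrow> frame_operator \<psi> v"
    using bessel_bound_sums_frame_operator[OF assms] by (simp add: sums_def)
  show ?thesis
  proof (rule LIMSEQ_le_const2[OF tendsto_norm[OF lim]], intro exI allI impI)
    fix n
    have "norm (\<Sum>j<n. (v \<bullet> \<psi> j) *\<^sub>R \<psi> j) \<le> B * sqrt (\<Sum>j<n. (v \<bullet> \<psi> j)\<^sup>2)"
      by (rule bessel_bound_sum[OF assms]) simp
    also have "(\<Sum>j<n. (v \<bullet> \<psi> j)\<^sup>2) \<le> (\<Sum>j. (v \<bullet> \<psi> j)\<^sup>2)"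
      by (intro sum_le_suminf sm) auto
    then have "sqrt (\<Sum>j<n. (v \<bullet> \<psi> j)\<^sup>2) \<le> sqrt ((B * norm v)\<^sup>2)"
      using bd by (intro real_sqrt_le_mono) simp
    then have "B * sqrt (\<Sum>j<n. (v \<bullet> \<psi> j)\<^sup>2) \<le> B * sqrt ((B * norm v)\<^sup>2)"
      using B0 by (rule mult_left_mono)
    also have "\<dots> = B\<^sup>2 * norm v" using B0 by (simp add: power2_eq_square)
    finally show "norm (\<Sum>j<n. (v \<bullet> \<psi> j) *\<^sub>R \<psi> j) \<le> B\<^sup>2 * norm v" .
  qed
qed

lemma linear_frame_operator:
  fixes \<psi> :: "nat \<Rightarrow> 'x::{real_inner, banach}"
  assumes "bessel_bound \<psi> B"
  shows "linear (frame_operator \<psi>)"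
proof (rule linearI)
  fix u v :: 'x and a :: real
  have "x \<bullet> frame_operator \<psi> (u + v) = x \<bullet> (frame_operator \<psi> u + frame_operator \<psi> v)" for x
    using assms by (simp add: inner_frame_operator_commute inner_add_right)
  then show "frame_operator \<psi> (u + v) = frame_operator \<psi> u + frame_operator \<psi> v"
    using vector_eq_ldot by blast
  have "x \<bullet> frame_operator \<psi> (a *\<^sub>R u) = x \<bullet> (a *\<^sub>R frame_operator \<psi> u)" for x
    using assms by (simp add: inner_frame_operator_commute)
  then show "frame_operator \<psi> (a *\<^sub>R u) = a *\<^sub>R frame_operator \<psi> u"
    using vector_eq_ldot by blast
qed

text \<open>Surjectivity comes from the contraction \<open>v \<mapsto> v - \<lambda> (S v - y)\<close>, \<open>S\<close> being coercive.\<close>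

lemma bij_frame_operator:
  fixes \<psi> :: "nat \<Rightarrow> 'x::{real_inner, banach}"
  assumes "is_frame \<psi>"
  shows "bij (frame_operator \<psi>)"
proof -
  obtain B where B: "bessel_bound \<psi> B" using is_frame_imp_bessel_bound[OF assms] .
  obtain c where c: "c > 0" and low: "\<And>v. c * (norm v)\<^sup>2 \<le> (\<Sum>j. (v \<bullet> \<psi> j)\<^sup>2)"
    using is_frame_lower_bound[OF assms] by blast
  let ?S = "frame_operator \<psi>"
  have lin: "linear ?S" using linear_frame_operator[OF B] .
  have coer: "c * (norm v)\<^sup>2 \<le> v \<bullet> ?S v" for v
    using low[of v] sums_unique[OF inner_frame_operator_sums[OF B, of v v]]
    by (simp add: power2_eq_square)
  have inj: "inj ?S"
  proof (rule injI)
    fix u v assume "?S u = ?S v"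
    then have "?S (u - v) = 0" by (simp add: linear_diff[OF lin])
    with coer[of "u - v"] c have "(norm (u - v))\<^sup>2 \<le> 0"
      by (simp add: mult_le_0_iff)
    then show "u = v" by simp
  qed
  have "surj ?S"
    unfolding surj_def
  proof
    fix y
    define K where "K = B\<^sup>2 + c + 1"
    have K: "K > 0" "K > c" using c by (auto simp: K_def intro: add_nonneg_pos add_pos_pos)
    have SK: "norm (?S v) \<le> K * norm v" for v
      using norm_frame_operator_le[OF B, of v] c
      by (smt (verit, best) K_def mult_right_mono norm_ge_zero)
    \<comment> \<open>This step size minimises 1 - 2 l c + l^2 K^2, and the minimum 1 - c^2 / K^2 is
      the squared contraction factor. The choice of \<open>K\<close> above \<open>c\<close> keeps it
      positive.\<close>
    define l where "l = c / K\<^sup>2"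
    have l: "l > 0" using c K by (simp add: l_def)
    define q where "q = sqrt (1 - c\<^sup>2 / K\<^sup>2)"
    have ck: "c\<^sup>2 / K\<^sup>2 < 1" "c\<^sup>2 / K\<^sup>2 > 0"
      using c K by (auto simp: power_strict_mono)
    have q: "0 \<le> q" "q < 1" using ck by (auto simp: q_def)
    define T where "T = (\<lambda>v. v - l *\<^sub>R (?S v - y))"
    have contr: "dist (T u) (T v) \<le> q * dist u v" for u v
    proof -
      define d where "d = u - v"
      have Td: "T u - T v = d - l *\<^sub>R ?S d"
        by (simp add: T_def d_def linear_diff[OF lin] algebra_simps)
      have "(norm (d - l *\<^sub>R ?S d))\<^sup>2 = (norm d)\<^sup>2 - 2 * l * (d \<bullet> ?S d) + l\<^sup>2 * (norm (?S d))\<^sup>2"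
        unfolding power2_norm_eq_inner
        by (simp add: inner_diff_left inner_diff_right power2_eq_square inner_commute algebra_simps)
      also have "\<dots> \<le> (norm d)\<^sup>2 - 2 * l * (c * (norm d)\<^sup>2) + l\<^sup>2 * (K * norm d)\<^sup>2"
        using l coer[of d] SK[of d]
        by (intro add_mono diff_mono mult_left_mono power_mono) auto
      also have "\<dots> = (1 - c\<^sup>2 / K\<^sup>2) * (norm d)\<^sup>2"
        using K by (simp add: l_def field_simps power2_eq_square power4_eq_xxxx)
      also have "\<dots> = (q * norm d)\<^sup>2" using ck by (simp add: q_def power_mult_distrib)
      finally have "norm (d - l *\<^sub>R ?S d) \<le> q * norm d"
        by (rule power2_le_imp_le) (use q in auto)
      then show ?thesis by (simp add: dist_norm Td) (simp add: d_def)
    qed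
    have "\<exists>!x. T x = x"
      by (rule banach_fix_type[OF q]) (use contr in auto)
    then obtain x where "T x = x" by blast
    then have "l *\<^sub>R (?S x - y) = 0" by (simp add: T_def)
    then have "y = ?S x" using l by simp
    then show "\<exists>x. y = ?S x" by blast
  qed
  with inj show ?thesis by (simp add: bij_def)
qed

text \<open>The synthesis series represents the functional in question, and a representing vector is
  unique; this trades the definite description for a series.\<close>

lemma analysis_adjoint_eq:
  fixes \<psi> :: "nat \<Rightarrow> 'x::{real_inner, banach}"
  assumes "bessel_bound \<psi> B" "summable (\<lambda>j. (c j)\<^sup>2)"
  shows "analysis_adjoint \<psi> c = (\<Sum>j. c j *\<^sub>R \<psi> j)"
  unfolding analysis_adjoint_def
proof (rule the_equality)
  have "v \<bullet> (\<Sum>j. c j *\<^sub>R \<psi> j) = (\<Sum>j. v \<bullet> (c j *\<^sub>R \<psi> j))" for v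
    using bounded_linear.suminf[OF bounded_linear_inner_right bessel_bound_summable[OF assms]]
    by simp
  then show *: "\<forall>v. v \<bullet> (\<Sum>j. c j *\<^sub>R \<psi> j) = (\<Sum>j. analysis \<psi> v j * c j)"
    by (simp add: analysis_def mult.commute)
  fix x assume "\<forall>v. v \<bullet> x = (\<Sum>j. analysis \<psi> v j * c j)"
  with * have "v \<bullet> x = v \<bullet> (\<Sum>j. c j *\<^sub>R \<psi> j)" for v by simp
  then show "x = (\<Sum>j. c j *\<^sub>R \<psi> j)" using vector_eq_ldot by blast
qed

lemma canonical_dual_eq:
  fixes \<psi> :: "nat \<Rightarrow> 'x::{real_inner, banach}"
  assumes "is_frame \<psi>"
  shows "canonical_dual \<psi> j = inv (frame_operator \<psi>) (\<psi> j)"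
proof -
  obtain B where B: "bessel_bound \<psi> B" using is_frame_imp_bessel_bound[OF assms] .
  have "analysis_adjoint \<psi> \<circ> analysis \<psi> = frame_operator \<psi>"
  proof
    fix v
    have "summable (\<lambda>j. (analysis \<psi> v j)\<^sup>2)"
      using B by (simp add: analysis_def bessel_bound_def)
    then show "(analysis_adjoint \<psi> \<circ> analysis \<psi>) v = frame_operator \<psi> v"
      by (simp add: analysis_adjoint_eq[OF B] frame_operator_def analysis_def)
  qed
  then show ?thesis by (simp add: canonical_dual_def)
qed

text \<open>Expand x as S applied to its preimage, S being the frame operator; self-adjointness of S
  moves the inverse from x onto \<open>\<psi> j\<close>, which is the canonical dual.\<close>

lemma frame_reconstruction:
  fixes \<psi> :: "nat \<Rightarrow> 'x::{real_inner, banach}"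
  assumes "is_frame \<psi>"
  shows "(\<lambda>j. (x \<bullet> canonical_dual \<psi> j) *\<^sub>R \<psi> j) sums x"
proof -
  obtain B where B: "bessel_bound \<psi> B" using is_frame_imp_bessel_bound[OF assms] .
  let ?S = "frame_operator \<psi>"
  have surj: "?S (inv ?S z) = z" for z
    using bij_frame_operator[OF assms] by (simp add: bij_def surj_f_inv_f)
  have "inv ?S x \<bullet> \<psi> j = x \<bullet> canonical_dual \<psi> j" for j
    using inner_frame_operator_commute[OF B, of "inv ?S x" "inv ?S (\<psi> j)"]
    by (simp add: canonical_dual_eq[OF assms] surj)
  with bessel_bound_sums_frame_operator[OF B, of "inv ?S x"] show ?thesis
    by (simp add: surj)
qed

section \<open>Interpolation nodes\<close>

text \<open>
  The van der Corput ordering of the dyadic roots of unity: entries \<open>2 n\<close> and \<open>2 n + 1\<close> are the two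
  square roots of entry \<open>n\<close>, so products over initial segments collapse under squaring. The phase is
  a primitive third root of unity; as it is not a dyadic root, the rotated points have distinct
  real parts.
\<close>

fun corput_root :: "nat \<Rightarrow> complex"
  where "corput_root n =
    (if n = 0 then 1 else if even n then csqrt (corput_root (n div 2))
     else - csqrt (corput_root (n div 2)))"

declare corput_root.simps [simp del]

definition corput_phase :: complex
  where "corput_phase = Complex (- 1 / 2) (sqrt 3 / 2)"

definition node :: "nat \<Rightarrow> real"
  where "node n = Re (corput_phase * corput_root n)"

lemma corput_root_0 [simp]: "corput_root 0 = 1"
  by (simp add: corput_root.simps[of 0])

lemma corput_root_even: "corput_root (2 * n) = csqrt (corput_root n)"
  by (cases "n = 0") (simp_all add: corput_root.simps[of "2 * n"])

lemma corput_root_odd: "corput_root (Suc (2 * n)) = - csqrt (corput_root n)"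
  by (simp add: corput_root.simps[of "Suc (2 * n)"])

lemma corput_root_square: "(corput_root n)\<^sup>2 = corput_root (n div 2)"
  by (cases "n = 0") (simp_all add: corput_root.simps[of n])

lemma norm_corput_root [simp]: "norm (corput_root n) = 1"
proof (induction n rule: less_induct)
  case (less n)
  then show ?case by (cases "n = 0") (simp_all add: corput_root.simps[of n] norm_csqrt)
qed

lemma corput_root_power: "corput_root n ^ (2 ^ p) = corput_root (n div 2 ^ p)"
proof (induction p)
  case (Suc p)
  have "corput_root n ^ (2 ^ Suc p) = (corput_root n ^ (2 ^ p))\<^sup>2"
    by (simp add: mult.commute flip: power_mult)
  also have "\<dots> = corput_root (n div 2 ^ p div 2)" by (simp add: Suc corput_root_square)
  finally show ?case by (metis div_mult2_eq power_Suc2)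
qed simp

text \<open>Squaring leads to the parent \<open>n div 2\<close>, so equal points have equal parents,
  and two children of one parent are nonzero and opposite. For m = 0 the induction does not descend:
  there all ancestors of n would have root 1, but every nonzero n has the ancestor 1, whose root is
  -1.\<close>

lemma inj_corput_root: "corput_root m = corput_root n \<Longrightarrow> m = n"
proof (induction m arbitrary: n rule: less_induct)
  case (less m)
  have nz: "csqrt (corput_root k) \<noteq> 0" for k
    using norm_corput_root[of k] by (metis csqrt_eq_0 norm_zero zero_neq_one)
  have sq: "corput_root (m div 2) = corput_root (n div 2)"
    using less.prems by (metis corput_root_square)
  show ?case
  proof (cases "m = 0")
    case True
    have "corput_root n = 1" using less.prems True by simp
    then have "\<forall>p. corput_root (n div 2 ^ p) = 1" by (metis corput_root_power power_one)
    moreover have "\<exists>p. n div 2 ^ p = 1" if "n \<noteq> 0"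
      using that
    proof (induction n rule: less_induct)
      case (less n)
      show ?case
      proof (cases "n = 1")
        case True then show ?thesis by (intro exI[of _ 0]) simp
      next
        case False
        with less.prems have "n div 2 < n" "n div 2 \<noteq> 0" by auto
        then obtain p where "n div 2 div 2 ^ p = 1" using less.IH by blast
        then show ?thesis by (intro exI[of _ "Suc p"]) (simp add: div_mult2_eq)
      qed
    qed
    moreover have "corput_root 1 = -1" using corput_root_odd[of 0] by simp
    ultimately show ?thesis using True by (metis one_neq_neg_one)
  next
    case False
    then have d: "m div 2 = n div 2" using less.IH sq by simp
    show ?thesis
    proof (cases "even m \<longleftrightarrow> even n")
      case True
      with d show ?thesis by (metis even_iff_mod_2_eq_zero div_mult_mod_eq not_mod_2_eq_0_eq_1)
    next
      case ne: False
      define k where "k = m div 2"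
      have "{m, n} = {2 * k, Suc (2 * k)}"
        using ne d unfolding k_def by (auto elim!: evenE oddE)
      then have "corput_root (2 * k) = corput_root (Suc (2 * k))"
        using less.prems by (auto simp: doubleton_eq_iff)
      then have "csqrt (corput_root k) = 0" by (simp add: corput_root_even corput_root_odd)
      with nz show ?thesis by blast
    qed
  qed
qed

lemma norm_corput_phase [simp]: "norm corput_phase = 1"
  by (simp add: corput_phase_def cmod_def power_divide)

lemma corput_phase_square: "corput_phase\<^sup>2 = cnj corput_phase"
  by (simp add: corput_phase_def complex_eq_iff power2_eq_square)

text \<open>Squaring swaps the phase with its conjugate, so the powers never leave these two
  values.\<close>

lemma corput_phase_power_neq_1: "corput_phase ^ (2 ^ p) \<noteq> 1"
proof -
  have "corput_phase ^ (2 ^ p) = corput_phase \<or> corput_phase ^ (2 ^ p) = cnj corput_phase"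
  proof (induction p)
    case (Suc p)
    have "corput_phase ^ (2 ^ Suc p) = (corput_phase ^ (2 ^ p))\<^sup>2"
      by (simp add: mult.commute flip: power_mult)
    with Suc show ?case
      by (metis complex_cnj_cnj complex_cnj_power corput_phase_square)
  qed simp
  then show ?thesis by (auto simp: corput_phase_def complex_eq_iff)
qed

lemma unit_eq_Re_imp:
  fixes a b :: complex
  assumes "norm a = 1" "norm b = 1" "Re a = Re b"
  shows "a = b \<or> a = cnj b"
proof -
  have "(Re a)\<^sup>2 + (Im a)\<^sup>2 = 1" "(Re b)\<^sup>2 + (Im b)\<^sup>2 = 1"
    using assms by (simp_all add: cmod_def)
  then have "(Im a)\<^sup>2 = (Im b)\<^sup>2" using assms by simp
  then show ?thesis using assms by (auto simp: power2_eq_iff complex_eq_iff)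
qed

text \<open>Points of the unit circle with equal real parts are equal or conjugate. In the conjugate
  case the squared phase times two dyadic roots is 1; raising this to the power
  \<open>2 ^ (m + n)\<close> turns both roots into 1 and leaves a forbidden power of the
  phase.\<close>

lemma inj_node: "inj node"
proof (rule injI)
  fix m n assume "node m = node n"
  then have "corput_phase * corput_root m = corput_phase * corput_root n \<or>
      corput_phase * corput_root m = cnj (corput_phase * corput_root n)"
    unfolding node_def by (intro unit_eq_Re_imp) (simp_all add: norm_mult)
  moreover have "corput_phase \<noteq> 0" using norm_corput_phase by (metis norm_zero zero_neq_one)
  moreover have False if eq: "corput_phase * corput_root m = cnj (corput_phase * corput_root n)"
  proof -
    have "corput_phase * corput_root n * (corput_phase * corput_root m) = 1"
      unfolding eq complex_norm_square[symmetric] by (simp add: norm_mult)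
    then have "(corput_phase\<^sup>2 * (corput_root m * corput_root n)) ^ (2 ^ (m + n)) = 1"
      by (simp add: power2_eq_square mult_ac)
    then have "corput_phase ^ (2 ^ Suc (m + n)) *
        (corput_root (m div 2 ^ (m + n)) * corput_root (n div 2 ^ (m + n))) = 1"
      by (simp add: power_mult_distrib corput_root_power flip: power_mult)
    moreover have "m < 2 ^ (m + n)" "n < 2 ^ (m + n)"
      by (meson le_add1 le_add2 le_less_trans less_exp)+
    ultimately show False using corput_phase_power_neq_1[of "Suc (m + n)"] by simp
  qed
  ultimately show "m = n" using inj_corput_root by auto
qed

lemma node_in: "node n \<in> {-1..1}"
  using abs_Re_le_cmod[of "corput_phase * corput_root n"]
  by (simp add: node_def norm_mult abs_le_iff)

section \<open>Products over initial segments of the circle points\<close>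

lemma prod_lessThan_double:
  fixes f :: "nat \<Rightarrow> 'a::comm_monoid_mult"
  shows "(\<Prod>i<2 * k. f i) = (\<Prod>i<k. f (2 * i) * f (Suc (2 * i)))"
proof (induction k)
  case (Suc k)
  have "2 * Suc k = Suc (Suc (2 * k))" by simp
  with Suc show ?case by (simp only: prod.lessThan_Suc mult.assoc)
qed simp

lemma corput_prod_even:
  "(\<Prod>i<2 * k. w - c * corput_root i) = (\<Prod>i<k. w\<^sup>2 - c\<^sup>2 * corput_root i)"
proof -
  have "(w - c * corput_root (2 * i)) * (w - c * corput_root (Suc (2 * i))) =
      w\<^sup>2 - c\<^sup>2 * (csqrt (corput_root i))\<^sup>2" for i
    by (simp only: corput_root_even corput_root_odd) (simp add: algebra_simps power2_eq_square del: power2_csqrt)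
  then show ?thesis by (simp add: prod_lessThan_double)
qed

lemma corput_prod_odd:
  "(\<Prod>i<Suc (2 * k). w - c * corput_root i) =
    (\<Prod>i<k. w\<^sup>2 - c\<^sup>2 * corput_root i) * (w - c * corput_root (2 * k))"
  unfolding prod.lessThan_Suc corput_prod_even by (rule refl)

lemma nat_binary_induct [case_names 0 even odd]:
  fixes n :: nat
  assumes "P 0" "\<And>n. 0 < n \<Longrightarrow> P n \<Longrightarrow> P (2 * n)" "\<And>n. P n \<Longrightarrow> P (Suc (2 * n))"
  shows "P n"
proof (induction n rule: less_induct)
  case (less n)
  then show ?case
    by (cases "n = 0"; cases "even n") (auto simp: assms elim!: evenE oddE)
qed

text \<open>Induction on binary digits: halving the length squares \<open>w\<close> and
  \<open>c\<close>, so both must be generalised. Only an odd length costs a factor, at most 2, and 2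
  (n + 1) is exactly the bound for length 2 n + 1.\<close>

lemma norm_corput_prod_le:
  assumes "norm w = 1" "norm c = 1"
  shows "norm (\<Prod>i<k. w - c * corput_root i) \<le> real (Suc k)"
  using assms
proof (induction k arbitrary: w c rule: nat_binary_induct)
  case (even n)
  have "norm (\<Prod>i<n. w\<^sup>2 - c\<^sup>2 * corput_root i) \<le> real (Suc n)"
    by (rule even) (simp_all add: even norm_power)
  then show ?case unfolding corput_prod_even by simp
next
  case (odd n)
  have 1: "norm (\<Prod>i<n. w\<^sup>2 - c\<^sup>2 * corput_root i) \<le> real (Suc n)"
    by (rule odd) (simp_all add: odd norm_power)
  have 2: "norm (w - c * corput_root (2 * n)) \<le> 2"
    using norm_triangle_ineq4[of w "c * corput_root (2 * n)"] odd by (simp add: norm_mult)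
  show ?case unfolding corput_prod_odd norm_mult
    using mult_mono[OF 1 2] by simp
qed simp

text \<open>The extra factor of an odd length is at least \<open>norm w - 1\<close>, hence at least
  \<open>(1 / 2) ^ m * norm w\<close>. Since 2 n + 2 = 2 (n + 1), the loss
  \<open>(1 / 2) ^ m\<close> is absorbed by the denominator, and the total loss stays polynomial in
  k. Squaring only enlarges \<open>norm w\<close>, so one \<open>m\<close> serves all
  levels.\<close>

lemma norm_corput_prod_ge:
  assumes "norm w \<ge> \<rho>" "\<rho> > 1" "norm c = 1" "(1 / 2) ^ m \<le> 1 - 1 / \<rho>"
  shows "norm (\<Prod>i<k. w - c * corput_root i) \<ge> norm w ^ k / real (Suc k) ^ m"
  using assms
proof (induction k arbitrary: w c rule: nat_binary_induct)
  case (even n)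
  have "\<rho> \<le> norm (w\<^sup>2)"
    using even.prems mult_mono[of 1 "norm w" \<rho> "norm w"] by (simp add: norm_mult power2_eq_square)
  then have "norm (\<Prod>i<n. w\<^sup>2 - c\<^sup>2 * corput_root i) \<ge> norm (w\<^sup>2) ^ n / real (Suc n) ^ m"
    using even.prems by (intro even.IH) (simp_all add: norm_power)
  moreover have "norm w ^ (2 * n) / real (Suc (2 * n)) ^ m \<le> norm (w\<^sup>2) ^ n / real (Suc n) ^ m"
    by (simp add: norm_power flip: power_mult) (intro divide_left_mono power_mono mult_pos_pos; simp)
  ultimately show ?case unfolding corput_prod_even by simp
next
  case (odd n)
  have "\<rho> \<le> norm (w\<^sup>2)"
    using odd.prems mult_mono[of 1 "norm w" \<rho> "norm w"] by (simp add: norm_mult power2_eq_square)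
  then have 1: "norm (\<Prod>i<n. w\<^sup>2 - c\<^sup>2 * corput_root i) \<ge> norm (w\<^sup>2) ^ n / real (Suc n) ^ m"
    using odd.prems by (intro odd.IH) (simp_all add: norm_power)
  have w: "norm w > 1" using odd.prems by simp
  have "1 / norm w \<le> 1 / \<rho>" using odd.prems by (intro frac_le) auto
  then have "(1 / 2) ^ m \<le> 1 - 1 / norm w" using odd.prems by simp
  then have "(1 / 2) ^ m * norm w \<le> (1 - 1 / norm w) * norm w" by (intro mult_right_mono) auto
  also have "\<dots> = norm w - 1"
    using w by (subst left_diff_distrib) auto
  also have "\<dots> \<le> norm (w - c * corput_root (2 * n))"
    using norm_triangle_ineq2[of w "c * corput_root (2 * n)"] odd.prems by (simp add: norm_mult)
  finally have 2: "norm (w - c * corput_root (2 * n)) \<ge> (1 / 2) ^ m * norm w" .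
  have "norm w ^ Suc (2 * n) / real (Suc (Suc (2 * n))) ^ m =
      norm (w\<^sup>2) ^ n / real (Suc n) ^ m * ((1 / 2) ^ m * norm w)"
  proof -
    have "real (Suc (Suc (2 * n))) = 2 * real (Suc n)" by simp
    then show ?thesis
      by (simp only: power_mult_distrib norm_power) (simp add: power_divide mult_ac flip: power_mult)
  qed
  also have "\<dots> \<le> norm (\<Prod>i<n. w\<^sup>2 - c\<^sup>2 * corput_root i) * norm (w - c * corput_root (2 * n))"
    by (intro mult_mono 1 2) auto
  finally show ?case unfolding corput_prod_odd norm_mult .
qed simp

section \<open>Nodal polynomials through the Joukowski map\<close>

definition nodal :: "(nat \<Rightarrow> 'a::comm_ring_1) \<Rightarrow> nat \<Rightarrow> 'a \<Rightarrow> 'a"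
  where "nodal \<xi> k x = (\<Prod>i<k. x - \<xi> i)"

abbreviation cnodal :: "(nat \<Rightarrow> real) \<Rightarrow> nat \<Rightarrow> complex \<Rightarrow> complex"
  where "cnodal \<xi> \<equiv> nodal (\<lambda>i. complex_of_real (\<xi> i))"

lemma of_real_nodal:
  "of_real (nodal \<xi> k x) = nodal (\<lambda>i. of_real (\<xi> i)) k (of_real x :: 'a::{comm_ring_1, real_algebra_1})"
  by (simp add: nodal_def)

text \<open>For e on the unit circle, z - Re e = (w - e) (w - cnj e) / (2 w). The second factor is
  the conjugate of cnj w - e, so both products run over the rotated circle points and are covered by
  the two estimates above.\<close>

lemma nodal_node_joukowski:
  assumes "w \<noteq> 0" "z = (w + 1 / w) / 2"
  shows "cnodal node k z =
    (\<Prod>i<k. w - corput_phase * corput_root i) *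
    cnj (\<Prod>i<k. cnj w - corput_phase * corput_root i) / (2 * w) ^ k"
proof -
  have "z - of_real (node i) =
      (w - corput_phase * corput_root i) * (w - cnj (corput_phase * corput_root i)) / (2 * w)" for i
  proof -
    define e where "e = corput_phase * corput_root i"
    have "e * cnj e = 1" unfolding e_def complex_norm_square[symmetric] by (simp add: norm_mult)
    moreover have "of_real (node i) = (e + cnj e) / 2"
      unfolding node_def e_def[symmetric] complex_add_cnj by simp
    ultimately show ?thesis
      unfolding e_def[symmetric] using assms
      by (simp add: field_simps power2_eq_square)
  qed
  then show ?thesis
    by (simp add: nodal_def prod.distrib prod_dividef prod_constant)
qed

text \<open>Points of the interval correspond to \<open>w\<close> on the unit circle, where each of
  the two circle products is at most k + 1.\<close>

lemma abs_nodal_node_le: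
  assumes "y \<in> {-1..1}"
  shows "\<bar>nodal node k y\<bar> \<le> real (Suc k) ^ 2 / 2 ^ k"
proof -
  define w where "w = cis (arccos y)"
  have w: "norm w = 1" "w \<noteq> 0" by (simp_all add: w_def)
  have "1 / w = cnj w" using w by (simp add: w_def cis_cnj divide_inverse cis_inverse)
  then have "complex_of_real y = (w + 1 / w) / 2"
    using assms by (simp add: complex_add_cnj w_def)
  then have "norm (complex_of_real (nodal node k y)) =
    norm (\<Prod>i<k. w - corput_phase * corput_root i) *
    norm (\<Prod>i<k. cnj w - corput_phase * corput_root i) / 2 ^ k"
    using w by (simp only: of_real_nodal nodal_node_joukowski norm_mult norm_divide norm_power complex_mod_cnj) simp
  also have "\<dots> \<le> real (Suc k) * real (Suc k) / 2 ^ k"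
    using w by (intro divide_right_mono mult_mono norm_corput_prod_le) auto
  finally show ?thesis by (simp add: power2_eq_square)
qed

lemma joukowski_surj:
  fixes z :: complex
  obtains w where "norm w \<ge> 1" "z = (w + 1 / w) / 2"
proof -
  define v where "v = z + csqrt (z\<^sup>2 - 1)"
  have "v * (z - csqrt (z\<^sup>2 - 1)) = 1"
    by (simp add: v_def algebra_simps flip: power2_eq_square)
  then have v: "v \<noteq> 0" "1 / v = z - csqrt (z\<^sup>2 - 1)"
    by (auto simp: divide_eq_eq) (simp add: mult.commute)
  then have zv: "z = (v + 1 / v) / 2" by (simp add: v_def)
  show ?thesis
  proof (cases "norm v \<ge> 1")
    case True then show ?thesis using that zv by blast
  next
    case False
    then have "norm (1 / v) \<ge> 1" using v by (simp add: norm_divide divide_simps)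
    moreover have "z = (1 / v + 1 / (1 / v)) / 2" using zv by simp
    ultimately show ?thesis using that by blast
  qed
qed

text \<open>The circle of radius R is mapped to an ellipse with semi-axes (R + 1 / R) / 2 and (R - 1
  / R) / 2. For R < 1 + \<kappa> these are smaller than 1 + \<kappa> and \<kappa>, so such a
  \<open>z\<close> would lie strictly inside the rectangle.\<close>

lemma joukowski_norm_ge:
  assumes "norm w \<ge> 1" "z = (w + 1 / w) / 2" "\<kappa> > 0" "\<bar>Im z\<bar> \<ge> \<kappa> \<or> \<bar>Re z\<bar> \<ge> 1 + \<kappa>"
  shows "norm w \<ge> 1 + \<kappa>"
proof -
  define R where "R = norm w"
  have R: "R \<ge> 1" using assms by (simp add: R_def)
  have w: "w \<noteq> 0" using assms by auto
  have inv: "1 / w = cnj w / of_real (R\<^sup>2)"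
    unfolding R_def using w complex_norm_square[of w] by (simp add: field_simps)
  have "Im z = Im w * (1 - 1 / R\<^sup>2) / 2" using w
    by (simp add: assms(2) inv) (simp add: algebra_simps R_def)
  moreover have "\<bar>1 - 1 / R\<^sup>2\<bar> = 1 - 1 / R\<^sup>2" using R by simp
  ultimately have "\<bar>Im z\<bar> = \<bar>Im w\<bar> * (1 - 1 / R\<^sup>2) / 2"
    by (metis abs_divide abs_mult abs_numeral)
  also have "\<dots> \<le> R * (1 - 1 / R\<^sup>2) / 2"
  proof (intro divide_right_mono mult_right_mono)
    show "\<bar>Im w\<bar> \<le> R" using abs_Im_le_cmod[of w] by (simp add: R_def)
    show "0 \<le> 1 - 1 / R\<^sup>2" using R by (simp add: divide_le_eq)
  qed simp
  also have "\<dots> = (R - 1 / R) / 2" using R by (simp add: field_simps power2_eq_square)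
  finally have im: "2 * \<bar>Im z\<bar> \<le> R - 1 / R" by simp
  have "2 * \<bar>Re z\<bar> \<le> norm (w + 1 / w)"
    using abs_Re_le_cmod[of "w + 1 / w"] by (simp add: assms(2))
  also have "\<dots> \<le> R + 1 / R" using norm_triangle_ineq[of w "1 / w"] by (simp add: R_def norm_divide)
  finally have re: "2 * \<bar>Re z\<bar> \<le> R + 1 / R" .
  have r1: "1 / R \<le> 1" using R by simp
  have "R \<ge> 1 + \<kappa>"
  proof (rule ccontr)
    assume "\<not> ?thesis"
    then have lt: "R < 1 + \<kappa>" by simp
    from assms(4) show False
    proof
      assume "\<bar>Im z\<bar> \<ge> \<kappa>"
      with im have "2 * \<kappa> \<le> R - 1 / R" by simp
      then have "2 * \<kappa> * R \<le> R * R - 1" using R by (simp add: field_simps)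
      also have "\<dots> = (R - 1) * (R + 1)" by (simp add: algebra_simps)
      also have "\<dots> \<le> (R - 1) * (2 * R)" using R by (intro mult_left_mono) auto
      finally have "\<kappa> \<le> R - 1" using R by (simp add: mult.commute mult.left_commute)
      with lt show False by simp
    next
      assume "\<bar>Re z\<bar> \<ge> 1 + \<kappa>"
      with re r1 lt assms(3) show False by linarith
    qed
  qed
  then show ?thesis by (simp add: R_def)
qed

lemma norm_nodal_node_ge:
  assumes "\<kappa> > 0" "\<bar>Im z\<bar> \<ge> \<kappa> \<or> \<bar>Re z\<bar> \<ge> 1 + \<kappa>" "(1 / 2) ^ m \<le> 1 - 1 / (1 + \<kappa>)"
  shows "norm (cnodal node k z) \<ge> ((1 + \<kappa>) / 2) ^ k / real (Suc k) ^ (2 * m)"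
proof -
  obtain w where w: "norm w \<ge> 1" "z = (w + 1 / w) / 2" using joukowski_surj .
  have wk: "norm w \<ge> 1 + \<kappa>" using joukowski_norm_ge[OF w assms(1,2)] .
  have w0: "w \<noteq> 0" using w by auto
  have ge: "norm v ^ k / real (Suc k) ^ m \<le> norm (\<Prod>i<k. v - corput_phase * corput_root i)"
    if "norm v = norm w" for v
    by (rule norm_corput_prod_ge[of "1 + \<kappa>"]) (use assms wk that in auto)
  have "((1 + \<kappa>) / 2) ^ k / real (Suc k) ^ (2 * m) \<le> (norm w / 2) ^ k / real (Suc k) ^ (2 * m)"
    using wk assms(1) by (intro divide_right_mono power_mono) auto
  also have "\<dots> = (norm w ^ k / real (Suc k) ^ m) * (norm (cnj w) ^ k / real (Suc k) ^ m) / (2 * norm w) ^ k"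
  proof -
    have "real (Suc k) ^ (2 * m) = real (Suc k) ^ m * real (Suc k) ^ m"
      by (simp add: mult_2 power_add)
    then show ?thesis using w0 by (simp add: power_divide power_mult_distrib)
  qed
  also have "\<dots> \<le> norm (\<Prod>i<k. w - corput_phase * corput_root i) *
    norm (\<Prod>i<k. cnj w - corput_phase * corput_root i) / (2 * norm w) ^ k"
    by (intro divide_right_mono mult_mono ge) auto
  also have "\<dots> = norm (cnodal node k z)"
    by (simp only: nodal_node_joukowski[OF w0 w(2)] norm_mult norm_divide norm_power complex_mod_cnj) simp
  finally show ?thesis .
qed

section \<open>Newton interpolation of holomorphic functions\<close>

text \<open>The weight of the value at node \<open>i\<close> in the divided difference over nodes 0
  to k, multiplied by the nodal polynomial. The value 0 for i > k lets the identity with Lagrange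
  polynomials hold for every \<open>i\<close>.\<close>

definition newton_basis :: "(nat \<Rightarrow> real) \<Rightarrow> nat \<Rightarrow> nat \<Rightarrow> real \<Rightarrow> real"
  where "newton_basis \<xi> k i y =
    (if i \<le> k then nodal \<xi> k y / (\<Prod>l\<in>{..k} - {i}. \<xi> i - \<xi> l) else 0)"

text \<open>In the induction step every product of two simple poles is split; the residues collected
  at the new point \<open>a\<close> are the induction hypothesis evaluated at
  \<open>\<xi> a\<close>.\<close>

lemma partial_fractions_simple:
  fixes \<xi> :: "'i \<Rightarrow> 'a::field"
  assumes "finite A" "A \<noteq> {}" "inj_on \<xi> A" "z \<notin> \<xi> ` A"
  shows "1 / (\<Prod>i\<in>A. z - \<xi> i) = (\<Sum>i\<in>A. 1 / ((z - \<xi> i) * (\<Prod>l\<in>A - {i}. \<xi> i - \<xi> l)))"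
  using assms
proof (induction A arbitrary: z rule: finite_ne_induct)
  case (insert a A)
  define c where "c i = 1 / (\<Prod>l\<in>A - {i}. \<xi> i - \<xi> l)" for i
  have inj: "inj_on \<xi> A" and a: "\<xi> a \<notin> \<xi> ` A"
    using insert.prems insert.hyps by (auto simp: inj_on_def)
  have za: "z \<noteq> \<xi> a" "z \<notin> \<xi> ` A" using insert.prems by auto
  have ne: "\<xi> i \<noteq> \<xi> a" "z \<noteq> \<xi> i" if "i \<in> A" for i using that a za by (metis imageI, metis imageI)
  have IH: "1 / (\<Prod>i\<in>A. y - \<xi> i) = (\<Sum>i\<in>A. c i / (y - \<xi> i))" if "y \<notin> \<xi> ` A" for y
    using insert.IH[OF inj that] by (simp add: c_def mult.commute)
  have "1 / (\<Prod>i\<in>insert a A. z - \<xi> i) = (\<Sum>i\<in>A. c i / (z - \<xi> i)) / (z - \<xi> a)"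
    using insert.hyps IH[OF za(2)] by (simp add: divide_simps)
  also have "\<dots> = (\<Sum>i\<in>A. c i / (\<xi> i - \<xi> a) / (z - \<xi> i) + c i / (\<xi> a - \<xi> i) / (z - \<xi> a))"
    unfolding sum_divide_distrib
  proof (rule sum.cong[OF refl])
    fix i assume "i \<in> A"
    note ne = ne[OF this]
    have e: "c i / (\<xi> a - \<xi> i) = - (c i / (\<xi> i - \<xi> a))"
      by (metis minus_diff_eq minus_divide_right)
    have "z - \<xi> i \<noteq> 0" "z - \<xi> a \<noteq> 0" "\<xi> i - \<xi> a \<noteq> 0" using ne za by auto
    then show "c i / (z - \<xi> i) / (z - \<xi> a) =
      c i / (\<xi> i - \<xi> a) / (z - \<xi> i) + c i / (\<xi> a - \<xi> i) / (z - \<xi> a)"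
      unfolding e by (simp add: divide_simps) (simp add: algebra_simps)
  qed
  also have "\<dots> = (\<Sum>i\<in>A. c i / (\<xi> i - \<xi> a) / (z - \<xi> i)) + (\<Sum>i\<in>A. c i / (\<xi> a - \<xi> i)) / (z - \<xi> a)"
    by (simp add: sum.distrib sum_divide_distrib)
  also have "(\<Sum>i\<in>A. c i / (\<xi> a - \<xi> i)) = 1 / (\<Prod>i\<in>A. \<xi> a - \<xi> i)"
    by (rule IH[OF a, symmetric])
  also have "(\<Sum>i\<in>A. c i / (\<xi> i - \<xi> a) / (z - \<xi> i)) =
      (\<Sum>i\<in>A. 1 / ((z - \<xi> i) * (\<Prod>l\<in>insert a A - {i}. \<xi> i - \<xi> l)))"
  proof (rule sum.cong[OF refl])
    fix i assume i: "i \<in> A"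
    then have "insert a A - {i} = insert a (A - {i})" using insert.hyps by auto
    then show "c i / (\<xi> i - \<xi> a) / (z - \<xi> i) =
        1 / ((z - \<xi> i) * (\<Prod>l\<in>insert a A - {i}. \<xi> i - \<xi> l))"
      using insert.hyps by (simp add: c_def mult_ac)
  qed
  finally show ?case
    using insert.hyps by (simp add: add.commute mult.commute)
qed simp

text \<open>Newton expansion of the Cauchy kernel with exact remainder, obtained by iterating 1 / (z
  - y) = 1 / (z - \<xi>) + (y - \<xi>) / ((z - \<xi>) (z - y)) over the nodes.\<close>

lemma nodal_expansion:
  fixes \<xi> :: "nat \<Rightarrow> 'a::field"
  assumes "z \<noteq> y" "\<And>k. z \<noteq> \<xi> k"
  shows "1 / (z - y) = (\<Sum>k<K. nodal \<xi> k y / nodal \<xi> (Suc k) z) + nodal \<xi> K y / (nodal \<xi> K z * (z - y))"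
proof (induction K)
  case (Suc K)
  have n: "nodal \<xi> k z \<noteq> 0" for k using assms by (simp add: nodal_def)
  have "nodal \<xi> K y / (nodal \<xi> K z * (z - y)) =
     nodal \<xi> K y / nodal \<xi> (Suc K) z + nodal \<xi> (Suc K) y / (nodal \<xi> (Suc K) z * (z - y))"
    using assms n[of K] by (simp add: nodal_def divide_simps) (simp add: algebra_simps)
  with Suc show ?case by simp
qed (simp add: nodal_def)

section \<open>Contour estimates for Newton terms\<close>

definition rectangle :: "real \<Rightarrow> complex set"
  where "rectangle \<kappa> = cbox (Complex (- 1 - \<kappa>) (- \<kappa>)) (Complex (1 + \<kappa>) \<kappa>)"

definition rectangle_path :: "real \<Rightarrow> real \<Rightarrow> complex"
  where "rectangle_path \<kappa> = rectpath (Complex (- 1 - \<kappa>) (- \<kappa>)) (Complex (1 + \<kappa>) \<kappa>)"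

lemma in_rectangle_iff: "z \<in> rectangle \<kappa> \<longleftrightarrow> \<bar>Re z\<bar> \<le> 1 + \<kappa> \<and> \<bar>Im z\<bar> \<le> \<kappa>"
  by (auto simp: rectangle_def in_cbox_complex_iff)

lemma of_real_in_interior_rectangle:
  assumes "\<kappa> > 0" "y \<in> {-1..1}"
  shows "complex_of_real y \<in> interior (rectangle \<kappa>)"
  using assms by (auto simp: rectangle_def interior_cbox in_box_complex_iff)

lemma path_image_rectangle_path:
  assumes "\<kappa> > 0"
  shows "path_image (rectangle_path \<kappa>) = rectangle \<kappa> - box (Complex (- 1 - \<kappa>) (- \<kappa>)) (Complex (1 + \<kappa>) \<kappa>)"
  using assms unfolding rectangle_path_def rectangle_def
  by (subst path_image_rectpath_cbox_minus_box) auto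

lemma rectangle_path_boundary:
  assumes "\<kappa> > 0" "z \<in> path_image (rectangle_path \<kappa>)"
  shows "\<bar>Im z\<bar> \<ge> \<kappa> \<or> \<bar>Re z\<bar> \<ge> 1 + \<kappa>"
  using assms by (auto simp: path_image_rectangle_path in_box_complex_iff)

lemma rectangle_path_dist:
  assumes "\<kappa> > 0" "z \<in> path_image (rectangle_path \<kappa>)" "y \<in> {-1..1}"
  shows "norm (z - of_real y) \<ge> \<kappa>"
proof -
  have "\<bar>Re (z - of_real y)\<bar> \<ge> \<kappa> \<or> \<bar>Im (z - of_real y)\<bar> \<ge> \<kappa>"
    using rectangle_path_boundary[OF assms(1,2)] assms(3) by auto
  then show ?thesis
    using abs_Re_le_cmod[of "z - of_real y"] abs_Im_le_cmod[of "z - of_real y"] by linarith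
qed

text \<open>The length estimate, side by side; \<open>4 + 8 * \<kappa>\<close> is the
  perimeter.\<close>

lemma contour_integral_rectangle_path_bound:
  assumes int: "(f has_contour_integral i) (rectangle_path \<kappa>)" and "\<kappa> > 0"
    and B: "\<And>z. z \<in> path_image (rectangle_path \<kappa>) \<Longrightarrow> norm (f z) \<le> B"
  shows "norm i \<le> B * (4 + 8 * \<kappa>)"
proof -
  define a1 where "a1 = Complex (- 1 - \<kappa>) (- \<kappa>)"
  define a2 where "a2 = Complex (1 + \<kappa>) (- \<kappa>)"
  define a3 where "a3 = Complex (1 + \<kappa>) \<kappa>"
  define a4 where "a4 = Complex (- 1 - \<kappa>) \<kappa>"
  have path: "rectangle_path \<kappa> =
      linepath a1 a2 +++ linepath a2 a3 +++ linepath a3 a4 +++ linepath a4 a1"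
    by (simp add: rectangle_path_def rectpath_def Let_def a1_def a2_def a3_def a4_def)
  have f: "f contour_integrable_on (linepath a1 a2 +++ linepath a2 a3 +++ linepath a3 a4 +++ linepath a4 a1)"
    using int path by (metis contour_integrable_on_def)
  then have f12: "f contour_integrable_on linepath a1 a2"
    and f23: "f contour_integrable_on linepath a2 a3"
    and f34: "f contour_integrable_on linepath a3 a4"
    and f41: "f contour_integrable_on linepath a4 a1"
    by auto
  have img: "path_image (rectangle_path \<kappa>) =
      closed_segment a1 a2 \<union> closed_segment a2 a3 \<union> closed_segment a3 a4 \<union> closed_segment a4 a1"
    by (simp add: path path_image_join Un_assoc)
  have "a1 \<in> path_image (rectangle_path \<kappa>)" by (simp add: img)
  then have B0: "0 \<le> B" using B norm_ge_zero order_trans by blast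
  have i: "i = contour_integral (linepath a1 a2) f + (contour_integral (linepath a2 a3) f +
      (contour_integral (linepath a3 a4) f + contour_integral (linepath a4 a1) f))"
    using contour_integral_unique[OF int] unfolding path
    by (simp add: f12 f23 f34 f41)
  have "norm i \<le> B * norm (a2 - a1) + (B * norm (a3 - a2) + (B * norm (a4 - a3) + B * norm (a1 - a4)))"
    unfolding i
    by (intro norm_triangle_mono contour_integral_bound_linepath f12 f23 f34 f41 B0)
      (auto intro: B simp: img)
  also have "\<dots> = B * (4 + 8 * \<kappa>)"
  proof -
    have "norm (a2 - a1) = 2 + 2 * \<kappa>" "norm (a4 - a3) = 2 + 2 * \<kappa>"
      "norm (a3 - a2) = 2 * \<kappa>" "norm (a1 - a4) = 2 * \<kappa>"
      using \<open>\<kappa> > 0\<close> by (simp_all add: a1_def a2_def a3_def a4_def complex_diff cmod_eq_Re cmod_eq_Im)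
    then show ?thesis by (simp add: algebra_simps)
  qed
  finally show ?thesis .
qed

lemma Cauchy_integral_rectangle_path:
  assumes "f holomorphic_on rectangle \<kappa>" "\<kappa> > 0" "y \<in> {-1..1}"
  shows "((\<lambda>z. f z / (z - of_real y)) has_contour_integral (2 * pi * \<i> * f (of_real y))) (rectangle_path \<kappa>)"
proof -
  have int: "complex_of_real y \<in> interior (rectangle \<kappa>)"
    using assms by (intro of_real_in_interior_rectangle)
  have "((\<lambda>z. f z / (z - of_real y)) has_contour_integral
      (2 * pi * \<i> * winding_number (rectangle_path \<kappa>) (of_real y) * f (of_real y))) (rectangle_path \<kappa>)"
  proof (rule Cauchy_integral_formula_convex_simple[OF _ assms(1) int])
    show "path_image (rectangle_path \<kappa>) \<subseteq> rectangle \<kappa> - {complex_of_real y}"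
      using int assms(2)
      by (auto simp: path_image_rectangle_path rectangle_def interior_cbox)
  qed (auto simp: rectangle_def rectangle_path_def valid_path_rectpath)
  moreover have "winding_number (rectangle_path \<kappa>) (of_real y) = 1"
    using int unfolding rectangle_path_def rectangle_def interior_cbox
    by (intro winding_number_rectpath) auto
  ultimately show ?thesis by simp
qed

definition newton_term :: "(nat \<Rightarrow> real) \<Rightarrow> nat \<Rightarrow> (real \<Rightarrow> complex) \<Rightarrow> real \<Rightarrow> complex"
  where "newton_term \<xi> k f y = (\<Sum>i\<le>k. of_real (newton_basis \<xi> k i y) * f (\<xi> i))"

text \<open>Hermite's contour formula for divided differences: partial fractions write the kernel as
  a combination of Cauchy kernels at the nodes, each of which reproduces one function value.\<close>

lemma newton_term_contour_integral:
  assumes hol: "f holomorphic_on rectangle \<kappa>" and \<kappa>: "\<kappa> > 0"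
    and inj: "inj \<xi>" and \<xi>: "range \<xi> \<subseteq> {-1..1}"
  shows "((\<lambda>z. f z * (of_real (nodal \<xi> k y) / cnodal \<xi> (Suc k) z)) has_contour_integral
    (2 * pi * \<i> * newton_term \<xi> k (\<lambda>x. f (of_real x)) y)) (rectangle_path \<kappa>)"
proof -
  define c where "c i = complex_of_real (newton_basis \<xi> k i y)" for i
  have "((\<lambda>z. \<Sum>i\<in>{..k}. c i * (f z / (z - of_real (\<xi> i)))) has_contour_integral
    (\<Sum>i\<in>{..k}. c i * (2 * pi * \<i> * f (of_real (\<xi> i))))) (rectangle_path \<kappa>)"
    by (intro has_contour_integral_sum has_contour_integral_lmul Cauchy_integral_rectangle_path hol \<kappa>
        subsetD[OF \<xi>] rangeI finite_atMost)
  moreover have "(\<Sum>i\<in>{..k}. c i * (2 * pi * \<i> * f (of_real (\<xi> i)))) =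
      2 * pi * \<i> * newton_term \<xi> k (\<lambda>x. f (of_real x)) y"
    by (simp add: newton_term_def c_def sum_distrib_left mult_ac)
  moreover have "(\<Sum>i\<in>{..k}. c i * (f z / (z - of_real (\<xi> i)))) =
      f z * (of_real (nodal \<xi> k y) / cnodal \<xi> (Suc k) z)"
    if "z \<in> path_image (rectangle_path \<kappa>)" for z
  proof -
    have ne: "z \<noteq> of_real (\<xi> i)" for i
      using rectangle_path_dist[OF \<kappa> that subsetD[OF \<xi> rangeI[of \<xi> i]]] \<kappa> by auto
    have "1 / cnodal \<xi> (Suc k) z =
        (\<Sum>i\<in>{..k}. 1 / ((z - of_real (\<xi> i)) * (\<Prod>l\<in>{..k} - {i}. complex_of_real (\<xi> i) - of_real (\<xi> l))))"
      unfolding nodal_def lessThan_Suc_atMost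
      by (rule partial_fractions_simple) (use ne inj in \<open>auto simp: inj_on_def\<close>)
    then have "f z * of_real (nodal \<xi> k y) * (1 / cnodal \<xi> (Suc k) z) =
        (\<Sum>i\<in>{..k}. c i * (f z / (z - of_real (\<xi> i))))"
      by (simp add: c_def newton_basis_def sum_distrib_left mult_ac)
    then show ?thesis by simp
  qed
  ultimately show ?thesis
    by (simp only:) (erule has_contour_integral_eq, blast)
qed

text \<open>The factor \<open>1 + 2 * \<kappa>\<close> is the perimeter divided by 4, as 2 pi is at
  least 4.\<close>

lemma norm_newton_term_le:
  assumes hol: "f holomorphic_on rectangle \<kappa>" and \<kappa>: "\<kappa> > 0"
    and inj: "inj \<xi>" and \<xi>: "range \<xi> \<subseteq> {-1..1}"
    and M: "\<And>z. z \<in> rectangle \<kappa> \<Longrightarrow> norm (f z) \<le> M"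
    and q: "\<And>z. z \<in> path_image (rectangle_path \<kappa>) \<Longrightarrow>
      \<bar>nodal \<xi> k y\<bar> / norm (cnodal \<xi> (Suc k) z) \<le> q"
  shows "norm (newton_term \<xi> k (\<lambda>x. f (of_real x)) y) \<le> M * q * (1 + 2 * \<kappa>)"
proof -
  have sub: "path_image (rectangle_path \<kappa>) \<subseteq> rectangle \<kappa>"
    using \<kappa> by (auto simp: path_image_rectangle_path)
  have M0: "0 \<le> M" using order_trans[OF norm_ge_zero M[of 0]] \<kappa> by (simp add: in_rectangle_iff)
  have b: "norm (2 * pi * \<i> * newton_term \<xi> k (\<lambda>x. f (of_real x)) y) \<le> M * q * (4 + 8 * \<kappa>)"
  proof (rule contour_integral_rectangle_path_bound[OF newton_term_contour_integral[OF hol \<kappa> inj \<xi>] \<kappa>])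
    fix z assume z: "z \<in> path_image (rectangle_path \<kappa>)"
    show "norm (f z * (of_real (nodal \<xi> k y) / cnodal \<xi> (Suc k) z)) \<le> M * q"
      unfolding norm_mult using M[of z] q[OF z] z sub M0
      by (intro mult_mono) (auto simp: norm_divide)
  qed
  have "rectangle_path \<kappa> 0 \<in> path_image (rectangle_path \<kappa>)" by (simp add: path_image_def)
  then have "0 \<le> q" using q by (meson abs_ge_zero divide_nonneg_nonneg norm_ge_zero order_trans)
  then have 0: "0 \<le> M * q * (4 + 8 * \<kappa>)" using M0 \<kappa> by simp
  have "norm (2 * pi * \<i> * newton_term \<xi> k (\<lambda>x. f (of_real x)) y) =
      (2 * pi) * norm (newton_term \<xi> k (\<lambda>x. f (of_real x)) y)"
    by (simp add: norm_mult)
  moreover have "4 * norm (newton_term \<xi> k (\<lambda>x. f (of_real x)) y) \<le>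
      (2 * pi) * norm (newton_term \<xi> k (\<lambda>x. f (of_real x)) y)"
    using pi_ge_two by (intro mult_right_mono) auto
  ultimately show ?thesis using b by (simp add: algebra_simps)
qed

text \<open>Each numerator factor is at most 2 and each denominator factor at least \<kappa>. The
  remaining factor (1 + 2 \<kappa>) / \<kappa> is at most 3, hence at most \<open>3 ^ k\<close>
  because k is positive. Folding it into the power leaves no leading constant, so the bound may be
  multiplied over any number of coordinates.\<close>

lemma norm_newton_term_le_crude:
  assumes hol: "f holomorphic_on rectangle \<kappa>" and \<kappa>: "\<kappa> \<ge> 1"
    and inj: "inj \<xi>" and \<xi>: "range \<xi> \<subseteq> {-1..1}"
    and M: "\<And>z. z \<in> rectangle \<kappa> \<Longrightarrow> norm (f z) \<le> M"
    and y: "y \<in> {-1..1}" and k: "k \<ge> 1"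
  shows "norm (newton_term \<xi> k (\<lambda>x. f (of_real x)) y) \<le> M * (6 / \<kappa>) ^ k"
proof -
  have \<kappa>0: "\<kappa> > 0" using \<kappa> by simp
  have "norm (newton_term \<xi> k (\<lambda>x. f (of_real x)) y) \<le> M * (2 ^ k / \<kappa> ^ Suc k) * (1 + 2 * \<kappa>)"
  proof (rule norm_newton_term_le[OF hol \<kappa>0 inj \<xi> M])
    fix z assume z: "z \<in> path_image (rectangle_path \<kappa>)"
    have "\<bar>nodal \<xi> k y\<bar> \<le> (\<Prod>i<k. 2)"
      unfolding nodal_def abs_prod
    proof (intro prod_mono conjI abs_ge_zero)
      fix i
      have "\<xi> i \<in> {-1..1}" using \<xi> by blast
      then show "\<bar>y - \<xi> i\<bar> \<le> 2" using y by auto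
    qed
    moreover have "(\<Prod>i<Suc k. \<kappa>) \<le> norm (cnodal \<xi> (Suc k) z)"
      unfolding nodal_def prod_norm[symmetric]
      by (intro prod_mono conjI rectangle_path_dist[OF \<kappa>0 z] subsetD[OF \<xi>] rangeI)
        (use \<kappa>0 in auto)
    ultimately show "\<bar>nodal \<xi> k y\<bar> / norm (cnodal \<xi> (Suc k) z) \<le> 2 ^ k / \<kappa> ^ Suc k"
      using \<kappa>0 by (intro frac_le) (auto simp del: power_Suc)
  qed
  also have "\<dots> = M * ((2 / \<kappa>) ^ k * ((1 + 2 * \<kappa>) / \<kappa>))"
    using \<kappa>0 by (simp add: power_divide mult_ac)
  also have "\<dots> \<le> M * ((2 / \<kappa>) ^ k * 3 ^ k)"
  proof (intro mult_left_mono)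
    have "(1 + 2 * \<kappa>) / \<kappa> \<le> 3" using \<kappa> by (simp add: field_simps)
    also have "(3::real) \<le> 3 ^ k" using k by (simp add: self_le_power)
    finally show "(1 + 2 * \<kappa>) / \<kappa> \<le> 3 ^ k" .
    show "0 \<le> M" using order_trans[OF norm_ge_zero M[of 0]] \<kappa> by (simp add: in_rectangle_iff)
  qed (use \<kappa>0 in auto)
  also have "\<dots> = M * (6 / \<kappa>) ^ k" by (simp flip: power_mult_distrib)
  finally show ?thesis .
qed

text \<open>The quotient decays like \<open>(1 + \<kappa>) ^ k\<close> in the denominator, up to
  polynomial factors; with \<theta> the square root of 1 / (1 + \<kappa>), half of the decay is
  spent on absorbing them. The case l = k + 1 serves the Newton terms, l = k the remainder of the
  Newton series.\<close>

lemma nodal_quotient_decay: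
  assumes \<kappa>: "\<kappa> > 0"
  obtains C \<theta> where "C \<ge> 1" "0 < \<theta>" "\<theta> < 1"
    "\<And>k l y z. y \<in> {-1..1} \<Longrightarrow> z \<in> path_image (rectangle_path \<kappa>) \<Longrightarrow> l \<in> {k, Suc k} \<Longrightarrow>
      \<bar>nodal node k y\<bar> / norm (cnodal node l z) \<le> C * \<theta> ^ k"
proof -
  have "1 - 1 / (1 + \<kappa>) > 0" using \<kappa> by simp
  then obtain m where m: "(1 / 2) ^ m < 1 - 1 / (1 + \<kappa>)"
    using real_arch_pow_inv[of "1 - 1 / (1 + \<kappa>)" "1 / 2 :: real"] by auto
  define \<theta> where "\<theta> = 1 / sqrt (1 + \<kappa>)"
  have \<theta>: "0 < \<theta>" "\<theta> < 1" using \<kappa> by (auto simp: \<theta>_def)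
  have \<theta>2: "\<theta>\<^sup>2 = 1 / (1 + \<kappa>)" using \<kappa> by (simp add: \<theta>_def power_divide)
  \<comment> \<open>Degree 2 comes from the upper bound on the numerator, 2 m from the lower bound
    on the denominator.\<close>
  define p where "p = 2 + 2 * m"
  have "(\<lambda>k. real (Suc (Suc k)) ^ p * \<theta> ^ k) \<longlonglongrightarrow> 0"
  proof -
    have "(\<lambda>k. real k ^ p * \<theta> ^ k) \<longlonglongrightarrow> 0"
      using \<theta> by real_asymp
    then have "(\<lambda>k. real (k + 2) ^ p * \<theta> ^ (k + 2)) \<longlonglongrightarrow> 0" by (rule LIMSEQ_ignore_initial_segment)
    then have "(\<lambda>k. (1 / \<theta>\<^sup>2) * (real (k + 2) ^ p * \<theta> ^ (k + 2))) \<longlonglongrightarrow> (1 / \<theta>\<^sup>2) * 0"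
      by (intro tendsto_mult tendsto_const)
    then show ?thesis using \<theta> by (simp add: power_add power2_eq_square add.commute field_simps)
  qed
  then have "Bseq (\<lambda>k. real (Suc (Suc k)) ^ p * \<theta> ^ k)" by (intro convergent_imp_Bseq convergentI)
  then obtain D where D: "D > 0" "\<And>k. norm (real (Suc (Suc k)) ^ p * \<theta> ^ k) \<le> D"
    by (auto simp: Bseq_def)
  have main: "\<bar>nodal node k y\<bar> / norm (cnodal node l z) \<le> max 1 (2 * D) * \<theta> ^ k"
    if y: "y \<in> {-1..1}" and z: "z \<in> path_image (rectangle_path \<kappa>)" and l: "l \<in> {k, Suc k}" for k l y z
  proof -
    have g: "((1 + \<kappa>) / 2) ^ l / real (Suc l) ^ (2 * m) \<le> norm (cnodal node l z)"
      by (rule norm_nodal_node_ge[OF \<kappa> rectangle_path_boundary[OF \<kappa> z]]) (use m in simp)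
    have sp: "real (Suc l) ^ (2 * m) > 0" by simp
    have pos: "((1 + \<kappa>) / 2) ^ l / real (Suc l) ^ (2 * m) > 0"
      using \<kappa> by (intro divide_pos_pos zero_less_power) auto
    have "\<bar>nodal node k y\<bar> / norm (cnodal node l z) \<le>
        (real (Suc k) ^ 2 / 2 ^ k) / (((1 + \<kappa>) / 2) ^ l / real (Suc l) ^ (2 * m))"
      by (intro frac_le abs_nodal_node_le y g pos) auto
    also have "\<dots> = real (Suc k) ^ 2 * real (Suc l) ^ (2 * m) * (2 ^ l / 2 ^ k) * (1 / (1 + \<kappa>) ^ l)"
      by (simp add: power_divide)
    also have "\<dots> \<le> real (Suc (Suc k)) ^ 2 * real (Suc (Suc k)) ^ (2 * m) * 2 * (1 / (1 + \<kappa>) ^ k)"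
      using l \<kappa> by (intro mult_mono power_mono divide_left_mono) (auto simp: mult_le_cancel_right1)
    also have "\<dots> = 2 * (real (Suc (Suc k)) ^ p * \<theta> ^ k) * \<theta> ^ k"
    proof -
      have "1 / (1 + \<kappa>) ^ k = \<theta> ^ k * \<theta> ^ k"
        using \<theta>2 by (metis power_mult_distrib power2_eq_square power_one_over)
      then show ?thesis by (simp add: p_def power_add power2_eq_square mult_ac)
    qed
    also have "\<dots> \<le> 2 * D * \<theta> ^ k"
      using D(2)[of k] \<theta> by (intro mult_right_mono mult_left_mono) auto
    also have "\<dots> \<le> max 1 (2 * D) * \<theta> ^ k" using \<theta> by (intro mult_right_mono) auto
    finally show ?thesis .
  qed
  show ?thesis by (rule that[OF _ \<theta> main]) auto
qed

lemma norm_newton_term_node_le: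
  assumes \<kappa>: "\<kappa> > 0"
  obtains C \<theta> where "C \<ge> 1" "0 < \<theta>" "\<theta> < 1"
    "\<And>f M k y. f holomorphic_on rectangle \<kappa> \<Longrightarrow> (\<And>z. z \<in> rectangle \<kappa> \<Longrightarrow> norm (f z) \<le> M) \<Longrightarrow>
      y \<in> {-1..1} \<Longrightarrow> norm (newton_term node k (\<lambda>x. f (of_real x)) y) \<le> M * (C * \<theta> ^ k)"
proof -
  obtain C \<theta> where C: "C \<ge> 1" "0 < \<theta>" "\<theta> < 1"
    "\<And>k l y z. y \<in> {-1..1} \<Longrightarrow> z \<in> path_image (rectangle_path \<kappa>) \<Longrightarrow> l \<in> {k, Suc k} \<Longrightarrow>
      \<bar>nodal node k y\<bar> / norm (cnodal node l z) \<le> C * \<theta> ^ k"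
    using nodal_quotient_decay[OF \<kappa>] by metis
  have rng: "range node \<subseteq> {-1..1}" using node_in by blast
  show ?thesis
  proof (rule that[of "C * (1 + 2 * \<kappa>)" \<theta>])
    show "1 \<le> C * (1 + 2 * \<kappa>)" using C(1) \<kappa> mult_mono[of 1 C 1 "1 + 2 * \<kappa>"] by simp
    fix f :: "complex \<Rightarrow> complex" and M k and y :: real
    assume "f holomorphic_on rectangle \<kappa>" "\<And>z. z \<in> rectangle \<kappa> \<Longrightarrow> norm (f z) \<le> M" "y \<in> {-1..1}"
    from norm_newton_term_le[OF this(1) \<kappa> inj_node rng this(2) C(4)[OF this(3)], of k]
    show "norm (newton_term node k (\<lambda>x. f (of_real x)) y) \<le> M * (C * (1 + 2 * \<kappa>) * \<theta> ^ k)"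
      by (simp add: mult_ac)
  qed (use C in auto)
qed

text \<open>Inserting the expansion of the Cauchy kernel into Cauchy's formula makes the partial
  sums appear; the contour integral of the remainder decays geometrically.\<close>

lemma newton_series_node:
  assumes hol: "f holomorphic_on rectangle \<kappa>" and \<kappa>: "\<kappa> > 0"
    and M: "\<And>z. z \<in> rectangle \<kappa> \<Longrightarrow> norm (f z) \<le> M" and y: "y \<in> {-1..1}"
  shows "(\<lambda>k. newton_term node k (\<lambda>x. f (of_real x)) y) sums f (of_real y)"
proof -
  obtain C \<theta> where C: "C \<ge> 1" "0 < \<theta>" "\<theta> < 1"
    "\<And>k l y z. y \<in> {-1..1} \<Longrightarrow> z \<in> path_image (rectangle_path \<kappa>) \<Longrightarrow> l \<in> {k, Suc k} \<Longrightarrow>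
      \<bar>nodal node k y\<bar> / norm (cnodal node l z) \<le> C * \<theta> ^ k"
    using nodal_quotient_decay[OF \<kappa>] by metis
  have rng: "range node \<subseteq> {-1..1}" using node_in by blast
  let ?N = "\<lambda>k. newton_term node k (\<lambda>x. f (of_real x)) y"
  have M0: "0 \<le> M" using order_trans[OF norm_ge_zero M[of 0]] \<kappa> by (simp add: in_rectangle_iff)
  have bound: "norm ((\<Sum>k<K. ?N k) - f (of_real y)) \<le> (M / \<kappa> * C * (1 + 2 * \<kappa>)) * \<theta> ^ K" for K
  proof -
    have 1: "((\<lambda>z. f z / (z - of_real y) - (\<Sum>k<K. f z * (of_real (nodal node k y) / cnodal node (Suc k) z)))
        has_contour_integral (2 * pi * \<i> * f (of_real y) - (\<Sum>k<K. 2 * pi * \<i> * ?N k))) (rectangle_path \<kappa>)"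
      by (intro has_contour_integral_diff has_contour_integral_sum
          Cauchy_integral_rectangle_path[OF hol \<kappa> y]
          newton_term_contour_integral[OF hol \<kappa> inj_node rng]) auto
    have "norm (2 * pi * \<i> * f (of_real y) - (\<Sum>k<K. 2 * pi * \<i> * ?N k)) \<le>
        (M * (C * \<theta> ^ K) / \<kappa>) * (4 + 8 * \<kappa>)"
    proof (rule contour_integral_rectangle_path_bound[OF 1 \<kappa>])
      fix z assume z: "z \<in> path_image (rectangle_path \<kappa>)"
      then have zr: "z \<in> rectangle \<kappa>" using \<kappa> by (auto simp: path_image_rectangle_path)
      have ne: "z \<noteq> of_real x" if "x \<in> {-1..1}" for x
        using rectangle_path_dist[OF \<kappa> z that] \<kappa> by auto
      have "f z / (z - of_real y) = f z * (1 / (z - of_real y))" by simp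
      also have "1 / (z - of_real y) = (\<Sum>k<K. cnodal node k (of_real y) / cnodal node (Suc k) z) +
          cnodal node K (of_real y) / (cnodal node K z * (z - of_real y))"
        by (rule nodal_expansion) (use ne y node_in in auto)
      finally have "f z / (z - of_real y) - (\<Sum>k<K. f z * (of_real (nodal node k y) / cnodal node (Suc k) z)) =
          f z * (of_real (nodal node K y) / cnodal node K z) / (z - of_real y)"
        by (simp add: of_real_nodal algebra_simps sum_distrib_left)
      moreover have "norm (f z * (of_real (nodal node K y) / cnodal node K z) / (z - of_real y)) \<le> M * (C * \<theta> ^ K) / \<kappa>"
        unfolding norm_divide norm_mult norm_of_real
        using M[OF zr] C(4)[OF y z, of K K] rectangle_path_dist[OF \<kappa> z y] \<kappa> M0
        by (intro frac_le mult_mono) (auto intro!: mult_nonneg_nonneg simp: C(1,2,3) less_imp_le order_trans[OF zero_le_one C(1)])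
      ultimately show "norm (f z / (z - of_real y) -
          (\<Sum>k<K. f z * (of_real (nodal node k y) / cnodal node (Suc k) z))) \<le> M * (C * \<theta> ^ K) / \<kappa>"
        by simp
    qed
    also have "2 * pi * \<i> * f (of_real y) - (\<Sum>k<K. 2 * pi * \<i> * ?N k) =
        - (2 * pi * \<i> * ((\<Sum>k<K. ?N k) - f (of_real y)))"
      by (simp add: sum_distrib_left algebra_simps)
    also have "norm \<dots> = (2 * pi) * norm ((\<Sum>k<K. ?N k) - f (of_real y))"
      by (simp add: norm_mult)
    finally have "(2 * pi) * norm ((\<Sum>k<K. ?N k) - f (of_real y)) \<le> (M * (C * \<theta> ^ K) / \<kappa>) * (4 + 8 * \<kappa>)" .
    moreover have "4 * norm ((\<Sum>k<K. ?N k) - f (of_real y)) \<le> (2 * pi) * norm ((\<Sum>k<K. ?N k) - f (of_real y))"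
      using pi_ge_two by (intro mult_right_mono) auto
    ultimately have "4 * norm ((\<Sum>k<K. ?N k) - f (of_real y)) \<le> (M * (C * \<theta> ^ K) / \<kappa>) * (4 + 8 * \<kappa>)"
      by (rule order_trans[rotated])
    also have "\<dots> = 4 * ((M / \<kappa> * C * (1 + 2 * \<kappa>)) * \<theta> ^ K)"
      using \<kappa> by (simp add: field_simps)
    finally show ?thesis by simp
  qed
  have "(\<lambda>K. (\<Sum>k<K. ?N k) - f (of_real y)) \<longlonglongrightarrow> 0"
  proof (rule Lim_null_comparison)
    show "\<forall>\<^sub>F K in sequentially. norm ((\<Sum>k<K. ?N k) - f (of_real y)) \<le> (M / \<kappa> * C * (1 + 2 * \<kappa>)) * \<theta> ^ K"
      using bound by simp
    show "(\<lambda>K. (M / \<kappa> * C * (1 + 2 * \<kappa>)) * \<theta> ^ K) \<longlonglongrightarrow> 0"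
      using C by (intro tendsto_mult_right_zero LIMSEQ_power_zero) auto
  qed
  then show ?thesis unfolding sums_def by (simp add: LIM_zero_iff)
qed

section \<open>Hierarchical surpluses\<close>

abbreviation supp :: "('a \<Rightarrow> nat) \<Rightarrow> 'a set"
  where "supp \<nu> \<equiv> {j. \<nu> j \<noteq> 0}"

definition multiindices :: "(nat \<Rightarrow> nat) set"
  where "multiindices = {\<nu>. finite (supp \<nu>)}"

abbreviation newton_tensor :: "(nat \<Rightarrow> real) \<Rightarrow> nat set \<Rightarrow> (nat \<Rightarrow> nat) \<Rightarrow> (nat \<Rightarrow> nat) \<Rightarrow> (nat \<Rightarrow> real) \<Rightarrow> real"
  where "newton_tensor \<xi> S \<nu> \<mu> y \<equiv> \<Prod>j\<in>S. newton_basis \<xi> (\<nu> j) (\<mu> j) (y j)"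

text \<open>This is \<open>\<Delta>\<^sub>\<nu> u\<close>, written out as a tensor product of
  one-dimensional Newton terms.\<close>

definition hier_surplus ::
    "(nat \<Rightarrow> real) \<Rightarrow> (nat \<Rightarrow> nat) \<Rightarrow> ((nat \<Rightarrow> real) \<Rightarrow> real) \<Rightarrow> (nat \<Rightarrow> real) \<Rightarrow> real"
  where "hier_surplus \<xi> \<nu> u y =
    (\<Sum>\<mu>\<in>{..\<nu>}. u (\<lambda>j. \<xi> (\<mu> j)) * newton_tensor \<xi> (supp \<nu>) \<nu> \<mu> y)"

lemma newton_basis_0 [simp]: "newton_basis \<xi> 0 0 y = 1"
  by (simp add: newton_basis_def nodal_def)

text \<open>Indices below \<nu> vanish off \<open>S\<close>, whereas members of the product set are
  undefined there; restriction passes between the two, giving access to cardinalities and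
  coordinatewise induction.\<close>

lemma atMost_fun_eq_image_PiE:
  fixes \<nu> :: "'a \<Rightarrow> nat"
  assumes "supp \<nu> \<subseteq> S"
  shows "bij_betw (\<lambda>\<mu>. restrict \<mu> S) {..\<nu>} (PiE S (\<lambda>j. {..\<nu> j}))"
proof (rule bij_betwI[where g = "\<lambda>\<mu> j. if j \<in> S then \<mu> j else 0"])
  show "(\<lambda>\<mu>. restrict \<mu> S) \<in> {..\<nu>} \<rightarrow> (PiE S (\<lambda>j. {..\<nu> j}))"
    by (auto simp: le_fun_def)
  show "(\<lambda>\<mu> j. if j \<in> S then \<mu> j else 0) \<in> (PiE S (\<lambda>j. {..\<nu> j})) \<rightarrow> {..\<nu>}"
    by (auto simp: le_fun_def PiE_def)
  show "(\<lambda>j. if j \<in> S then restrict \<mu> S j else 0) = \<mu>" if "\<mu> \<in> {..\<nu>}" for \<mu>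
  proof
    fix j
    have "\<mu> j \<le> \<nu> j" using that by (simp add: le_fun_def)
    then have "\<mu> j = 0" if "\<nu> j = 0" using that by simp
    then show "(if j \<in> S then restrict \<mu> S j else 0) = \<mu> j" using assms by auto
  qed
  show "restrict (\<lambda>j. if j \<in> S then \<mu> j else 0) S = \<mu>" if "\<mu> \<in> PiE S (\<lambda>j. {..\<nu> j})" for \<mu>
    using that by (auto simp: fun_eq_iff PiE_def extensional_def)
qed

lemma finite_atMost_multiindex:
  assumes "\<nu> \<in> multiindices"
  shows "finite {..\<nu>}"
  using bij_betw_finite[OF atMost_fun_eq_image_PiE[of \<nu> "supp \<nu>"]] assms
  by (simp add: multiindices_def finite_PiE)

lemma card_atMost_multiindex:
  assumes "supp \<nu> \<subseteq> S" "finite S"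
  shows "card {..\<nu>} = (\<Prod>j\<in>S. Suc (\<nu> j))"
  using bij_betw_same_card[OF atMost_fun_eq_image_PiE[OF assms(1)]] assms(2)
  by (simp add: card_PiE)

lemma multiindices_le: "\<mu> \<in> multiindices" if "\<mu> \<le> \<nu>" "\<nu> \<in> multiindices"
proof -
  have "supp \<mu> \<subseteq> supp \<nu>"
    using that(1) by (auto simp: le_fun_def) (metis le_zero_eq not_gr_zero)
  then show ?thesis using that(2) finite_subset by (auto simp: multiindices_def)
qed

lemma hier_surplus_superset:
  assumes "finite S" "supp \<nu> \<subseteq> S"
  shows "hier_surplus \<xi> \<nu> u y =
    (\<Sum>\<mu>\<in>{..\<nu>}. u (\<lambda>j. \<xi> (\<mu> j)) * newton_tensor \<xi> S \<nu> \<mu> y)"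
  unfolding hier_surplus_def
proof (rule sum.cong[OF refl])
  fix \<mu> assume \<mu>: "\<mu> \<in> {..\<nu>}"
  have "newton_tensor \<xi> (supp \<nu>) \<nu> \<mu> y = newton_tensor \<xi> S \<nu> \<mu> y"
  proof (rule prod.mono_neutral_left[OF assms])
    show "\<forall>i\<in>S - supp \<nu>. newton_basis \<xi> (\<nu> i) (\<mu> i) (y i) = 1"
    proof
      fix i assume "i \<in> S - supp \<nu>"
      moreover have "\<mu> i \<le> \<nu> i" using \<mu> by (simp add: le_fun_def)
      ultimately show "newton_basis \<xi> (\<nu> i) (\<mu> i) (y i) = 1" by simp
    qed
  qed
  then show "u (\<lambda>j. \<xi> (\<mu> j)) * newton_tensor \<xi> (supp \<nu>) \<nu> \<mu> y =
      u (\<lambda>j. \<xi> (\<mu> j)) * newton_tensor \<xi> S \<nu> \<mu> y" by simp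
qed

lemma hier_surplus_linear:
  "hier_surplus \<xi> \<nu> (\<lambda>y. \<Sum>i\<in>I. c i * u i y) y = (\<Sum>i\<in>I. c i * hier_surplus \<xi> \<nu> (u i) y)"
proof -
  have "hier_surplus \<xi> \<nu> (\<lambda>y. \<Sum>i\<in>I. c i * u i y) y =
    (\<Sum>\<mu>\<in>{..\<nu>}. \<Sum>i\<in>I. c i * (u i (\<lambda>j. \<xi> (\<mu> j)) * newton_tensor \<xi> (supp \<nu>) \<nu> \<mu> y))"
    unfolding hier_surplus_def by (simp add: sum_distrib_right mult.assoc)
  also have "\<dots> = (\<Sum>i\<in>I. c i * hier_surplus \<xi> \<nu> (u i) y)"
    by (subst sum.swap) (simp add: hier_surplus_def sum_distrib_left)
  finally show ?thesis .
qed

section \<open>Surpluses and the combination formula\<close>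

definition lagrange_basis :: "(nat \<Rightarrow> real) \<Rightarrow> nat \<Rightarrow> nat \<Rightarrow> real \<Rightarrow> real"
  where "lagrange_basis \<xi> k i y = (if i \<le> k then \<Prod>l\<in>{..k} - {i}. (y - \<xi> l) / (\<xi> i - \<xi> l) else 0)"

abbreviation lagrange_tensor :: "(nat \<Rightarrow> real) \<Rightarrow> nat set \<Rightarrow> (nat \<Rightarrow> nat) \<Rightarrow> (nat \<Rightarrow> nat) \<Rightarrow> (nat \<Rightarrow> real) \<Rightarrow> real"
  where "lagrange_tensor \<xi> S \<kappa> \<mu> y \<equiv> \<Prod>j\<in>S. lagrange_basis \<xi> (\<kappa> j) (\<mu> j) (y j)"

text \<open>This is where nestedness of the nodes enters: the next Lagrange polynomial at an old
  node gains one factor, and that factor minus 1 is (y - \<xi> i) / (\<xi> i - \<xi> (k + 1)), which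
  completes the nodal polynomial.\<close>

lemma newton_basis_Suc:
  assumes "inj \<xi>"
  shows "newton_basis \<xi> (Suc k) i y = lagrange_basis \<xi> (Suc k) i y - lagrange_basis \<xi> k i y"
proof -
  consider "i \<le> k" | "i = Suc k" | "i > Suc k" by linarith
  then show ?thesis
  proof cases
    case 1
    have ne: "\<xi> i - \<xi> (Suc k) \<noteq> 0" using assms 1 by (auto dest: injD)
    have set: "{..Suc k} - {i} = insert (Suc k) ({..k} - {i})" using 1 by auto
    have nod: "nodal \<xi> (Suc k) y = (y - \<xi> i) * (\<Prod>l\<in>{..k} - {i}. y - \<xi> l)"
      using 1 unfolding nodal_def lessThan_Suc_atMost by (intro prod.remove) auto
    have "lagrange_basis \<xi> (Suc k) i y - lagrange_basis \<xi> k i y =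
        lagrange_basis \<xi> k i y * ((y - \<xi> (Suc k)) / (\<xi> i - \<xi> (Suc k)) - 1)"
      using 1 by (simp add: lagrange_basis_def set algebra_simps)
    also have "(y - \<xi> (Suc k)) / (\<xi> i - \<xi> (Suc k)) - 1 = (y - \<xi> i) / (\<xi> i - \<xi> (Suc k))"
      using ne by (simp add: field_simps)
    also have "lagrange_basis \<xi> k i y * ((y - \<xi> i) / (\<xi> i - \<xi> (Suc k))) = newton_basis \<xi> (Suc k) i y"
      using 1 by (simp add: newton_basis_def lagrange_basis_def set nod prod_dividef mult.commute)
    finally show ?thesis by simp
  next
    case 2
    then have "{..Suc k} - {i} = {..<Suc k}" by auto
    then show ?thesis using 2
      by (simp add: newton_basis_def lagrange_basis_def nodal_def prod_dividef)
  next
    case 3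
    then show ?thesis by (simp add: newton_basis_def lagrange_basis_def)
  qed
qed

text \<open>Since Lagrange polynomials are set to 0 beyond their degree, all interpolants below
  \<nu> can be summed over the same grid indices and over the same coordinates.\<close>

lemma tensor_interp_superset:
  assumes "\<kappa> \<le> \<nu>" "finite S" "supp \<nu> \<subseteq> S"
  shows "tensor_interp \<xi> \<kappa> u y =
    (\<Sum>\<mu>\<in>{..\<nu>}. u (\<lambda>j. \<xi> (\<mu> j)) * lagrange_tensor \<xi> S \<kappa> \<mu> y)"
proof -
  have \<nu>: "\<nu> \<in> multiindices" using assms finite_subset by (auto simp: multiindices_def)
  have supp: "supp \<kappa> \<subseteq> S"
  proof
    fix j assume "j \<in> supp \<kappa>"
    moreover have "\<kappa> j \<le> \<nu> j" using assms(1) by (simp add: le_fun_def)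
    ultimately have "\<nu> j \<noteq> 0" by simp
    then show "j \<in> S" using assms(3) by blast
  qed
  have "(\<Sum>\<mu>\<in>{..\<nu>}. u (\<lambda>j. \<xi> (\<mu> j)) * lagrange_tensor \<xi> S \<kappa> \<mu> y) =
      (\<Sum>\<mu>\<in>{..\<kappa>}. u (\<lambda>j. \<xi> (\<mu> j)) * lagrange_tensor \<xi> S \<kappa> \<mu> y)"
  proof (rule sum.mono_neutral_right)
    show "finite {..\<nu>}" using \<nu> by (rule finite_atMost_multiindex)
    show "{..\<kappa>} \<subseteq> {..\<nu>}" using assms(1) by auto
    show "\<forall>\<mu>\<in>{..\<nu>} - {..\<kappa>}. u (\<lambda>j. \<xi> (\<mu> j)) * lagrange_tensor \<xi> S \<kappa> \<mu> y = 0"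
    proof
      fix \<mu> assume \<mu>: "\<mu> \<in> {..\<nu>} - {..\<kappa>}"
      then obtain j where j: "\<not> \<mu> j \<le> \<kappa> j" by (auto simp: le_fun_def)
      have "\<mu> j \<le> \<nu> j" using \<mu> by (simp add: le_fun_def)
      with j have "j \<in> S" using assms(3) by auto
      moreover have "lagrange_basis \<xi> (\<kappa> j) (\<mu> j) (y j) = 0" using j by (simp add: lagrange_basis_def)
      ultimately have "lagrange_tensor \<xi> S \<kappa> \<mu> y = 0" using assms(2) by auto
      then show "u (\<lambda>j. \<xi> (\<mu> j)) * lagrange_tensor \<xi> S \<kappa> \<mu> y = 0" by simp
    qed
  qed
  also have "\<dots> = tensor_interp \<xi> \<kappa> u y"
    unfolding tensor_interp_def
  proof (rule sum.cong[OF refl])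
    fix \<mu> assume \<mu>: "\<mu> \<in> {..\<kappa>}"
    have le: "\<mu> j \<le> \<kappa> j" for j using \<mu> by (simp add: le_fun_def)
    have "lagrange_tensor \<xi> S \<kappa> \<mu> y =
        (\<Prod>j\<in>supp \<kappa>. lagrange_basis \<xi> (\<kappa> j) (\<mu> j) (y j))"
    proof (rule prod.mono_neutral_right[OF assms(2) supp], rule ballI)
      fix i assume "i \<in> S - supp \<kappa>"
      then show "lagrange_basis \<xi> (\<kappa> i) (\<mu> i) (y i) = 1"
        using le[of i] by (simp add: lagrange_basis_def)
    qed
    then show "u (\<lambda>j. \<xi> (\<mu> j)) * lagrange_tensor \<xi> S \<kappa> \<mu> y =
      u (\<lambda>j. \<xi> (\<mu> j)) *
       (\<Prod>j\<in>supp \<kappa>. \<Prod>i\<in>{..\<kappa> j} - {\<mu> j}. (y j - \<xi> i) / (\<xi> (\<mu> j) - \<xi> i))"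
      using le by (simp add: lagrange_basis_def)
  qed
  finally show ?thesis by simp
qed

text \<open>In every active coordinate a Newton term is a difference of consecutive Lagrange
  interpolants; expanding the product of differences gives a signed sum over the subsets
  \<open>X\<close> of coordinates whose order is lowered.\<close>

lemma hier_surplus_eq_tensor_interp:
  assumes "inj \<xi>" "\<nu> \<in> multiindices"
  shows "hier_surplus \<xi> \<nu> u y =
    (\<Sum>X\<in>Pow (supp \<nu>). (- 1) ^ card X * tensor_interp \<xi> (\<lambda>j. if j \<in> X then \<nu> j - 1 else \<nu> j) u y)"
proof -
  define S where "S = supp \<nu>"
  have fin: "finite S" using assms(2) by (simp add: S_def multiindices_def)
  define \<kappa> where "\<kappa> X = (\<lambda>j. if j \<in> X then \<nu> j - 1 else \<nu> j)" for X
  have \<kappa>: "\<kappa> X \<le> \<nu>" for X by (simp add: \<kappa>_def le_fun_def)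
  have "newton_tensor \<xi> S \<nu> \<mu> y =
      (\<Sum>X\<in>Pow S. (- 1) ^ card X * lagrange_tensor \<xi> S (\<kappa> X) \<mu> y)" for \<mu>
  proof -
    have "newton_tensor \<xi> S \<nu> \<mu> y =
        (\<Prod>j\<in>S. lagrange_basis \<xi> (\<nu> j) (\<mu> j) (y j) - lagrange_basis \<xi> (\<nu> j - 1) (\<mu> j) (y j))"
    proof (rule prod.cong[OF refl])
      fix j assume "j \<in> S"
      then obtain k where "\<nu> j = Suc k" by (auto simp: S_def gr0_conv_Suc)
      then show "newton_basis \<xi> (\<nu> j) (\<mu> j) (y j) =
          lagrange_basis \<xi> (\<nu> j) (\<mu> j) (y j) - lagrange_basis \<xi> (\<nu> j - 1) (\<mu> j) (y j)"
        using newton_basis_Suc[OF assms(1)] by simp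
    qed
    also have "\<dots> = (\<Sum>X\<in>Pow S. (- 1) ^ card X *
        (\<Prod>j\<in>X. lagrange_basis \<xi> (\<nu> j - 1) (\<mu> j) (y j)) *
        (\<Prod>j\<in>S - X. lagrange_basis \<xi> (\<nu> j) (\<mu> j) (y j)))"
      by (rule prod_diff_conv_sum[OF fin])
    also have "\<dots> = (\<Sum>X\<in>Pow S. (- 1) ^ card X * lagrange_tensor \<xi> S (\<kappa> X) \<mu> y)"
    proof (rule sum.cong[OF refl])
      fix X assume "X \<in> Pow S"
      then have X: "X \<subseteq> S" by simp
      show "(- 1) ^ card X * (\<Prod>j\<in>X. lagrange_basis \<xi> (\<nu> j - 1) (\<mu> j) (y j)) *
        (\<Prod>j\<in>S - X. lagrange_basis \<xi> (\<nu> j) (\<mu> j) (y j)) =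
        (- 1) ^ card X * lagrange_tensor \<xi> S (\<kappa> X) \<mu> y"
        unfolding prod.subset_diff[OF X fin, of "\<lambda>j. lagrange_basis \<xi> (\<kappa> X j) (\<mu> j) (y j)"]
        by (simp add: \<kappa>_def mult_ac)
    qed
    finally show ?thesis .
  qed
  then have "hier_surplus \<xi> \<nu> u y = (\<Sum>\<mu>\<in>{..\<nu>}. \<Sum>X\<in>Pow S. (- 1) ^ card X *
      (u (\<lambda>j. \<xi> (\<mu> j)) * lagrange_tensor \<xi> S (\<kappa> X) \<mu> y))"
    unfolding hier_surplus_def S_def[symmetric] by (simp add: sum_distrib_left mult_ac)
  also have "\<dots> = (\<Sum>X\<in>Pow S. (- 1) ^ card X * tensor_interp \<xi> (\<kappa> X) u y)"
    by (subst sum.swap)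
      (simp add: tensor_interp_superset[OF \<kappa> fin equalityD1[OF S_def[symmetric]]] sum_distrib_left)
  finally show ?thesis by (simp add: S_def \<kappa>_def)
qed

text \<open>Identify 0-1 sequences with their supports \<open>X\<close>. The pairs (\<nu>, X) in the
  combination formula, shifted to \<nu> plus the indicator of \<open>X\<close>, become the pairs in
  the subset expansion of the surpluses. The inverse shift stays in \<Lambda> because \<Lambda> is
  downward closed.\<close>

lemma sparse_interp_eq_sum_hier_surplus:
  assumes "inj \<xi>" "multiindex_set \<Lambda>"
  shows "sparse_interp \<xi> \<Lambda> u y = (\<Sum>\<nu>\<in>\<Lambda>. hier_surplus \<xi> \<nu> u y)"
proof -
  have fin: "finite \<Lambda>" and mi: "\<And>\<nu>. \<nu> \<in> \<Lambda> \<Longrightarrow> finite (supp \<nu>)"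
    and down: "\<And>\<nu> \<mu>. \<nu> \<in> \<Lambda> \<Longrightarrow> \<mu> \<le> \<nu> \<Longrightarrow> \<mu> \<in> \<Lambda>"
    using assms(2) by (auto simp: multiindex_set_def)
  define ind :: "nat set \<Rightarrow> nat \<Rightarrow> nat" where "ind X = (\<lambda>j. if j \<in> X then 1 else 0)" for X
  define E where "E \<nu> = {X. (\<lambda>j. \<nu> j + ind X j) \<in> \<Lambda>}" for \<nu>
  have finE: "finite (E \<nu>)" for \<nu>
  proof (rule finite_imageD)
    show "finite ((\<lambda>X j. \<nu> j + ind X j) ` E \<nu>)"
      by (rule finite_subset[OF _ fin]) (auto simp: E_def)
    show "inj_on (\<lambda>X j. \<nu> j + ind X j) (E \<nu>)"
      by (rule inj_onI) (auto simp: ind_def fun_eq_iff split: if_splits)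
  qed
  have coeff: "combination_coeff \<Lambda> \<nu> = (\<Sum>X\<in>E \<nu>. (- 1) ^ card X)" for \<nu>
    unfolding combination_coeff_def
  proof (rule sum.reindex_bij_witness[where i = ind and j = "\<lambda>e. {j. e j \<noteq> 0}"])
    fix e assume e: "e \<in> {e. range e \<subseteq> {0, 1} \<and> (\<lambda>j. \<nu> j + e j) \<in> \<Lambda>}"
    then have "range e \<subseteq> {0, 1}" by simp
    then have "e j \<in> {0, 1}" for j by (rule range_subsetD)
    then have e01: "e j = 0 \<or> e j = 1" for j by simp
    show inde: "ind {j. e j \<noteq> 0} = e"
    proof
      fix j show "ind {j. e j \<noteq> 0} j = e j" using e01[of j] by (auto simp: ind_def)
    qed
    show "{j. e j \<noteq> 0} \<in> E \<nu>" using e inde by (simp add: E_def)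
    have "(\<Sum>j\<in>{j. e j \<noteq> 0}. e j) = card {j. e j \<noteq> 0}"
    proof -
      have "(\<Sum>j\<in>{j. e j \<noteq> 0}. e j) = (\<Sum>j\<in>{j. e j \<noteq> 0}. 1)"
      proof (rule sum.cong[OF refl])
        fix j assume "j \<in> {j. e j \<noteq> 0}"
        then show "e j = 1" using e01[of j] by simp
      qed
      then show ?thesis by simp
    qed
    then show "(- 1 :: real) ^ card {j. e j \<noteq> 0} = (- 1) ^ (\<Sum>j\<in>{j. e j \<noteq> 0}. e j)" by simp
  next
    fix X assume "X \<in> E \<nu>"
    then show "ind X \<in> {e. range e \<subseteq> {0, 1} \<and> (\<lambda>j. \<nu> j + e j) \<in> \<Lambda>}" "{j. ind X j \<noteq> 0} = X"
      by (auto simp: E_def ind_def)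
  qed
  have "sparse_interp \<xi> \<Lambda> u y = (\<Sum>(\<nu>, X)\<in>Sigma \<Lambda> E. (- 1) ^ card X * tensor_interp \<xi> \<nu> u y)"
    unfolding sparse_interp_def coeff sum_distrib_right
    by (rule sum.Sigma) (use fin finE in auto)
  also have "\<dots> = (\<Sum>(\<nu>, X)\<in>Sigma \<Lambda> (\<lambda>\<nu>. Pow (supp \<nu>)).
      (- 1) ^ card X * tensor_interp \<xi> (\<lambda>j. if j \<in> X then \<nu> j - 1 else \<nu> j) u y)"
  proof (rule sum.reindex_bij_witness[where
        j = "\<lambda>(\<nu>, X). (\<lambda>j. \<nu> j + ind X j, X)" and
        i = "\<lambda>(\<nu>, X). (\<lambda>j. if j \<in> X then \<nu> j - 1 else \<nu> j, X)"], goal_cases)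
    case (1 a)
    then show ?case by (auto simp: ind_def fun_eq_iff)
  next
    case (2 a)
    then show ?case by (auto simp: E_def ind_def fun_eq_iff)
  next
    case (3 b)
    then obtain \<nu> X where b: "b = (\<nu>, X)" "X \<subseteq> supp \<nu>" by auto
    have "(\<lambda>j. (if j \<in> X then \<nu> j - 1 else \<nu> j) + ind X j) = \<nu>"
      using b(2) by (force simp: ind_def)
    then show ?case by (simp add: b)
  next
    case (4 b)
    then obtain \<nu> X where b: "b = (\<nu>, X)" "\<nu> \<in> \<Lambda>" "X \<subseteq> supp \<nu>" by auto
    have "(\<lambda>j. if j \<in> X then \<nu> j - 1 else \<nu> j) \<le> \<nu>" by (simp add: le_fun_def)
    then have "(\<lambda>j. if j \<in> X then \<nu> j - 1 else \<nu> j) \<in> \<Lambda>" using down b by blast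
    moreover have "(\<lambda>j. (if j \<in> X then \<nu> j - 1 else \<nu> j) + ind X j) = \<nu>"
      using b(3) by (force simp: ind_def)
    ultimately show ?case using b by (simp add: E_def)
  next
    case (5 a)
    then obtain \<nu> X where a: "a = (\<nu>, X)" by (cases a)
    have "(\<lambda>j. if j \<in> X then \<nu> j + ind X j - 1 else \<nu> j + ind X j) = \<nu>"
      by (auto simp: ind_def)
    then show ?case by (simp add: a)
  qed
  also have "\<dots> = (\<Sum>\<nu>\<in>\<Lambda>. hier_surplus \<xi> \<nu> u y)"
    using fin mi
    by (subst sum.Sigma[symmetric])
      (auto intro!: sum.cong simp: hier_surplus_eq_tensor_interp[OF assms(1)] multiindices_def)
  finally show ?thesis .
qed

section \<open>Convergence of the hierarchical expansion\<close>

lemma hier_surplus_update: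
  assumes "finite (supp \<nu>)" "\<nu> m = 0"
  shows "hier_surplus \<xi> (\<nu>(m := k)) u y =
    (\<Sum>\<mu>\<in>{..\<nu>}. newton_tensor \<xi> (supp \<nu>) \<nu> \<mu> y *
      (\<Sum>i\<le>k. newton_basis \<xi> k i (y m) * u ((\<lambda>j. \<xi> (\<mu> j))(m := \<xi> i))))"
proof -
  define S where "S = supp \<nu>"
  have S: "finite S" "m \<notin> S" using assms by (auto simp: S_def)
  have \<mu>m: "\<mu> m = 0" if "\<mu> \<in> {..\<nu>}" for \<mu>
  proof -
    have "\<mu> m \<le> \<nu> m" using that by (simp add: le_fun_def)
    then show ?thesis using assms(2) by simp
  qed
  have "hier_surplus \<xi> (\<nu>(m := k)) u y =
    (\<Sum>\<mu>\<in>{..\<nu>(m := k)}. u (\<lambda>j. \<xi> (\<mu> j)) * (\<Prod>j\<in>insert m S. newton_basis \<xi> ((\<nu>(m := k)) j) (\<mu> j) (y j)))"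
    by (rule hier_surplus_superset) (use S(1) in \<open>auto simp: S_def split: if_splits\<close>)
  also have "\<dots> = (\<Sum>(\<mu>, i)\<in>{..\<nu>} \<times> {..k}.
      newton_tensor \<xi> S \<nu> \<mu> y *
      (newton_basis \<xi> k i (y m) * u ((\<lambda>j. \<xi> (\<mu> j))(m := \<xi> i))))"
  proof (rule sum.reindex_bij_witness[where i = "\<lambda>(\<mu>, i). \<mu>(m := i)" and j = "\<lambda>\<mu>. (\<mu>(m := 0), \<mu> m)"], goal_cases)
    case (1 \<mu>) then show ?case by simp
  next
    case (2 \<mu>)
    then have le: "\<mu> j \<le> (if j = m then k else \<nu> j)" for j by (simp add: le_fun_def)
    have "(\<mu>(m := 0)) j \<le> \<nu> j" for j using le[of j] by (auto split: if_splits)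
    then show ?case using le[of m] by (simp add: le_fun_def)
  next
    case (3 b) then show ?case using \<mu>m by (auto simp: fun_eq_iff)
  next
    case (4 b) then show ?case by (auto simp: le_fun_def)
  next
    case (5 \<mu>)
    have "(\<Prod>j\<in>S. newton_basis \<xi> (\<nu> j) ((\<mu>(m := 0)) j) (y j)) =
        (\<Prod>j\<in>S. newton_basis \<xi> ((\<nu>(m := k)) j) (\<mu> j) (y j))"
      by (rule prod.cong) (use S in auto)
    moreover have "(\<lambda>j. \<xi> ((\<mu>(m := 0)) j))(m := \<xi> (\<mu> m)) = (\<lambda>j. \<xi> (\<mu> j))" by auto
    ultimately show ?case using S by simp
  qed
  also have "\<dots> = (\<Sum>\<mu>\<in>{..\<nu>}. \<Sum>i\<le>k. newton_tensor \<xi> S \<nu> \<mu> y *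
      (newton_basis \<xi> k i (y m) * u ((\<lambda>j. \<xi> (\<mu> j))(m := \<xi> i))))"
    by (simp add: sum.cartesian_product)
  finally show ?thesis by (simp add: S_def sum_distrib_left)
qed

text \<open>Coordinates are summed out one at a time: in \<open>U m\<close> the first m arguments
  are already set to \<open>y\<close>, and \<open>F m\<close> keeps the indices in the remaining
  coordinates. Summing coordinate m is a one-dimensional Newton series turning \<open>U m\<close>
  into \<open>U (Suc m)\<close>, while unconditional summability leaves the total unchanged. At m =
  n only the zero index is left, which evaluates at the base node.\<close>

lemma hier_surplus_has_sum_finite:
  assumes \<xi>: "range \<xi> \<subseteq> {-1..1}" and y: "y \<in> unit_cube"
    and newton: "\<And>y m. y \<in> unit_cube \<Longrightarrow>
      (\<lambda>k. \<Sum>i\<le>k. newton_basis \<xi> k i (y m) * u (y(m := \<xi> i))) sums u y"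
    and summ: "(\<lambda>\<nu>. hier_surplus \<xi> \<nu> u y) summable_on {\<nu>. supp \<nu> \<subseteq> {..<n}}"
  shows "((\<lambda>\<nu>. hier_surplus \<xi> \<nu> u y) has_sum u (\<lambda>j. if j < n then y j else \<xi> 0))
    {\<nu>. supp \<nu> \<subseteq> {..<n}}"
proof -
  define F where "F m = {\<nu>::nat \<Rightarrow> nat. supp \<nu> \<subseteq> {m..<n}}" for m
  have Fiff: "\<nu> \<in> F m \<longleftrightarrow> (\<forall>j. j < m \<or> n \<le> j \<longrightarrow> \<nu> j = 0)" for \<nu> m
    unfolding F_def subset_iff by (auto simp: not_less[symmetric])
  define U where "U m y' = u (\<lambda>j. if j < m then y j else y' j)" for m y'
  define s where "s = (\<Sum>\<^sub>\<infinity>\<nu>\<in>F 0. hier_surplus \<xi> \<nu> u y)"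
  have F0: "F 0 = {\<nu>. supp \<nu> \<subseteq> {..<n}}" by (simp add: F_def lessThan_atLeast0)
  have P: "((\<lambda>\<nu>. hier_surplus \<xi> \<nu> (U m) y) has_sum s) (F m)" if "m \<le> n" for m
    using that
  proof (induction m)
    case 0
    have "U 0 = u" by (simp add: U_def fun_eq_iff)
    then show ?case using summ unfolding s_def F0 by simp
  next
    case (Suc m)
    then have IH: "((\<lambda>\<nu>. hier_surplus \<xi> \<nu> (U m) y) has_sum s) (F m)" and m: "m < n" by auto
    have "bij_betw (\<lambda>(\<nu>, k). \<nu>(m := k)) (F (Suc m) \<times> UNIV) (F m)"
    proof (rule bij_betwI[where g = "\<lambda>\<nu>. (\<nu>(m := 0), \<nu> m)"])
      show "(\<lambda>(\<nu>, k). \<nu>(m := k)) \<in> F (Suc m) \<times> UNIV \<rightarrow> F m"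
        using m by (auto simp: Fiff)
      show "(\<lambda>\<nu>. (\<nu>(m := 0), \<nu> m)) \<in> F m \<rightarrow> F (Suc m) \<times> UNIV"
        by (auto simp: Fiff less_Suc_eq)
      show "((case x of (\<nu>, k) \<Rightarrow> \<nu>(m := k))(m := 0), (case x of (\<nu>, k) \<Rightarrow> \<nu>(m := k)) m) = x"
        if "x \<in> F (Suc m) \<times> UNIV" for x :: "(nat \<Rightarrow> nat) \<times> nat"
      proof -
        obtain \<nu> k where x: "x = (\<nu>, k)" "\<nu> \<in> F (Suc m)" using \<open>x \<in> F (Suc m) \<times> UNIV\<close> by auto
        then have "\<nu> m = 0" by (simp add: Fiff)
        then show ?thesis by (auto simp: x)
      qed
    qed simp
    from has_sum_reindex_bij_betw[OF this, of "\<lambda>\<nu>. hier_surplus \<xi> \<nu> (U m) y" s] IH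
    have "((\<lambda>x. hier_surplus \<xi> (case x of (\<nu>, k) \<Rightarrow> \<nu>(m := k)) (U m) y) has_sum s) (F (Suc m) \<times> UNIV)"
      by simp
    then have sig: "((\<lambda>(\<nu>, k). hier_surplus \<xi> (\<nu>(m := k)) (U m) y) has_sum s) (Sigma (F (Suc m)) (\<lambda>_. UNIV))"
      by (simp add: case_prod_unfold)
    show ?case
    proof (rule has_sum_SigmaD[OF sig])
      fix \<nu> assume \<nu>: "\<nu> \<in> F (Suc m)"
      have fin: "finite (supp \<nu>)" and \<nu>m: "\<nu> m = 0"
        using \<nu> finite_subset[of _ "{Suc m..<n}"] by (auto simp: F_def)
      have "(\<lambda>(\<nu>, k). hier_surplus \<xi> (\<nu>(m := k)) (U m) y) summable_on Sigma (F (Suc m)) (\<lambda>_. UNIV)"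
        using sig by (rule has_sum_imp_summable)
      then have "(\<lambda>k. hier_surplus \<xi> (\<nu>(m := k)) (U m) y) summable_on UNIV"
        using summable_on_SigmaD1[of "\<lambda>\<nu> k. hier_surplus \<xi> (\<nu>(m := k)) (U m) y"] \<nu> by fast
      moreover have "(\<lambda>k. hier_surplus \<xi> (\<nu>(m := k)) (U m) y) sums hier_surplus \<xi> \<nu> (U (Suc m)) y"
      proof -
        have "(\<lambda>k. \<Sum>\<mu>\<in>{..\<nu>}. newton_tensor \<xi> (supp \<nu>) \<nu> \<mu> y *
            (\<Sum>i\<le>k. newton_basis \<xi> k i (y m) * U m ((\<lambda>j. \<xi> (\<mu> j))(m := \<xi> i)))) sums
          (\<Sum>\<mu>\<in>{..\<nu>}. newton_tensor \<xi> (supp \<nu>) \<nu> \<mu> y * U (Suc m) (\<lambda>j. \<xi> (\<mu> j)))"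
        proof (intro sums_sum sums_mult)
          fix \<mu> :: "nat \<Rightarrow> nat"
          define y' where "y' = (\<lambda>j. if j < Suc m then y j else \<xi> (\<mu> j))"
          have y': "y' \<in> unit_cube" using y subsetD[OF \<xi> rangeI] by (simp add: unit_cube_def y'_def)
          have "(\<lambda>j. if j < m then y j else ((\<lambda>j. \<xi> (\<mu> j))(m := \<xi> i)) j) = y'(m := \<xi> i)" for i
            by (auto simp: y'_def)
          moreover have "y' m = y m" by (simp add: y'_def)
          moreover have "u y' = U (Suc m) (\<lambda>j. \<xi> (\<mu> j))" by (simp add: U_def y'_def)
          ultimately show "(\<lambda>k. \<Sum>i\<le>k. newton_basis \<xi> k i (y m) * U m ((\<lambda>j. \<xi> (\<mu> j))(m := \<xi> i))) sums
              U (Suc m) (\<lambda>j. \<xi> (\<mu> j))"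
            using newton[OF y', of m] by (simp add: U_def)
        qed
        then show ?thesis
          unfolding hier_surplus_update[OF fin \<nu>m] by (simp add: hier_surplus_def mult.commute)
      qed
      ultimately have "((\<lambda>k. hier_surplus \<xi> (\<nu>(m := k)) (U m) y) has_sum hier_surplus \<xi> \<nu> (U (Suc m)) y) UNIV"
        \<comment> \<open>Convergence of the ordered Newton series is weaker than
          \<open>has_sum\<close>; it only identifies the value, while summability on the slice comes
          from the whole family.\<close>
        by (metis has_sum_imp_sums has_sum_infsum sums_unique2)
      then show "((\<lambda>k. case (\<nu>, k) of (\<nu>, k) \<Rightarrow> hier_surplus \<xi> (\<nu>(m := k)) (U m) y) has_sum
          hier_surplus \<xi> \<nu> (U (Suc m)) y) UNIV" by simp
    qed
  qed
  have "F n = {\<lambda>_. 0}" by (auto simp: F_def)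
  moreover have "hier_surplus \<xi> (\<lambda>_. 0) (U n) y = U n (\<lambda>_. \<xi> 0)"
  proof -
    have "{..(\<lambda>_. 0) :: nat \<Rightarrow> nat} = {\<lambda>_. 0}" by (auto simp: le_fun_def)
    then show ?thesis by (simp add: hier_surplus_def)
  qed
  ultimately have "((\<lambda>\<nu>. hier_surplus \<xi> \<nu> (U n) y) has_sum U n (\<lambda>_. \<xi> 0)) (F n)"
    by (simp add: has_sum_finiteI)
  then have "s = U n (\<lambda>_. \<xi> 0)" using P[of n] has_sum_unique by blast
  moreover have "U 0 = u" "U n (\<lambda>_. \<xi> 0) = u (\<lambda>j. if j < n then y j else \<xi> 0)"
    by (simp_all add: U_def fun_eq_iff)
  ultimately show ?thesis using P[of 0] unfolding F0 by simp
qed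

text \<open>The indices supported in the first n coordinates exhaust all multiindices, so the total
  is the limit of the finite-dimensional values; continuity along truncations identifies it.\<close>

lemma hier_surplus_has_sum:
  assumes \<xi>: "range \<xi> \<subseteq> {-1..1}" and y: "y \<in> unit_cube"
    and newton: "\<And>y m. y \<in> unit_cube \<Longrightarrow>
      (\<lambda>k. \<Sum>i\<le>k. newton_basis \<xi> k i (y m) * u (y(m := \<xi> i))) sums u y"
    and summ: "(\<lambda>\<nu>. hier_surplus \<xi> \<nu> u y) summable_on multiindices"
    and cont: "(\<lambda>n. u (\<lambda>j. if j < n then y j else \<xi> 0)) \<longlonglongrightarrow> u y"
  shows "((\<lambda>\<nu>. hier_surplus \<xi> \<nu> u y) has_sum u y) multiindices"
proof -
  define s where "s = (\<Sum>\<^sub>\<infinity>\<nu>\<in>multiindices. hier_surplus \<xi> \<nu> u y)"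
  have s: "((\<lambda>\<nu>. hier_surplus \<xi> \<nu> u y) has_sum s) multiindices"
    using summ by (simp add: s_def)
  define F where "F n = {\<nu>::nat \<Rightarrow> nat. supp \<nu> \<subseteq> {..<n}}" for n
  have sub: "F n \<subseteq> multiindices" for n
    using finite_subset by (auto simp: F_def multiindices_def)
  have Fn: "((\<lambda>\<nu>. hier_surplus \<xi> \<nu> u y) has_sum u (\<lambda>j. if j < n then y j else \<xi> 0)) (F n)" for n
    unfolding F_def
    by (rule hier_surplus_has_sum_finite[OF \<xi> y newton])
      (use summable_on_subset_banach[OF summ sub] in \<open>simp_all add: F_def\<close>)
  have "(\<lambda>n. u (\<lambda>j. if j < n then y j else \<xi> 0)) \<longlonglongrightarrow> s"
  proof (rule metric_LIMSEQ_I)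
    fix e :: real assume e: "e > 0"
    have "\<forall>\<^sub>F X in finite_subsets_at_top multiindices. dist (sum (\<lambda>\<nu>. hier_surplus \<xi> \<nu> u y) X) s < e / 2"
      using tendstoD[OF s[unfolded has_sum_def], of "e / 2"] e by simp
    then obtain X where X: "finite X" "X \<subseteq> multiindices"
      "\<forall>Y. finite Y \<and> X \<subseteq> Y \<and> Y \<subseteq> multiindices \<longrightarrow>
        dist (sum (\<lambda>\<nu>. hier_surplus \<xi> \<nu> u y) Y) s < e / 2"
      unfolding eventually_finite_subsets_at_top by (elim exE conjE) (rule that)
    have "finite (\<Union>\<nu>\<in>X. supp \<nu>)" using X by (auto simp: multiindices_def)
    then obtain n0 where n0: "(\<Union>\<nu>\<in>X. supp \<nu>) \<subseteq> {..<n0}"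
      using finite_nat_iff_bounded by blast
    have "dist (u (\<lambda>j. if j < n then y j else \<xi> 0)) s \<le> e / 2" if "n \<ge> n0" for n
    proof -
      have "{..<n0} \<subseteq> {..<n}" using that by auto
      note le = subset_trans[OF subset_trans[OF UN_upper n0] this]
      have XF: "X \<subseteq> F n" unfolding F_def by (intro subsetI CollectI le)
      have lim: "((\<lambda>Y. dist (sum (\<lambda>\<nu>. hier_surplus \<xi> \<nu> u y) Y) s) \<longlongrightarrow>
          dist (u (\<lambda>j. if j < n then y j else \<xi> 0)) s) (finite_subsets_at_top (F n))"
        using Fn[of n] unfolding has_sum_def by (intro tendsto_dist tendsto_const)
      show ?thesis
      proof (rule tendsto_upperbound[OF lim])
        show "\<forall>\<^sub>F Y in finite_subsets_at_top (F n). dist (sum (\<lambda>\<nu>. hier_surplus \<xi> \<nu> u y) Y) s \<le> e / 2"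
          unfolding eventually_finite_subsets_at_top
          using X XF sub[of n] by (intro exI[of _ X]) (meson less_imp_le order_trans)
      qed simp
    qed
    then show "\<exists>n0. \<forall>n\<ge>n0. dist (u (\<lambda>j. if j < n then y j else \<xi> 0)) s < e"
      using e by (intro exI[of _ n0]) fastforce
  qed
  then have "s = u y" using cont LIMSEQ_unique by blast
  then show ?thesis using s by simp
qed

text \<open>One-dimensional operator bounds multiply: with the operators of \<open>T\<close> already
  applied, the result is still holomorphic in the next variable and bounded uniformly on its set, so
  the one-dimensional bound applies once more. Stating it for arbitrary frozen \<open>z\<close> in
  \<open>P\<close> makes the induction close.\<close>

lemma tensor_operator_bound:
  fixes u :: "(nat \<Rightarrow> complex) \<Rightarrow> complex" and d :: "nat \<Rightarrow> nat \<Rightarrow> complex"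
  assumes "finite T" "T \<subseteq> S"
    and hol: "\<And>z j. z \<in> P \<Longrightarrow> j \<in> S \<Longrightarrow> (\<lambda>t. u (z(j := t))) holomorphic_on R j"
    and P: "P = {z. (\<forall>j\<in>S. z j \<in> R j) \<and> (\<forall>j. j \<notin> S \<longrightarrow> z j = b j)}"
    and M: "\<And>z. z \<in> P \<Longrightarrow> norm (u z) \<le> M"
    and x: "\<And>i j. j \<in> S \<Longrightarrow> x i \<in> R j"
    and bnd: "\<And>j f M'. j \<in> S \<Longrightarrow> f holomorphic_on R j \<Longrightarrow> (\<And>z. z \<in> R j \<Longrightarrow> norm (f z) \<le> M') \<Longrightarrow>
      norm (\<Sum>i\<le>\<nu> j. d j i * f (x i)) \<le> M' * g j"
    and z: "z \<in> P"
  shows "norm (\<Sum>\<mu>\<in>PiE T (\<lambda>j. {..\<nu> j}). (\<Prod>j\<in>T. d j (\<mu> j)) * u (\<lambda>j. if j \<in> T then x (\<mu> j) else z j))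
    \<le> M * (\<Prod>j\<in>T. g j)"
  using assms(1,2) z
proof (induction T arbitrary: z rule: finite_induct)
  case empty
  then show ?case using M by simp
next
  case (insert j T)
  define v where "v z = (\<Sum>\<mu>\<in>PiE T (\<lambda>j. {..\<nu> j}). (\<Prod>j\<in>T. d j (\<mu> j)) *
    u (\<lambda>j. if j \<in> T then x (\<mu> j) else z j))" for z
  have j: "j \<in> S" "j \<notin> T" using insert by auto
  have upd: "z(j := t) \<in> P" if "t \<in> R j" for t
    using insert.prems(2) j that by (auto simp: P)
  have zov: "(\<lambda>j. if j \<in> T then x (\<mu> j) else z j) \<in> P" for \<mu>
    using insert.prems x by (auto simp: P)
  have com: "(\<lambda>l. if l \<in> T then x (\<mu> l) else (z(j := t)) l) =
      (\<lambda>l. if l \<in> T then x (\<mu> l) else z l)(j := t)" for \<mu> t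
    using j by auto
  have holv: "(\<lambda>t. v (z(j := t))) holomorphic_on R j"
    unfolding v_def com by (intro holomorphic_intros hol zov j)
  have vb: "norm (v (z(j := t))) \<le> M * (\<Prod>j\<in>T. g j)" if "t \<in> R j" for t
    unfolding v_def using insert.IH[OF _ upd[OF that]] insert.prems by simp
  have "(\<Sum>\<mu>\<in>PiE (insert j T) (\<lambda>j. {..\<nu> j}). (\<Prod>j\<in>insert j T. d j (\<mu> j)) *
      u (\<lambda>l. if l \<in> insert j T then x (\<mu> l) else z l)) =
    (\<Sum>(i, \<mu>)\<in>{..\<nu> j} \<times> PiE T (\<lambda>j. {..\<nu> j}). d j i * ((\<Prod>j\<in>T. d j (\<mu> j)) *
      u (\<lambda>l. if l \<in> T then x (\<mu> l) else (z(j := x i)) l)))"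
    unfolding PiE_insert_eq
  proof (subst sum.reindex)
    show "inj_on (\<lambda>(y, g). g(j := y)) ({..\<nu> j} \<times> PiE T (\<lambda>j. {..\<nu> j}))"
      using j by (intro inj_combinator) auto
    show "sum ((\<lambda>\<mu>. (\<Prod>j\<in>insert j T. d j (\<mu> j)) *
      u (\<lambda>l. if l \<in> insert j T then x (\<mu> l) else z l)) \<circ> (\<lambda>(y, g). g(j := y))) ({..\<nu> j} \<times> PiE T (\<lambda>j. {..\<nu> j})) =
    (\<Sum>(i, \<mu>)\<in>{..\<nu> j} \<times> PiE T (\<lambda>j. {..\<nu> j}). d j i * ((\<Prod>j\<in>T. d j (\<mu> j)) *
      u (\<lambda>l. if l \<in> T then x (\<mu> l) else (z(j := x i)) l)))"
    proof (rule sum.cong[OF refl])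
      fix p :: "nat \<times> (nat \<Rightarrow> nat)"
      obtain i \<mu> where p: "p = (i, \<mu>)" by (cases p)
      have "(\<Prod>k\<in>T. d k ((\<mu>(j := i)) k)) = (\<Prod>k\<in>T. d k (\<mu> k))"
        using j by (intro prod.cong) auto
      then have "(\<Prod>k\<in>insert j T. d k ((\<mu>(j := i)) k)) = d j i * (\<Prod>k\<in>T. d k (\<mu> k))"
        using j insert.hyps by simp
      moreover have "(\<lambda>l. if l \<in> insert j T then x ((\<mu>(j := i)) l) else z l) =
          (\<lambda>l. if l \<in> T then x (\<mu> l) else (z(j := x i)) l)"
        using j by auto
      ultimately show "((\<lambda>\<mu>. (\<Prod>j\<in>insert j T. d j (\<mu> j)) *
          u (\<lambda>l. if l \<in> insert j T then x (\<mu> l) else z l)) \<circ> (\<lambda>(y, g). g(j := y))) p =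
        (case p of (i, \<mu>) \<Rightarrow> d j i * ((\<Prod>j\<in>T. d j (\<mu> j)) *
          u (\<lambda>l. if l \<in> T then x (\<mu> l) else (z(j := x i)) l)))"
        by (simp only: p o_apply prod.case mult.assoc)
    qed
  qed
  also have "\<dots> = (\<Sum>i\<le>\<nu> j. d j i * v (z(j := x i)))"
    by (simp add: v_def sum.cartesian_product[symmetric] sum_distrib_left)
  finally have eq: "(\<Sum>\<mu>\<in>PiE (insert j T) (\<lambda>j. {..\<nu> j}). (\<Prod>j\<in>insert j T. d j (\<mu> j)) *
      u (\<lambda>l. if l \<in> insert j T then x (\<mu> l) else z l)) = (\<Sum>i\<le>\<nu> j. d j i * v (z(j := x i)))" .
  have "norm (\<Sum>i\<le>\<nu> j. d j i * v (z(j := x i))) \<le> (M * (\<Prod>j\<in>T. g j)) * g j"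
    by (rule bnd[OF j(1) holv vb])
  then show ?case unfolding eq using insert.hyps by (simp add: mult_ac)
qed

text \<open>Every grid index below \<nu> is 0 off the support, so the inactive coordinates may be
  frozen at the first node and only finitely many complex variables remain.\<close>

lemma abs_hier_surplus_le:
  fixes U :: "(nat \<Rightarrow> complex) \<Rightarrow> complex"
  assumes \<nu>: "\<nu> \<in> multiindices" and S: "S = supp \<nu>"
    and P: "P = {z. (\<forall>j\<in>S. z j \<in> R j) \<and> (\<forall>j. j \<notin> S \<longrightarrow> z j = of_real (\<xi> 0))}"
    and hol: "\<And>z j. z \<in> P \<Longrightarrow> j \<in> S \<Longrightarrow> (\<lambda>t. U (z(j := t))) holomorphic_on R j"
    and M: "\<And>z. z \<in> P \<Longrightarrow> norm (U z) \<le> M"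
    and \<xi>: "\<And>i j. j \<in> S \<Longrightarrow> of_real (\<xi> i) \<in> R j"
    and bnd: "\<And>j f M'. j \<in> S \<Longrightarrow> f holomorphic_on R j \<Longrightarrow> (\<And>z. z \<in> R j \<Longrightarrow> norm (f z) \<le> M') \<Longrightarrow>
      norm (newton_term \<xi> (\<nu> j) (\<lambda>x. f (of_real x)) (y j)) \<le> M' * g j"
    and u: "\<And>\<mu>. U (\<lambda>j. of_real (\<xi> (\<mu> j))) = of_real (u (\<lambda>j. \<xi> (\<mu> j)))"
  shows "\<bar>hier_surplus \<xi> \<nu> u y\<bar> \<le> M * (\<Prod>j\<in>S. g j)"
proof -
  have fin: "finite S" using \<nu> by (simp add: S multiindices_def)
  define d where "d j i = complex_of_real (newton_basis \<xi> (\<nu> j) i (y j))" for j i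
  define z where "z = (\<lambda>_::nat. complex_of_real (\<xi> 0))"
  have z: "z \<in> P" using \<xi> by (auto simp: P z_def)
  have "complex_of_real (hier_surplus \<xi> \<nu> u y) =
      (\<Sum>\<mu>\<in>{..\<nu>}. (\<Prod>j\<in>S. d j (\<mu> j)) * U (\<lambda>j. of_real (\<xi> (\<mu> j))))"
    unfolding hier_surplus_def S[symmetric] by (simp add: d_def u mult.commute)
  also have "\<dots> = (\<Sum>\<mu>\<in>{..\<nu>}. (\<Prod>j\<in>S. d j (restrict \<mu> S j)) *
      U (\<lambda>j. if j \<in> S then of_real (\<xi> (restrict \<mu> S j)) else z j))"
  proof (rule sum.cong[OF refl])
    fix \<mu> assume "\<mu> \<in> {..\<nu>}"
    then have "\<mu> j \<le> \<nu> j" for j by (simp add: le_fun_def)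
    then have "\<mu> j = 0" if "j \<notin> S" for j using that by (metis (mono_tags, lifting) S le_zero_eq mem_Collect_eq)
    then have "(\<lambda>j. complex_of_real (\<xi> (\<mu> j))) = (\<lambda>j. if j \<in> S then of_real (\<xi> (restrict \<mu> S j)) else z j)"
      by (auto simp: z_def)
    then show "(\<Prod>j\<in>S. d j (\<mu> j)) * U (\<lambda>j. of_real (\<xi> (\<mu> j))) =
      (\<Prod>j\<in>S. d j (restrict \<mu> S j)) * U (\<lambda>j. if j \<in> S then of_real (\<xi> (restrict \<mu> S j)) else z j)"
      by simp
  qed
  also have "\<dots> = (\<Sum>\<mu>\<in>PiE S (\<lambda>j. {..\<nu> j}). (\<Prod>j\<in>S. d j (\<mu> j)) *
      U (\<lambda>j. if j \<in> S then of_real (\<xi> (\<mu> j)) else z j))"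
    by (rule sum.reindex_bij_betw[OF atMost_fun_eq_image_PiE]) (simp add: S)
  finally have "\<bar>hier_surplus \<xi> \<nu> u y\<bar> = norm (\<Sum>\<mu>\<in>PiE S (\<lambda>j. {..\<nu> j}). (\<Prod>j\<in>S. d j (\<mu> j)) *
      U (\<lambda>j. if j \<in> S then of_real (\<xi> (\<mu> j)) else z j))"
    by (metis norm_of_real)
  also have "\<dots> \<le> M * (\<Prod>j\<in>S. g j)"
    by (rule tensor_operator_bound[where P = P and S = S and R = R and b = "\<lambda>_. of_real (\<xi> 0)" and
        x = "\<lambda>i. of_real (\<xi> i)" and \<nu> = \<nu> and d = d and g = g and u = U and M = M,
        OF fin order_refl hol P M \<xi> bnd[unfolded newton_term_def, folded d_def] z])
  finally show ?thesis .
qed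

section \<open>Holomorphic parametrization\<close>

lemma compact_unit_cube: "compact unit_cube"
proof -
  have "compactin (product_topology (\<lambda>_. euclidean :: real topology) (UNIV :: nat set)) (PiE UNIV (\<lambda>_. {-1..1}))"
    by (subst compactin_PiE) auto
  moreover have "PiE UNIV (\<lambda>_. {-1..1}) = unit_cube"
    by (auto simp: unit_cube_def PiE_def)
  ultimately show ?thesis by (simp add: euclidean_product_topology)
qed

lemma tendsto_fun_iff:
  fixes f :: "'a \<Rightarrow> 'i \<Rightarrow> 'b::topological_space"
  shows "(f \<longlongrightarrow> l) F \<longleftrightarrow> (\<forall>i. ((\<lambda>x. f x i) \<longlongrightarrow> l i) F)"
  using limitin_componentwise[of "\<lambda>_. euclidean" UNIV f l F]
  by (simp add: euclidean_product_topology)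

lemma bounded_linear_inner_complexified: "bounded_linear (\<lambda>y. inner_complexified y v)"
proof -
  have "(\<lambda>y. inner_complexified y v) = (\<lambda>y. of_real (fst y \<bullet> v) + \<i> * of_real (snd y \<bullet> v))"
    by (simp add: inner_complexified_def fun_eq_iff complex_eq_iff)
  moreover have "bounded_linear (\<lambda>y. complex_of_real (fst y \<bullet> v) + \<i> * of_real (snd y \<bullet> v))"
    by (intro bounded_linear_add bounded_linear_const_mult
        bounded_linear_compose[OF bounded_linear_of_real]
        bounded_linear_compose[OF bounded_linear_inner_left] bounded_linear_fst bounded_linear_snd)
  ultimately show ?thesis by simp
qed

lemma inner_complexified_cscale: "inner_complexified (cscale z h) v = z * inner_complexified h v"
  by (simp add: inner_complexified_def cscale_def complex_eq_iff inner_diff_left inner_add_left)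

lemma bounded_linear_cscale: "bounded_linear (\<lambda>z. cscale z (h :: 'a::real_normed_vector \<times> 'a))"
  unfolding cscale_def
  by (intro bounded_linear_Pair bounded_linear_sub bounded_linear_add
      bounded_linear_compose[OF bounded_linear_scaleR_left] bounded_linear_Re bounded_linear_Im)

locale holomorphic_parametrization =
  fixes \<psi> :: "nat \<Rightarrow> 'x::{real_inner, banach}"
    and \<eta> :: "nat \<Rightarrow> 'y::real_inner"
    and w :: "nat \<Rightarrow> real" and r s t M B :: real
    and G :: "'x \<Rightarrow> 'y" and Om :: "('x \<times> 'x) set" and GC :: "'x \<times> 'x \<Rightarrow> 'y \<times> 'y"
  assumes bessel: "bessel_bound \<psi> B"
    and w_pos: "0 < w j" and w_summable: "summable (\<lambda>j. w j powr s)"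
    and r_pos: "r > 0"
    and open_Om: "open Om"
    and cube_sub: "a \<in> C_tilde r s w \<psi> \<Longrightarrow> (a, 0) \<in> Om"
    and GC_real: "a \<in> C_tilde r s w \<psi> \<Longrightarrow> GC (a, 0) = (G a, 0)"
    and hol: "holomorphic_map_on GC Om"
    and GC_Yt: "p \<in> Om \<Longrightarrow> GC p \<in> Yt_complex w \<eta> t"
    and GC_bound: "p \<in> Om \<Longrightarrow> Yt_complex_norm w \<eta> t (GC p) \<le> M"
begin

abbreviation \<sigma> :: "(nat \<Rightarrow> real) \<Rightarrow> 'x"
  where "\<sigma> \<equiv> sigma_map r s w \<psi>"

text \<open>The complex-linear extension of \<open>sigma_map\<close>, with the complexification
  represented by pairs.\<close>

definition csigma :: "(nat \<Rightarrow> complex) \<Rightarrow> 'x \<times> 'x"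
  where "csigma z = (\<sigma> (\<lambda>j. Re (z j)), \<sigma> (\<lambda>j. Im (z j)))"

definition out_coeff :: "nat \<Rightarrow> (nat \<Rightarrow> real) \<Rightarrow> real"
  where "out_coeff j y = G (\<sigma> y) \<bullet> canonical_dual \<eta> j"

lemma B_nonneg: "0 \<le> B"
  using bessel by (simp add: bessel_bound_def)

lemma norm_term_le: "\<bar>x\<bar> \<le> 1 \<Longrightarrow> norm ((w j powr s * x) *\<^sub>R \<psi> j) \<le> w j powr s * B"
  using bessel_bound_norm_le[OF bessel, of j] B_nonneg mult_mono[of "\<bar>x\<bar>" 1 "norm (\<psi> j)" B]
  by (simp add: abs_mult mult.assoc mult_left_mono)

lemma sigma_summable: "y \<in> unit_cube \<Longrightarrow> summable (\<lambda>j. (w j powr s * y j) *\<^sub>R \<psi> j)"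
  by (rule summable_comparison_test'[OF summable_mult2[OF w_summable, of B], of 0])
    (rule norm_term_le, simp add: unit_cube_def abs_le_iff minus_le_iff)

lemma sigma_in_C_tilde: "y \<in> unit_cube \<Longrightarrow> \<sigma> y \<in> C_tilde r s w \<psi>"
  by (auto simp: C_tilde_def)

lemma M_nonneg: "0 \<le> M"
proof -
  have "(\<lambda>_. 0) \<in> unit_cube" by (simp add: unit_cube_def)
  note om = cube_sub[OF sigma_in_C_tilde[OF this]]
  have "0 \<le> Yt_complex_norm w \<eta> t (GC (\<sigma> (\<lambda>_. 0), 0))"
    unfolding Yt_complex_norm_def
    using GC_Yt[OF om] by (intro real_sqrt_ge_zero suminf_nonneg) (auto simp: Yt_complex_def)
  then show ?thesis using GC_bound[OF om] by simp
qed

lemma continuous_on_sigma: "continuous_on unit_cube \<sigma>"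
proof -
  have "uniform_limit unit_cube (\<lambda>n y. \<Sum>j<n. (w j powr s * y j) *\<^sub>R \<psi> j)
      (\<lambda>y. \<Sum>j. (w j powr s * y j) *\<^sub>R \<psi> j) sequentially"
    by (rule Weierstrass_m_test[OF _ summable_mult2[OF w_summable, of B]])
      (rule norm_term_le, simp add: unit_cube_def abs_le_iff minus_le_iff)
  moreover have "continuous_on unit_cube (\<lambda>y. \<Sum>j<n. (w j powr s * y j) *\<^sub>R \<psi> j)" for n
    by (intro continuous_intros continuous_on_product_then_coordinatewise[OF continuous_on_id])
  ultimately have "continuous_on unit_cube (\<lambda>y. \<Sum>j. (w j powr s * y j) *\<^sub>R \<psi> j)"
    by (intro uniform_limit_theorem[of _ _ sequentially]) auto
  then show ?thesis
    unfolding sigma_map_def by (intro continuous_intros)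
qed

section \<open>A uniform complex neighbourhood of the parameter set\<close>

definition tube :: "real \<Rightarrow> bool"
  where "tube \<epsilon> \<longleftrightarrow> (\<forall>y\<in>unit_cube. \<forall>h. norm (h - (\<sigma> y, 0)) < \<epsilon> \<longrightarrow> h \<in> Om)"

text \<open>The cube is compact in the product topology and \<open>\<sigma>\<close> is continuous on
  it, so one radius inside the open set serves all parameters simultaneously.\<close>

lemma ball_radius:
  obtains \<epsilon> where "\<epsilon> > 0" "tube \<epsilon>"
proof -
  define K where "K = (\<lambda>y. (\<sigma> y, 0 :: 'x)) ` unit_cube"
  have "compact K" unfolding K_def
    by (intro compact_continuous_image compact_unit_cube continuous_intros continuous_on_sigma)
  moreover have "K \<subseteq> Om" using cube_sub sigma_in_C_tilde by (auto simp: K_def)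
  ultimately obtain \<epsilon> where \<epsilon>: "\<epsilon> > 0" "(\<Union>x\<in>K. ball x \<epsilon>) \<subseteq> Om"
    using compact_subset_open_imp_ball_epsilon_subset[OF _ open_Om] by metis
  show ?thesis
  proof (rule that[OF \<epsilon>(1)], unfold tube_def, intro ballI allI impI)
    fix y and h :: "'x \<times> 'x" assume "y \<in> unit_cube" "norm (h - (\<sigma> y, 0)) < \<epsilon>"
    then have "(\<sigma> y, 0) \<in> K" "h \<in> ball (\<sigma> y, 0) \<epsilon>"
      by (auto simp: K_def dist_norm norm_minus_commute)
    then show "h \<in> Om" using \<epsilon>(2) by blast
  qed
qed

lemma sigma_finite_change:
  assumes "finite S" "\<And>j. j \<notin> S \<Longrightarrow> x j = x' j" "summable (\<lambda>j. (w j powr s * x' j) *\<^sub>R \<psi> j)"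
  shows "summable (\<lambda>j. (w j powr s * x j) *\<^sub>R \<psi> j)"
    and "\<sigma> x = \<sigma> x' + r *\<^sub>R (\<Sum>j\<in>S. (w j powr s * (x j - x' j)) *\<^sub>R \<psi> j)"
proof -
  have eq: "(\<lambda>j. (w j powr s * x j) *\<^sub>R \<psi> j) = (\<lambda>j. (w j powr s * x' j) *\<^sub>R \<psi> j +
      (if j \<in> S then (w j powr s * (x j - x' j)) *\<^sub>R \<psi> j else 0))"
    using assms(2) by (auto simp: fun_eq_iff algebra_simps)
  have "(\<lambda>j. (w j powr s * x j) *\<^sub>R \<psi> j) sums
    ((\<Sum>j. (w j powr s * x' j) *\<^sub>R \<psi> j) + (\<Sum>j\<in>S. (w j powr s * (x j - x' j)) *\<^sub>R \<psi> j))"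
    unfolding eq by (intro sums_add summable_sums assms(3) sums_If_finite_set assms(1))
  then show "summable (\<lambda>j. (w j powr s * x j) *\<^sub>R \<psi> j)"
    and "\<sigma> x = \<sigma> x' + r *\<^sub>R (\<Sum>j\<in>S. (w j powr s * (x j - x' j)) *\<^sub>R \<psi> j)"
    by (auto simp: sums_iff sigma_map_def scaleR_add_right)
qed

definition poly_rectangle :: "(nat \<Rightarrow> real) \<Rightarrow> nat set \<Rightarrow> (nat \<Rightarrow> complex) set"
  where "poly_rectangle \<kappa> S =
    {z. (\<forall>j\<in>S. z j \<in> rectangle (\<kappa> j)) \<and> (\<forall>j. j \<notin> S \<longrightarrow> Im (z j) = 0 \<and> Re (z j) \<in> {-1..1})}"

lemma poly_rectangle_summable:
  assumes "finite S" "z \<in> poly_rectangle \<kappa> S"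
  shows "summable (\<lambda>j. (w j powr s * Re (z j)) *\<^sub>R \<psi> j)" "summable (\<lambda>j. (w j powr s * Im (z j)) *\<^sub>R \<psi> j)"
proof -
  show "summable (\<lambda>j. (w j powr s * Re (z j)) *\<^sub>R \<psi> j)"
    by (rule sigma_finite_change(1)[OF assms(1), of _ "\<lambda>j. if j \<in> S then 0 else Re (z j)"])
      (use assms in \<open>auto intro!: sigma_summable simp: unit_cube_def poly_rectangle_def\<close>)
  show "summable (\<lambda>j. (w j powr s * Im (z j)) *\<^sub>R \<psi> j)"
    by (rule sigma_finite_change(1)[OF assms(1), of _ "\<lambda>j. 0"])
      (use assms in \<open>auto simp: poly_rectangle_def\<close>)
qed

text \<open>Clipping the real parts to the interval gives a real cube point \<open>x\<close>. In
  each coordinate of \<open>S\<close> the real part moves by at most \<open>\<kappa> j\<close> and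
  the imaginary part is at most \<open>\<kappa> j\<close>; the two contributions produce the factor
  2.\<close>

lemma csigma_in_Om:
  assumes \<epsilon>: "tube \<epsilon>"
    and S: "finite S" and z: "z \<in> poly_rectangle \<kappa> S"
    and \<kappa>: "\<And>j. j \<in> S \<Longrightarrow> \<kappa> j > 0" and small: "2 * r * B * (\<Sum>j\<in>S. w j powr s * \<kappa> j) < \<epsilon>"
  shows "csigma z \<in> Om"
proof -
  define x where "x j = max (-1) (min 1 (Re (z j)))" for j
  have x: "x \<in> unit_cube" by (auto simp: unit_cube_def x_def)
  have bd: "norm (r *\<^sub>R (\<Sum>j\<in>S. (w j powr s * d j) *\<^sub>R \<psi> j)) \<le> r * B * (\<Sum>j\<in>S. w j powr s * \<kappa> j)"
    if "\<And>j. j \<in> S \<Longrightarrow> \<bar>d j\<bar> \<le> \<kappa> j" for d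
  proof -
    have "norm (\<Sum>j\<in>S. (w j powr s * d j) *\<^sub>R \<psi> j) \<le> (\<Sum>j\<in>S. w j powr s * \<kappa> j * B)"
    proof (rule sum_norm_le)
      fix j assume j: "j \<in> S"
      have "\<bar>d j\<bar> * norm (\<psi> j) \<le> \<kappa> j * B"
        using that[OF j] bessel_bound_norm_le[OF bessel, of j] \<kappa>[OF j] by (intro mult_mono) auto
      then show "norm ((w j powr s * d j) *\<^sub>R \<psi> j) \<le> w j powr s * \<kappa> j * B"
        by (simp add: abs_mult mult.assoc mult_left_mono)
    qed
    then show ?thesis using r_pos by (simp add: sum_distrib_right mult_ac flip: sum_distrib_left)
  qed
  have "norm (csigma z - (\<sigma> x, 0)) \<le> norm (\<sigma> (\<lambda>j. Re (z j)) - \<sigma> x) + norm (\<sigma> (\<lambda>j. Im (z j)))"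
    by (simp add: csigma_def norm_Pair_le)
  also have "\<sigma> (\<lambda>j. Re (z j)) - \<sigma> x = r *\<^sub>R (\<Sum>j\<in>S. (w j powr s * (Re (z j) - x j)) *\<^sub>R \<psi> j)"
  proof -
    have "Re (z j) = x j" if "j \<notin> S" for j using z that by (auto simp: poly_rectangle_def x_def)
    from sigma_finite_change(2)[OF S this sigma_summable[OF x]] show ?thesis by simp
  qed
  also have "norm \<dots> \<le> r * B * (\<Sum>j\<in>S. w j powr s * \<kappa> j)"
  proof (rule bd)
    fix j assume "j \<in> S"
    with z \<kappa> have "\<bar>Re (z j)\<bar> \<le> 1 + \<kappa> j" "\<kappa> j > 0" by (auto simp: poly_rectangle_def in_rectangle_iff)
    then show "\<bar>Re (z j) - x j\<bar> \<le> \<kappa> j" by (auto simp: x_def max_def min_def)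
  qed
  also have "\<sigma> (\<lambda>j. Im (z j)) = r *\<^sub>R (\<Sum>j\<in>S. (w j powr s * Im (z j)) *\<^sub>R \<psi> j)"
    using sigma_finite_change(2)[OF S, of "\<lambda>j. Im (z j)" "\<lambda>_. 0"] z
    by (auto simp: poly_rectangle_def sigma_map_def)
  also have "norm \<dots> \<le> r * B * (\<Sum>j\<in>S. w j powr s * \<kappa> j)"
    by (rule bd) (use z in \<open>auto simp: poly_rectangle_def in_rectangle_iff\<close>)
  finally have "norm (csigma z - (\<sigma> x, 0)) < \<epsilon>" using small by (simp add: mult_ac)
  then show ?thesis using \<epsilon> x unfolding tube_def by blast
qed

lemma csigma_update:
  assumes "summable (\<lambda>j. (w j powr s * Re (z j)) *\<^sub>R \<psi> j)" "summable (\<lambda>j. (w j powr s * Im (z j)) *\<^sub>R \<psi> j)"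
  shows "csigma (z(j := h)) = csigma z + cscale (h - z j) ((r * w j powr s) *\<^sub>R \<psi> j, 0)"
  using sigma_finite_change(2)[of "{j}" "\<lambda>i. Re ((z(j := h)) i)" "\<lambda>i. Re (z i)"]
    sigma_finite_change(2)[of "{j}" "\<lambda>i. Im ((z(j := h)) i)" "\<lambda>i. Im (z i)"] assms
  by (simp add: csigma_def cscale_def mult_ac)

text \<open>Along a complex line the chain rule yields the derivative h to D (cscale h q); complex
  linearity of \<open>D\<close> turns this into multiplication by a complex number, that is, into an
  ordinary complex derivative.\<close>

lemma holomorphic_on_GC_inner:
  assumes "\<And>h. h \<in> R \<Longrightarrow> p + cscale (h - c) q \<in> Om"
  shows "(\<lambda>h. inner_complexified (GC (p + cscale (h - c) q)) v) holomorphic_on R"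
  unfolding holomorphic_on_def
proof
  fix h assume "h \<in> R"
  then obtain D where D: "(GC has_derivative D) (at (p + cscale (h - c) q))"
    "\<And>z h. D (cscale z h) = cscale z (D h)"
    using assms hol unfolding holomorphic_map_on_def by blast
  have "((\<lambda>h. cscale h q) has_derivative (\<lambda>h. cscale h q)) (at (h - c))"
    by (rule bounded_linear_imp_has_derivative[OF bounded_linear_cscale])
  then have "((\<lambda>h. p + cscale (h - c) q) has_derivative (\<lambda>h. cscale h q)) (at h)"
    by (auto intro!: derivative_eq_intros has_derivative_compose[of "\<lambda>h. h - c" _ _ _ "\<lambda>h. cscale h q"])
  from has_derivative_compose[OF this D(1)]
  have "((\<lambda>h. GC (p + cscale (h - c) q)) has_derivative (\<lambda>h. D (cscale h q))) (at h)" .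
  from bounded_linear.has_derivative[OF bounded_linear_inner_complexified this]
  have "((\<lambda>h. inner_complexified (GC (p + cscale (h - c) q)) v) has_derivative
      (\<lambda>h. inner_complexified (D q) v * h)) (at h)"
    by (simp add: D(2) inner_complexified_cscale mult.commute)
  then have "((\<lambda>h. inner_complexified (GC (p + cscale (h - c) q)) v) has_field_derivative
      inner_complexified (D q) v) (at h)"
    by (simp add: has_field_derivative_def)
  then show "(\<lambda>h. inner_complexified (GC (p + cscale (h - c) q)) v) field_differentiable (at h within R)"
    using field_differentiable_at_within field_differentiable_def by blast
qed

definition ccoeff :: "nat \<Rightarrow> (nat \<Rightarrow> complex) \<Rightarrow> complex"
  where "ccoeff j z = inner_complexified (GC (csigma z)) (canonical_dual \<eta> j)"

lemma ccoeff_of_real: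
  assumes "y \<in> unit_cube"
  shows "ccoeff j (\<lambda>i. of_real (y i)) = of_real (out_coeff j y)"
proof -
  have "csigma (\<lambda>i. of_real (y i)) = (\<sigma> y, 0)" by (simp add: csigma_def sigma_map_def)
  then show ?thesis
    using GC_real[OF sigma_in_C_tilde[OF assms]]
    by (simp add: ccoeff_def out_coeff_def inner_complexified_def complex_eq_iff)
qed

text \<open>Cauchy-Schwarz with the weight split between both factors. Testing with arbitrary real
  \<beta> encodes the weighted norm bound through scalar functions, to which one-variable Cauchy
  estimates apply.\<close>

lemma norm_ccoeff_sum_le:
  assumes "csigma z \<in> Om"
  shows "norm (\<Sum>j<J. of_real (\<beta> j) * ccoeff j z) \<le> M * sqrt (\<Sum>j<J. (\<beta> j * w j powr t)\<^sup>2)"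
proof -
  define c where "c j = norm (ccoeff j z)" for j
  have sm: "summable (\<lambda>j. (c j)\<^sup>2 * w j powr (- 2 * t))"
    using GC_Yt[OF assms] by (simp add: Yt_complex_def c_def ccoeff_def)
  have le: "sqrt (\<Sum>j. (c j)\<^sup>2 * w j powr (- 2 * t)) \<le> M"
    using GC_bound[OF assms] by (simp add: Yt_complex_norm_def c_def ccoeff_def)
  have "(\<Sum>j<J. (c j * w j powr (- t))\<^sup>2) = (\<Sum>j<J. (c j)\<^sup>2 * w j powr (- 2 * t))"
    by (simp add: power_mult_distrib power2_eq_square[of "_ powr _"] flip: powr_add)
  also have "\<dots> \<le> (\<Sum>j. (c j)\<^sup>2 * w j powr (- 2 * t))"
    by (rule sum_le_suminf[OF sm]) auto
  finally have "sqrt (\<Sum>j<J. (c j * w j powr (- t))\<^sup>2) \<le> M"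
    using le by (meson order_trans real_sqrt_le_mono)
  then have L: "L2_set (\<lambda>j. c j * w j powr (- t)) {..<J} \<le> M" by (simp add: L2_set_def)
  have "norm (\<Sum>j<J. of_real (\<beta> j) * ccoeff j z) \<le> (\<Sum>j<J. \<bar>c j * w j powr (- t)\<bar> * \<bar>\<beta> j * w j powr t\<bar>)"
  proof (rule sum_norm_le)
    fix j
    have "w j powr (- t) * w j powr t = 1" using w_pos[of j] by (simp flip: powr_add)
    then have "c j * \<bar>\<beta> j\<bar> = c j * \<bar>\<beta> j\<bar> * (w j powr (- t) * w j powr t)" by simp
    also have "\<dots> = \<bar>c j * w j powr (- t)\<bar> * \<bar>\<beta> j * w j powr t\<bar>"
      by (simp add: abs_mult c_def mult_ac)
    finally show "norm (of_real (\<beta> j) * ccoeff j z) \<le> \<bar>c j * w j powr (- t)\<bar> * \<bar>\<beta> j * w j powr t\<bar>"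
      by (simp only: norm_mult c_def norm_of_real mult.commute order_refl)
  qed
  also have "\<dots> \<le> L2_set (\<lambda>j. c j * w j powr (- t)) {..<J} * L2_set (\<lambda>j. \<beta> j * w j powr t) {..<J}"
    by (rule L2_set_mult_ineq)
  also have "\<dots> \<le> M * L2_set (\<lambda>j. \<beta> j * w j powr t) {..<J}"
    by (intro mult_right_mono L L2_set_nonneg)
  finally show ?thesis by (simp add: L2_set_def)
qed

lemma ccoeff_sum_holomorphic:
  assumes \<epsilon>: "tube \<epsilon>"
    and S: "finite S" and z: "z \<in> poly_rectangle \<kappa> S" and j: "j \<in> S"
    and \<kappa>: "\<And>j. j \<in> S \<Longrightarrow> \<kappa> j > 0" and small: "2 * r * B * (\<Sum>j\<in>S. w j powr s * \<kappa> j) < \<epsilon>"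
  shows "(\<lambda>h. \<Sum>i<J. of_real (\<beta> i) * ccoeff i (z(j := h))) holomorphic_on rectangle (\<kappa> j)"
proof (intro holomorphic_intros)
  fix i
  define q where "q = ((r * w j powr s) *\<^sub>R \<psi> j, 0 :: 'x)"
  have upd: "csigma (z(j := h)) = csigma z + cscale (h - z j) q" for h
    unfolding q_def by (rule csigma_update) (use poly_rectangle_summable[OF S z] in auto)
  have "(\<lambda>h. inner_complexified (GC (csigma z + cscale (h - z j) q)) (canonical_dual \<eta> i))
      holomorphic_on rectangle (\<kappa> j)"
  proof (rule holomorphic_on_GC_inner)
    fix h assume "h \<in> rectangle (\<kappa> j)"
    then have "z(j := h) \<in> poly_rectangle \<kappa> S" using z j by (auto simp: poly_rectangle_def)
    from csigma_in_Om[OF \<epsilon> S this \<kappa> small] show "csigma z + cscale (h - z j) q \<in> Om"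
      by (simp add: upd)
  qed
  then show "(\<lambda>h. ccoeff i (z(j := h))) holomorphic_on rectangle (\<kappa> j)"
    by (simp add: ccoeff_def upd)
qed

lemma abs_sum_hier_surplus_le:
  assumes \<epsilon>: "tube \<epsilon>"
    and \<xi>: "range \<xi> \<subseteq> {-1..1}"
    and \<nu>: "\<nu> \<in> multiindices" and S: "S = supp \<nu>"
    and \<kappa>: "\<And>j. j \<in> S \<Longrightarrow> \<kappa> j > 0" and small: "2 * r * B * (\<Sum>j\<in>S. w j powr s * \<kappa> j) < \<epsilon>"
    and g: "\<And>j f M'. j \<in> S \<Longrightarrow> f holomorphic_on rectangle (\<kappa> j) \<Longrightarrow>
      (\<And>z. z \<in> rectangle (\<kappa> j) \<Longrightarrow> norm (f z) \<le> M') \<Longrightarrow>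
      norm (newton_term \<xi> (\<nu> j) (\<lambda>x. f (of_real x)) (y j)) \<le> M' * g j"
  shows "\<bar>\<Sum>j<J. \<beta> j * hier_surplus \<xi> \<nu> (out_coeff j) y\<bar> \<le>
    M * sqrt (\<Sum>j<J. (\<beta> j * w j powr t)\<^sup>2) * (\<Prod>j\<in>S. g j)"
proof -
  have fin: "finite S" using \<nu> by (simp add: S multiindices_def)
  have \<xi>in: "\<xi> i \<in> {-1..1}" for i using \<xi> by blast
  define P where "P = {z. (\<forall>j\<in>S. z j \<in> rectangle (\<kappa> j)) \<and> (\<forall>j. j \<notin> S \<longrightarrow> z j = complex_of_real (\<xi> 0))}"
  have P: "z \<in> poly_rectangle \<kappa> S" if "z \<in> P" for z
    using that \<xi>in[of 0] by (auto simp: P_def poly_rectangle_def)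
  have "\<bar>hier_surplus \<xi> \<nu> (\<lambda>y. \<Sum>j<J. \<beta> j * out_coeff j y) y\<bar> \<le>
      M * sqrt (\<Sum>j<J. (\<beta> j * w j powr t)\<^sup>2) * (\<Prod>j\<in>S. g j)"
  proof (rule abs_hier_surplus_le[where R = "\<lambda>j. rectangle (\<kappa> j)" and \<xi> = \<xi> and
        U = "\<lambda>z. \<Sum>j<J. of_real (\<beta> j) * ccoeff j z", OF \<nu> S P_def])
    show "(\<lambda>h. \<Sum>i<J. of_real (\<beta> i) * ccoeff i (z(j := h))) holomorphic_on rectangle (\<kappa> j)"
      if "z \<in> P" "j \<in> S" for z j
      by (rule ccoeff_sum_holomorphic[OF \<epsilon> fin P[OF that(1)] that(2) \<kappa> small])
    show "norm (\<Sum>j<J. of_real (\<beta> j) * ccoeff j z) \<le> M * sqrt (\<Sum>j<J. (\<beta> j * w j powr t)\<^sup>2)"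
      if "z \<in> P" for z
      by (rule norm_ccoeff_sum_le[OF csigma_in_Om[OF \<epsilon> fin P[OF that] \<kappa> small]])
    show "complex_of_real (\<xi> i) \<in> rectangle (\<kappa> j)" if "j \<in> S" for i j
      using \<xi>in[of i] \<kappa>[OF that] by (auto simp: in_rectangle_iff)
    show "(\<Sum>j<J. of_real (\<beta> j) * ccoeff j (\<lambda>i. complex_of_real (\<xi> (\<mu> i)))) =
        of_real (\<Sum>j<J. \<beta> j * out_coeff j (\<lambda>i. \<xi> (\<mu> i)))" for \<mu>
      using \<xi>in by (subst ccoeff_of_real) (auto simp: unit_cube_def)
  qed (use g in auto)
  then show ?thesis by (simp add: hier_surplus_linear)
qed

text \<open>All coordinates but the m-th stay real, so a small rectangle in one variable remains
  inside the tube. A single coefficient is treated as the combination with an indicator for \<beta>,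
  which makes the bounds for sums available.\<close>

lemma out_coeff_newton_sums:
  assumes \<epsilon>: "\<epsilon> > 0" "tube \<epsilon>"
    and y: "y \<in> unit_cube"
  shows "(\<lambda>k. \<Sum>i\<le>k. newton_basis node k i (y m) * out_coeff j (y(m := node i))) sums out_coeff j y"
proof -
  define c where "c = 2 * r * B * w m powr s"
  have c: "c \<ge> 0" using r_pos B_nonneg by (simp add: c_def)
  define k0 where "k0 = \<epsilon> / (c + 1)"
  have k0: "k0 > 0" using \<epsilon> c by (simp add: k0_def)
  have "c * k0 < \<epsilon>" using \<epsilon> c by (simp add: k0_def field_simps)
  then have small: "2 * r * B * (\<Sum>j\<in>{m}. w j powr s * k0) < \<epsilon>" by (simp add: c_def mult_ac)
  define z where "z = (\<lambda>i. complex_of_real (y i))"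
  have z: "z \<in> poly_rectangle (\<lambda>_. k0) {m}"
    using y k0 by (auto simp: z_def poly_rectangle_def unit_cube_def in_rectangle_iff abs_le_iff add_increasing2 minus_le_iff)
  define f where "f h = ccoeff j (z(m := h))" for h
  have fsum: "f h = (\<Sum>i<Suc j. of_real (if i = j then 1 else 0) * ccoeff i (z(m := h)))" for h
    by (simp add: f_def)
  have hol: "f holomorphic_on rectangle k0"
    using ccoeff_sum_holomorphic[where j = m and J = "Suc j" and \<beta> = "\<lambda>i. if i = j then 1 else 0",
        OF \<epsilon>(2) _ z _ _ small] k0
    unfolding fsum[symmetric] by simp
  have bd: "norm (f h) \<le> M * sqrt (\<Sum>i<Suc j. ((if i = j then 1 else 0) * w i powr t)\<^sup>2)"
    if "h \<in> rectangle k0" for h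
  proof -
    have "z(m := h) \<in> poly_rectangle (\<lambda>_. k0) {m}" using z that by (auto simp: poly_rectangle_def)
    from csigma_in_Om[OF \<epsilon>(2) _ this _ small] k0 have "csigma (z(m := h)) \<in> Om" by simp
    then show ?thesis unfolding fsum by (rule norm_ccoeff_sum_le)
  qed
  have ym: "y m \<in> {-1..1}" using y by (simp add: unit_cube_def)
  have fr: "f (of_real x) = of_real (out_coeff j (y(m := x)))" if "x \<in> {-1..1}" for x
  proof -
    have "z(m := of_real x) = (\<lambda>i. of_real ((y(m := x)) i))" by (auto simp: z_def)
    moreover have "y(m := x) \<in> unit_cube" using y that by (simp add: unit_cube_def)
    ultimately show ?thesis unfolding f_def using ccoeff_of_real by metis
  qed
  have "(\<lambda>k. newton_term node k (\<lambda>x. f (of_real x)) (y m)) sums f (of_real (y m))"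
    by (rule newton_series_node[OF hol k0 bd ym])
  moreover have "newton_term node k (\<lambda>x. f (of_real x)) (y m) =
      of_real (\<Sum>i\<le>k. newton_basis node k i (y m) * out_coeff j (y(m := node i)))" for k
    unfolding newton_term_def using fr[OF node_in] by simp
  ultimately show ?thesis by (simp only: fr[OF ym] sums_of_real_iff fun_upd_triv)
qed

lemma out_coeff_truncation_tendsto:
  assumes y: "y \<in> unit_cube" and x: "x \<in> {-1..1}"
  shows "(\<lambda>n. out_coeff j (\<lambda>i. if i < n then y i else x)) \<longlonglongrightarrow> out_coeff j y"
proof -
  let ?y = "\<lambda>n i. if i < n then y i else x"
  have mem: "?y n \<in> unit_cube" for n using y x by (auto simp: unit_cube_def)
  have "?y \<longlonglongrightarrow> y"
    unfolding tendsto_fun_iff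
  proof
    fix i
    show "(\<lambda>n. ?y n i) \<longlonglongrightarrow> y i"
      by (rule tendsto_eventually) (auto simp: eventually_sequentially intro!: exI[of _ "Suc i"])
  qed
  then have "(\<lambda>n. \<sigma> (?y n)) \<longlonglongrightarrow> \<sigma> y"
    by (rule continuous_on_tendsto_compose[OF continuous_on_sigma]) (use y mem in auto)
  then have lim: "(\<lambda>n. (\<sigma> (?y n), 0 :: 'x)) \<longlonglongrightarrow> (\<sigma> y, 0)" by (intro tendsto_intros)
  have "isCont GC (\<sigma> y, 0)"
    using hol cube_sub[OF sigma_in_C_tilde[OF y]] unfolding holomorphic_map_on_def
    by (meson has_derivative_continuous)
  from isCont_tendsto_compose[OF this lim]
  have "(\<lambda>n. GC (\<sigma> (?y n), 0)) \<longlonglongrightarrow> GC (\<sigma> y, 0)" .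
  then have "(\<lambda>n. fst (GC (\<sigma> (?y n), 0)) \<bullet> canonical_dual \<eta> j) \<longlonglongrightarrow> fst (GC (\<sigma> y, 0)) \<bullet> canonical_dual \<eta> j"
    by (intro tendsto_intros)
  then show ?thesis
    by (simp add: GC_real sigma_in_C_tilde mem y out_coeff_def)
qed

end

section \<open>Decay of the surpluses\<close>

text \<open>For a decreasing summable sequence, j + 1 times its j-th term is at most the total sum.
  Apply this to the weights raised to p = t / \<alpha> > 1 and take the power \<alpha>.\<close>

lemma admissible_weights_decay:
  assumes "admissible_weights w" "0 < \<alpha>" "\<alpha> < t"
  obtains C where "C > 0" "\<And>j. w j powr t \<le> C * real (Suc j) powr (- \<alpha>)"
proof -
  define p where "p = t / \<alpha>"
  have p: "p > 1" using assms by (simp add: p_def)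
  have pos: "0 < w j" and dec: "decseq w" for j using assms(1) by (auto simp: admissible_weights_def)
  have "summable (\<lambda>j. w j powr (1 + (p - 1)))"
    using assms(1) p unfolding admissible_weights_def by (meson diff_gt_0_iff_gt)
  then have sm: "summable (\<lambda>j. w j powr p)" by simp
  define W where "W = (\<Sum>j. w j powr p)"
  have le: "real (Suc j) * w j powr p \<le> W" for j
  proof -
    have "(\<Sum>i<Suc j. w j powr p) \<le> (\<Sum>i<Suc j. w i powr p)"
      using dec pos p by (intro sum_mono powr_mono2) (auto simp: decseq_def less_imp_le)
    also have "\<dots> \<le> W" unfolding W_def by (intro sum_le_suminf sm) auto
    finally show ?thesis by simp
  qed
  have "0 < real (Suc 0) * w 0 powr p" using pos[of 0] by simp
  then have W: "W > 0" using le[of 0] by linarith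
  show ?thesis
  proof (rule that[of "W powr \<alpha>"])
    fix j
    have "w j powr p \<le> W / real (Suc j)" using le[of j] by (simp add: field_simps)
    then have "(w j powr p) powr \<alpha> \<le> (W / real (Suc j)) powr \<alpha>"
      using assms by (intro powr_mono2) auto
    moreover have "(w j powr p) powr \<alpha> = w j powr t" using assms by (simp add: powr_powr p_def)
    moreover have "(W / real (Suc j)) powr \<alpha> = W powr \<alpha> * real (Suc j) powr (- \<alpha>)"
      using W by (simp add: powr_divide powr_minus_divide)
    ultimately show "w j powr t \<le> W powr \<alpha> * real (Suc j) powr (- \<alpha>)" by simp
  qed (use W in auto)
qed

section \<open>Counting multiindices by tail size\<close>

definition tail_supp :: "nat \<Rightarrow> (nat \<Rightarrow> nat) \<Rightarrow> nat set"
  where "tail_supp J \<nu> = {j. J \<le> j \<and> \<nu> j \<noteq> 0}"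

definition tail_size :: "nat \<Rightarrow> (nat \<Rightarrow> nat) \<Rightarrow> nat"
  where "tail_size J \<nu> = (\<Sum>j\<in>tail_supp J \<nu>. \<nu> j)"

lemma finite_tail_supp: "\<nu> \<in> multiindices \<Longrightarrow> finite (tail_supp J \<nu>)"
  by (rule finite_subset[of _ "supp \<nu>"]) (auto simp: tail_supp_def multiindices_def)

lemma sum_power_div_fact_le_exp:
  assumes "0 \<le> (x::real)"
  shows "(\<Sum>i\<le>m. x ^ i / fact i) \<le> exp x"
proof -
  have "(\<lambda>i. x ^ i / fact i) sums exp x"
    using exp_converges[of x] by (simp add: divide_inverse mult.commute)
  then show ?thesis
    using sum_le_suminf[of "\<lambda>i. x ^ i / fact i" "{..m}"] assms by (auto simp: sums_iff)
qed

text \<open>Multiindices of tail size \<open>k\<close> are counted by the exponential generating function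
  \<open>\<Prod>\<^sub>j exp (x \<gamma>\<^sub>j)\<close> at \<open>x = k / \<Gamma>\<close>, which yields the bound \<open>(e \<Gamma>)\<^sup>k\<close>.\<close>

lemma multinomial_weight_summable:
  fixes h \<gamma> :: "nat \<Rightarrow> real"
  assumes h: "\<And>k. 0 \<le> h k" "summable h"
    and \<gamma>: "\<And>j. 0 \<le> \<gamma> j" "\<And>n. (\<Sum>j\<in>{J..<n}. \<gamma> j) \<le> \<Gamma>"
    and \<Gamma>: "0 < \<Gamma>" "exp 1 * \<Gamma> < 1"
  shows "(\<lambda>\<nu>. (\<Prod>j<J. h (\<nu> j)) * (real (tail_size J \<nu>) ^ tail_size J \<nu> *
    (\<Prod>j\<in>tail_supp J \<nu>. \<gamma> j ^ \<nu> j / fact (\<nu> j)))) summable_on multiindices"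
    (is "?W summable_on _")
proof (rule nonneg_bdd_above_summable_on)
  show "0 \<le> ?W \<nu>" for \<nu>
    using h \<gamma> by (intro mult_nonneg_nonneg prod_nonneg) auto
  define H where "H = suminf h"
  define D where "D = H ^ J * (\<Sum>k. (exp 1 * \<Gamma>) ^ k)"
  have H0: "0 \<le> H" unfolding H_def by (intro suminf_nonneg h)
  show "bdd_above (sum ?W ` {F. F \<subseteq> multiindices \<and> finite F})"
  proof (rule bdd_aboveI[of _ D], clarify)
    fix F assume F: "F \<subseteq> multiindices" "finite F"
    have "finite (\<Union>\<nu>\<in>F. supp \<nu>)" using F by (auto simp: multiindices_def)
    then obtain n0 where n0: "(\<Union>\<nu>\<in>F. supp \<nu>) \<subseteq> {..<n0}"
      unfolding finite_nat_iff_bounded by (elim exE)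
    define n where "n = max n0 J"
    have supp: "\<nu> j = 0" if "\<nu> \<in> F" "j \<ge> n" for \<nu> j
    proof (rule ccontr)
      assume "\<nu> j \<noteq> 0"
      then have "j \<in> {..<n0}" using n0 that(1) by blast
      then show False using that(2) by (simp add: n_def)
    qed
    have nJ: "J \<le> n" by (simp add: n_def)
    define m where "m = Max (insert 0 (\<Union>\<nu>\<in>F. \<nu> ` {..<n}))"
    have m: "\<nu> j \<le> m" if "\<nu> \<in> F" "j < n" for \<nu> j
      unfolding m_def by (rule Max_ge) (use F that in auto)
    have part: "(\<Sum>\<nu>\<in>{\<nu>\<in>F. tail_size J \<nu> = k}. ?W \<nu>) \<le> H ^ J * (exp 1 * \<Gamma>) ^ k" for k
    proof -
      define x where "x = real k / \<Gamma>"
      have x: "0 \<le> x" "real k = \<Gamma> * x" using \<Gamma> by (auto simp: x_def)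
      define c where "c j i = (if j < J then h i else (x * \<gamma> j) ^ i / fact i)" for j i
      have c0: "0 \<le> c j i" for j i using h \<gamma> x by (simp add: c_def)
      \<comment> \<open>The factor \<open>k ^ k\<close> is \<Gamma> x to the power k; as the tail
        entries of \<nu> add up to k, the power of x can be distributed over the
        coordinates.\<close>
      have W: "?W \<nu> = \<Gamma> ^ k * (\<Prod>j<n. c j (\<nu> j))" if \<nu>: "\<nu> \<in> F" "tail_size J \<nu> = k" for \<nu>
      proof -
        have sub: "tail_supp J \<nu> \<subseteq> {J..<n}"
        proof
          fix j assume "j \<in> tail_supp J \<nu>"
          then have "J \<le> j" "\<nu> j \<noteq> 0" by (simp_all add: tail_supp_def)
          then show "j \<in> {J..<n}" using supp[OF \<nu>(1), of j] by (cases "j < n") auto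
        qed
        have "(\<Prod>j<n. c j (\<nu> j)) = (\<Prod>j<J. c j (\<nu> j)) * (\<Prod>j\<in>{J..<n}. c j (\<nu> j))"
          using nJ by (simp add: lessThan_atLeast0 prod.atLeastLessThan_concat)
        also have "(\<Prod>j<J. c j (\<nu> j)) = (\<Prod>j<J. h (\<nu> j))" by (simp add: c_def)
        also have "(\<Prod>j\<in>{J..<n}. c j (\<nu> j)) = (\<Prod>j\<in>tail_supp J \<nu>. c j (\<nu> j))"
          by (rule prod.mono_neutral_right[OF _ sub]) (auto simp: tail_supp_def c_def)
        also have "\<dots> = (\<Prod>j\<in>tail_supp J \<nu>. x ^ \<nu> j * (\<gamma> j ^ \<nu> j / fact (\<nu> j)))"
          by (rule prod.cong) (auto simp: tail_supp_def c_def power_mult_distrib)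
        also have "\<dots> = x ^ k * (\<Prod>j\<in>tail_supp J \<nu>. \<gamma> j ^ \<nu> j / fact (\<nu> j))"
          unfolding prod.distrib \<nu>(2)[symmetric] tail_size_def power_sum ..
        finally show ?thesis unfolding \<nu>(2) by (simp add: x(2) power_mult_distrib mult_ac)
      qed
      have inj: "inj_on (\<lambda>\<nu>. restrict \<nu> {..<n}) {\<nu>\<in>F. tail_size J \<nu> = k}"
      proof (rule inj_onI, rule ext)
        fix \<nu> \<mu> j assume as: "\<nu> \<in> {\<nu>\<in>F. tail_size J \<nu> = k}" "\<mu> \<in> {\<nu>\<in>F. tail_size J \<nu> = k}"
          "restrict \<nu> {..<n} = restrict \<mu> {..<n}"
        show "\<nu> j = \<mu> j"
        proof (cases "j < n")
          case True then show ?thesis using fun_cong[OF as(3), of j] by simp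
        next
          case False then show ?thesis using supp[of \<nu> j] supp[of \<mu> j] as by simp
        qed
      qed
      have "(\<Sum>\<nu>\<in>{\<nu>\<in>F. tail_size J \<nu> = k}. ?W \<nu>) =
          \<Gamma> ^ k * (\<Sum>\<nu>\<in>{\<nu>\<in>F. tail_size J \<nu> = k}. \<Prod>j<n. c j (restrict \<nu> {..<n} j))"
        using W by (simp add: sum_distrib_left)
      also have "\<dots> = \<Gamma> ^ k * (\<Sum>\<nu>\<in>(\<lambda>\<nu>. restrict \<nu> {..<n}) ` {\<nu>\<in>F. tail_size J \<nu> = k}. \<Prod>j<n. c j (\<nu> j))"
        by (subst sum.reindex[OF inj]) simp
      \<comment> \<open>Dropping the constraint on the tail size enlarges the sum to a full box,
        where it factorises into one-dimensional sums.\<close>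
      also have "\<dots> \<le> \<Gamma> ^ k * (\<Sum>\<nu>\<in>PiE {..<n} (\<lambda>_. {..m}). \<Prod>j<n. c j (\<nu> j))"
        using \<Gamma> m by (intro mult_left_mono sum_mono2 finite_PiE prod_nonneg c0)
            (auto simp: image_subset_iff restrict_PiE_iff simp del: PiE_restrict)
      also have "\<dots> = \<Gamma> ^ k * (\<Prod>j<n. \<Sum>i\<le>m. c j i)"
        by (subst prod_sum_PiE) auto
      also have "(\<Prod>j<n. \<Sum>i\<le>m. c j i) = (\<Prod>j<J. \<Sum>i\<le>m. c j i) * (\<Prod>j\<in>{J..<n}. \<Sum>i\<le>m. c j i)"
        using nJ by (simp add: lessThan_atLeast0 prod.atLeastLessThan_concat)
      also have "\<Gamma> ^ k * \<dots> \<le> \<Gamma> ^ k * ((\<Prod>j<J. H) * (\<Prod>j\<in>{J..<n}. exp (x * \<gamma> j)))"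
      proof (intro mult_left_mono mult_mono prod_mono conjI sum_nonneg prod_nonneg c0)
        fix j assume "j \<in> {..<J}"
        then show "(\<Sum>i\<le>m. c j i) \<le> H"
          unfolding H_def using h by (simp add: c_def) (intro sum_le_suminf, auto)
      next
        fix j assume "j \<in> {J..<n}"
        then show "(\<Sum>i\<le>m. c j i) \<le> exp (x * \<gamma> j)"
          using sum_power_div_fact_le_exp[of "x * \<gamma> j" m] x \<gamma> by (simp add: c_def)
      qed (use \<Gamma> H0 in auto)
      also have "(\<Prod>j\<in>{J..<n}. exp (x * \<gamma> j)) = exp (x * (\<Sum>j\<in>{J..<n}. \<gamma> j))"
        by (simp add: exp_sum sum_distrib_left)
      also have "\<Gamma> ^ k * ((\<Prod>j<J. H) * \<dots>) \<le> \<Gamma> ^ k * ((\<Prod>j<J. H) * exp (x * \<Gamma>))"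
        using \<gamma>(2)[of n] x \<Gamma> H0 by (intro mult_left_mono) (auto intro!: mult_left_mono)
      also have "\<dots> = H ^ J * (exp 1 * \<Gamma>) ^ k"
      proof -
        have "exp (x * \<Gamma>) = exp 1 ^ k" using x by (simp add: mult.commute flip: exp_of_nat_mult)
        then show ?thesis by (simp add: power_mult_distrib)
      qed
      finally show ?thesis .
    qed
    define K where "K = Max (insert 0 (tail_size J ` F))"
    have geo: "summable (\<lambda>k. (exp 1 * \<Gamma>) ^ k)" using \<Gamma> by (intro summable_geometric) simp
    have "sum ?W F = (\<Sum>k\<in>{..K}. \<Sum>\<nu>\<in>{\<nu>\<in>F. tail_size J \<nu> = k}. ?W \<nu>)"
      by (rule sum.group[symmetric]) (use F in \<open>auto simp: K_def\<close>)
    also have "\<dots> \<le> (\<Sum>k\<in>{..K}. H ^ J * (exp 1 * \<Gamma>) ^ k)" by (intro sum_mono part)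
    also have "\<dots> = H ^ J * (\<Sum>k\<in>{..K}. (exp 1 * \<Gamma>) ^ k)" by (simp add: sum_distrib_left)
    also have "\<dots> \<le> D"
      unfolding D_def using H0 \<Gamma> by (intro mult_left_mono sum_le_suminf geo) auto
    finally show "sum ?W F \<le> D" .
  qed
qed

text \<open>The quotient \<open>X\<close> is at least 1 since no entry exceeds n; hence for q at
  most 1 its power q is at most \<open>X\<close>, and replacing \<open>\<nu> j ^ \<nu> j\<close> by
  the smaller factorial only increases it. The power q thus stays on the \<open>c j\<close>
  alone.\<close>

lemma prod_power_powr_le_multinomial:
  fixes c :: "nat \<Rightarrow> real"
  assumes T: "finite T" "\<And>j. j \<in> T \<Longrightarrow> \<nu> j > 0" "n = (\<Sum>j\<in>T. \<nu> j)"
    and c: "\<And>j. 0 < c j" and q: "0 < q" "q \<le> 1"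
  shows "(\<Prod>j\<in>T. (real n * c j / real (\<nu> j)) ^ \<nu> j) powr q \<le>
    real n ^ n * (\<Prod>j\<in>T. (c j powr q) ^ \<nu> j / fact (\<nu> j))"
proof -
  define X where "X = real n ^ n / (\<Prod>j\<in>T. real (\<nu> j) ^ \<nu> j)"
  have pp: "(\<Prod>j\<in>T. real (\<nu> j) ^ \<nu> j) > 0" using T by (intro prod_pos) auto
  have nn: "real n ^ n = (\<Prod>j\<in>T. real n ^ \<nu> j)" using T by (simp add: power_sum)
  have "(\<Prod>j\<in>T. real (\<nu> j) ^ \<nu> j) \<le> (\<Prod>j\<in>T. real n ^ \<nu> j)"
    using T by (intro prod_mono conjI power_mono) (auto intro!: member_le_sum)
  then have X1: "X \<ge> 1" using pp by (simp add: X_def nn[symmetric])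
  have "(\<Prod>j\<in>T. (real n * c j / real (\<nu> j)) ^ \<nu> j) = X * (\<Prod>j\<in>T. c j ^ \<nu> j)"
    unfolding X_def nn by (simp add: power_mult_distrib power_divide prod.distrib prod_dividef)
  also have "\<dots> powr q = X powr q * (\<Prod>j\<in>T. (c j powr q) ^ \<nu> j)"
  proof -
    have "(\<Prod>j\<in>T. c j ^ \<nu> j) powr q = (\<Prod>j\<in>T. (c j ^ \<nu> j) powr q)"
      by (rule prod_powr_distrib)
    moreover have "(c j ^ k) powr q = (c j powr q) ^ k" for j k
      using c[of j] by (simp add: powr_powr mult.commute flip: powr_realpow)
    ultimately show ?thesis using X1 c by (simp add: powr_mult prod_nonneg less_imp_le)
  qed
  also have "\<dots> \<le> (real n ^ n / (\<Prod>j\<in>T. fact (\<nu> j))) * (\<Prod>j\<in>T. (c j powr q) ^ \<nu> j)"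
  proof (intro mult_right_mono prod_nonneg)
    have "X powr q \<le> X powr 1" using X1 q by (intro powr_mono) auto
    also have "\<dots> = X" using X1 by simp
    also have "X \<le> real n ^ n / (\<Prod>j\<in>T. fact (\<nu> j))"
      unfolding X_def
    proof (intro divide_left_mono prod_mono conjI mult_pos_pos pp prod_pos)
      fix j
      show "fact (\<nu> j) \<le> real (\<nu> j) ^ \<nu> j" using fact_le_power[of "\<nu> j"] by simp
    qed auto
    finally show "X powr q \<le> real n ^ n / (\<Prod>j\<in>T. fact (\<nu> j))" .
  qed auto
  also have "\<dots> = real n ^ n * (\<Prod>j\<in>T. (c j powr q) ^ \<nu> j / fact (\<nu> j))"
    by (simp add: prod_dividef)
  finally show ?thesis .
qed

text \<open>The majorant \<open>g \<nu>\<close> is the sum of \<open>f\<close> over all multiindices above \<open>\<nu>\<close>.\<close>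

lemma monotone_majorant_summable:
  fixes f :: "(nat \<Rightarrow> nat) \<Rightarrow> real"
  assumes f: "\<And>\<nu>. \<nu> \<in> multiindices \<Longrightarrow> 0 \<le> f \<nu>"
    and sm: "(\<lambda>\<nu>. real (card {..\<nu>}) * f \<nu>) summable_on multiindices"
  obtains g where "\<And>\<nu>. \<nu> \<in> multiindices \<Longrightarrow> f \<nu> \<le> g \<nu>"
    "\<And>\<mu> \<nu>. \<nu> \<in> multiindices \<Longrightarrow> \<mu> \<le> \<nu> \<Longrightarrow> g \<nu> \<le> g \<mu>" "g summable_on multiindices"
proof -
  define up where "up \<nu> = {\<mu>\<in>multiindices. \<nu> \<le> \<mu>}" for \<nu> :: "nat \<Rightarrow> nat"
  define g where "g \<nu> = (\<Sum>\<^sub>\<infinity>\<mu>\<in>up \<nu>. f \<mu>)" for \<nu>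
  \<comment> \<open>In the sum of the majorant each \<open>f \<mu>\<close> is counted once for every
    index below \<mu>, which is where the cardinality weight comes from.\<close>
  have "(\<lambda>(\<mu>, \<nu>). f \<mu>) summable_on Sigma multiindices (\<lambda>\<mu>. {..\<mu>})"
  proof (rule summable_on_SigmaI[where g = "\<lambda>\<mu>. real (card {..\<mu>}) * f \<mu>"])
    show "((\<lambda>\<nu>. case (\<mu>, \<nu>) of (\<mu>, \<nu>) \<Rightarrow> f \<mu>) has_sum real (card {..\<mu>}) * f \<mu>) {..\<mu>}"
      if "\<mu> \<in> multiindices" for \<mu>
      using finite_atMost_multiindex[OF that] by (simp add: has_sum_finiteI)
  qed (use sm f in auto)
  then have sig: "(\<lambda>(\<nu>, \<mu>). f \<mu>) summable_on Sigma multiindices up"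
    by (subst summable_on_reindex_bij_witness[where i = prod.swap and j = prod.swap and
          T = "Sigma multiindices (\<lambda>\<mu>. {..\<mu>})" and h = "\<lambda>(\<mu>, \<nu>). f \<mu>"])
      (auto simp: up_def intro: multiindices_le)
  have inner: "f summable_on up \<nu>" if "\<nu> \<in> multiindices" for \<nu>
    using summable_on_SigmaD1[OF sig that] by simp
  have fs: "f summable_on multiindices"
    using inner[of "\<lambda>_. 0"] by (simp add: up_def multiindices_def le_fun_def)
  have f_up: "f summable_on up \<nu>" for \<nu>
    by (rule summable_on_subset_banach[OF fs]) (auto simp: up_def)
  show ?thesis
  proof (rule that)
    fix \<nu> assume \<nu>: "\<nu> \<in> multiindices"
    have "(\<Sum>\<mu>\<in>{\<nu>}. f \<mu>) \<le> g \<nu>"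
      unfolding g_def using \<nu> f by (intro finite_sum_le_infsum f_up) (auto simp: up_def)
    then show "f \<nu> \<le> g \<nu>" by simp
  next
    fix \<mu> \<nu> assume "\<nu> \<in> multiindices" "\<mu> \<le> \<nu>"
    then show "g \<nu> \<le> g \<mu>"
      unfolding g_def using f by (intro infsum_mono2 f_up) (auto simp: up_def)
  next
    show "g summable_on multiindices"
      using summable_on_SigmaD[OF sig] f_up unfolding g_def by simp
  qed
qed

text \<open>Index \<nu> receives the integer part of its share of the budget N as its number of
  output coefficients, so the shares total at most N. Monotonicity of \<open>g\<close> makes each
  level set downward closed, and exchanging sums turns the total share into the total
  cardinality.\<close>

lemma sparse_levels:
  fixes g :: "(nat \<Rightarrow> nat) \<Rightarrow> real"
  assumes g: "\<And>\<nu>. \<nu> \<in> multiindices \<Longrightarrow> 0 \<le> g \<nu>"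
    and mono: "\<And>\<mu> \<nu>. \<nu> \<in> multiindices \<Longrightarrow> \<mu> \<le> \<nu> \<Longrightarrow> g \<nu> \<le> g \<mu>"
    and sm: "g summable_on multiindices" and D: "D > 0" "(\<Sum>\<^sub>\<infinity>\<nu>\<in>multiindices. g \<nu>) \<le> D" and N: "1 \<le> N"
  obtains \<Lambda> J where "\<forall>j. multiindex_set (\<Lambda> j)" "\<forall>\<nu>\<in>multiindices. \<forall>j. \<nu> \<in> \<Lambda> j \<longleftrightarrow> j < J \<nu>"
    "\<forall>\<nu>\<in>multiindices. real N * g \<nu> / D \<le> real (Suc (J \<nu>))"
    "\<forall>j\<ge>N. \<Lambda> j = {}" "(\<Sum>j<N. card (\<Lambda> j)) \<le> N"
proof -
  define J where "J \<nu> = nat \<lfloor>real N * g \<nu> / D\<rfloor>" for \<nu>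
  define \<Lambda> where "\<Lambda> j = {\<nu>\<in>multiindices. j < J \<nu>}" for j
  have Jle: "real (J \<nu>) \<le> real N * g \<nu> / D" if "\<nu> \<in> multiindices" for \<nu>
    using g[OF that] D by (simp add: J_def)
  have Jge: "real N * g \<nu> / D \<le> real (Suc (J \<nu>))" for \<nu>
    unfolding J_def by linarith
  have sumle: "(\<Sum>\<nu>\<in>X. J \<nu>) \<le> N" if X: "finite X" "X \<subseteq> multiindices" for X
  proof -
    have "real (\<Sum>\<nu>\<in>X. J \<nu>) \<le> (\<Sum>\<nu>\<in>X. real N * g \<nu> / D)"
      using X Jle by (simp add: sum_mono subset_iff)
    also have "\<dots> = real N / D * (\<Sum>\<nu>\<in>X. g \<nu>)" by (simp add: sum_distrib_left)
    also have "(\<Sum>\<nu>\<in>X. g \<nu>) \<le> (\<Sum>\<^sub>\<infinity>\<nu>\<in>multiindices. g \<nu>)"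
      using X g by (intro finite_sum_le_infsum sm) auto
    then have "real N / D * (\<Sum>\<nu>\<in>X. g \<nu>) \<le> real N / D * D"
      using D by (intro mult_left_mono) auto
    finally have "real (\<Sum>\<nu>\<in>X. J \<nu>) \<le> real N" using D by simp
    then show ?thesis by (simp only: of_nat_le_iff)
  qed
  \<comment> \<open>Every member of the lowest level has a share of at least 1, so a finite subset
    has at most N elements.\<close>
  have fin0: "finite (\<Lambda> 0)"
  proof (rule conjunct1[OF finite_if_finite_subsets_card_bdd[where C = N]])
    fix X assume X: "X \<subseteq> \<Lambda> 0" "finite X"
    have "card X = (\<Sum>\<nu>\<in>X. 1)" by simp
    also have "\<dots> \<le> (\<Sum>\<nu>\<in>X. J \<nu>)" using X by (intro sum_mono) (auto simp: \<Lambda>_def)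
    also have "\<dots> \<le> N" using X by (intro sumle) (auto simp: \<Lambda>_def)
    finally show "card X \<le> N" .
  qed
  have sub: "\<Lambda> j \<subseteq> \<Lambda> 0" for j by (auto simp: \<Lambda>_def)
  have fin: "finite (\<Lambda> j)" for j using finite_subset[OF sub fin0] .
  have JN: "J \<nu> \<le> N" if "\<nu> \<in> multiindices" for \<nu> using sumle[of "{\<nu>}"] that by simp
  have "(\<Sum>j<N. card (\<Lambda> j)) = (\<Sum>j<N. \<Sum>\<nu>\<in>\<Lambda> 0. if j < J \<nu> then 1 else 0)"
  proof (rule sum.cong[OF refl])
    fix j
    have "\<Lambda> j = \<Lambda> 0 \<inter> {\<nu>. j < J \<nu>}" by (auto simp: \<Lambda>_def)
    then show "card (\<Lambda> j) = (\<Sum>\<nu>\<in>\<Lambda> 0. if j < J \<nu> then 1 else 0)"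
      using fin0 by (simp add: sum.If_cases)
  qed
  also have "\<dots> = (\<Sum>\<nu>\<in>\<Lambda> 0. \<Sum>j<N. if j < J \<nu> then 1 else 0)" by (rule sum.swap)
  also have "\<dots> = (\<Sum>\<nu>\<in>\<Lambda> 0. J \<nu>)"
  proof (rule sum.cong[OF refl])
    fix \<nu> assume "\<nu> \<in> \<Lambda> 0"
    then have "{j. j < N \<and> j < J \<nu>} = {..<J \<nu>}" using JN by (force simp: \<Lambda>_def)
    then show "(\<Sum>j<N. if j < J \<nu> then 1 else 0) = J \<nu>"
      by (simp add: sum.If_cases Int_def)
  qed
  also have "\<dots> \<le> N" using fin0 by (intro sumle) (auto simp: \<Lambda>_def)
  finally have cards: "(\<Sum>j<N. card (\<Lambda> j)) \<le> N" .
  have down: "\<mu> \<in> \<Lambda> j" if "\<nu> \<in> \<Lambda> j" "\<mu> \<le> \<nu>" for \<mu> \<nu> j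
  proof -
    have "\<nu> \<in> multiindices" using that by (simp add: \<Lambda>_def)
    then have "\<mu> \<in> multiindices" "g \<nu> \<le> g \<mu>" using that multiindices_le mono by blast+
    moreover have "J \<nu> \<le> J \<mu>" unfolding J_def using calculation D
      by (intro nat_mono floor_mono divide_right_mono mult_left_mono) auto
    ultimately show ?thesis using that by (simp add: \<Lambda>_def)
  qed
  have "finite (supp \<nu>)" if "\<nu> \<in> \<Lambda> j" for \<nu> j
    using that by (simp add: \<Lambda>_def multiindices_def)
  then have "multiindex_set (\<Lambda> j)" for j
    unfolding multiindex_set_def by (intro conjI ballI allI impI fin) (auto intro: down)
  moreover have "\<Lambda> j = {}" if "N \<le> j" for j using JN that by (force simp: \<Lambda>_def)
  moreover have "\<nu> \<in> \<Lambda> j \<longleftrightarrow> j < J \<nu>" if "\<nu> \<in> multiindices" for j \<nu>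
    using that by (simp add: \<Lambda>_def)
  ultimately show ?thesis
    using that[of \<Lambda> J] Jge cards by blast
qed

context holomorphic_parametrization
begin

text \<open>Dual form of the statement that the sequence \<open>\<Delta>\<^sub>\<nu> c\<close> has
  t-weighted norm at most \<open>M * a \<nu>\<close>; the form with \<beta> is both what the Cauchy
  estimates give and what the error estimate consumes.\<close>

definition surplus_bound :: "((nat \<Rightarrow> nat) \<Rightarrow> real) \<Rightarrow> bool"
  where "surplus_bound a \<longleftrightarrow> (\<forall>\<nu>\<in>multiindices. 0 \<le> a \<nu> \<and> (\<forall>y\<in>unit_cube. \<forall>\<beta> K.
    \<bar>\<Sum>j<K. \<beta> j * hier_surplus node \<nu> (out_coeff j) y\<bar> \<le> M * sqrt (\<Sum>j<K. (\<beta> j * w j powr t)\<^sup>2) * a \<nu>))"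

text \<open>
  The polyrectangle is chosen depending on \<open>\<nu>\<close>: a fixed small \<open>\<kappa>\<close> for the first \<open>J\<close> coordinates, and
  beyond them \<open>\<kappa>\<^sub>j = 1 + \<epsilon>' \<nu>\<^sub>j / (n b\<^sub>j)\<close> with \<open>n\<close> the tail size of \<open>\<nu>\<close> and \<open>b\<^sub>j = w\<^sub>j powr s\<close>.
  A choice independent of \<open>\<nu>\<close> would lose a full order of the rate.
\<close>

lemma surplus_majorant:
  assumes q: "0 < q" "q \<le> 1" and smq: "summable (\<lambda>j. w j powr (s * q))"
  obtains a where "surplus_bound a"
    "(\<lambda>\<nu>. real (card {..\<nu>}) * a \<nu> powr q) summable_on multiindices"
proof -
  obtain \<epsilon> where \<epsilon>: "\<epsilon> > 0" "tube \<epsilon>"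
    using ball_radius by metis
  have rng: "range node \<subseteq> {-1..1}" using node_in by blast
  define b where "b j = w j powr s" for j
  have b: "b j > 0" for j using w_pos[of j] by (simp add: b_def)
  have sb: "summable b" using w_summable by (simp add: b_def[abs_def])
  define K where "K = 2 * r * B"
  have K: "K \<ge> 0" using r_pos B_nonneg by (simp add: K_def)
  \<comment> \<open>The sum of \<open>b j * \<kappa> j\<close> is later split into three parts of at
    most \<epsilon>' each: the head, the constant 1 in the tail radii, and their proportional part.
    The divisor 4 makes the total strictly smaller than \<epsilon>.\<close>
  define \<epsilon>' where "\<epsilon>' = \<epsilon> / (4 * (K + 1))"
  have \<epsilon>': "\<epsilon>' > 0" using \<epsilon> K by (simp add: \<epsilon>'_def)
  have sb0: "0 \<le> suminf b" using sb b by (intro suminf_nonneg) (auto simp: less_imp_le)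
  define k0 where "k0 = \<epsilon>' / (suminf b + 1)"
  have k0: "k0 > 0" using \<epsilon>' sb0 by (simp add: k0_def)
  obtain C \<theta> where C: "C \<ge> 1" "0 < \<theta>" "\<theta> < 1"
    "\<And>f M k y. f holomorphic_on rectangle k0 \<Longrightarrow> (\<And>z. z \<in> rectangle k0 \<Longrightarrow> norm (f z) \<le> M) \<Longrightarrow>
      y \<in> {-1..1} \<Longrightarrow> norm (newton_term node k (\<lambda>x. f (of_real x)) y) \<le> M * (C * \<theta> ^ k)"
    using norm_newton_term_node_le[OF k0] by metis
  \<comment> \<open>Chosen so that 6 divided by the proportional part of the tail radius is
    \<open>n \<nu> * c j / \<nu> j\<close>.\<close>
  define c where "c j = 6 * b j / \<epsilon>'" for j
  have c: "0 < c j" for j using b \<epsilon>' by (simp add: c_def)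
  \<comment> \<open>The factor 2 pays for the cardinality weight in the tail, since 1 + k is at most
    \<open>2 ^ k\<close>.\<close>
  define \<gamma> where "\<gamma> j = 2 * c j powr q" for j
  have \<gamma>0: "0 \<le> \<gamma> j" for j by (simp add: \<gamma>_def)
  have "c j powr q = (6 / \<epsilon>') powr q * w j powr (s * q)" for j
    using \<epsilon>' w_pos[of j] by (simp add: c_def b_def powr_mult powr_divide powr_powr)
  then have s\<gamma>: "summable \<gamma>" unfolding \<gamma>_def[abs_def] by (simp add: smq summable_mult)
  define \<Gamma> :: real where "\<Gamma> = 1 / (2 * exp 1)"
  have \<Gamma>: "0 < \<Gamma>" "exp 1 * \<Gamma> < 1" by (auto simp: \<Gamma>_def)
  obtain J1 where J1: "\<And>m n. m \<ge> J1 \<Longrightarrow> norm (\<Sum>j\<in>{m..<n}. b j) < \<epsilon>'"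
    using sb \<epsilon>' unfolding summable_Cauchy by blast
  obtain J2 where J2: "\<And>m n. m \<ge> J2 \<Longrightarrow> norm (\<Sum>j\<in>{m..<n}. \<gamma> j) < \<Gamma>"
    using s\<gamma> \<Gamma> unfolding summable_Cauchy by blast
  \<comment> \<open>A small tail of \<open>b\<close> pays for the constant 1 in the tail radii; a
    small tail of \<gamma> gives the ratio 1 / 2 in the count of multiindices.\<close>
  define J where "J = max J1 J2"
  have bJ: "(\<Sum>j\<in>{J..<n}. b j) \<le> \<epsilon>'" for n using J1[of J n] by (simp add: J_def)
  have \<gamma>J: "(\<Sum>j\<in>{J..<n}. \<gamma> j) \<le> \<Gamma>" for n using J2[of J n] by (simp add: J_def)
  define T where "T = tail_supp J"
  define n where "n = tail_size J"
  \<comment> \<open>Only head coordinates contribute a leading constant, and there are at most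
    \<open>J\<close> of them.\<close>
  define a where "a \<nu> = C ^ J * (\<Prod>j<J. \<theta> ^ \<nu> j) * (\<Prod>j\<in>T \<nu>. (real (n \<nu>) * c j / real (\<nu> j)) ^ \<nu> j)" for \<nu>
  have Tpos: "\<nu> j > 0" if "j \<in> T \<nu>" for j \<nu> using that by (simp add: T_def tail_supp_def)
  have a0: "0 \<le> a \<nu>" for \<nu>
    unfolding a_def using C c by (intro mult_nonneg_nonneg prod_nonneg) (auto simp: less_imp_le)
  have bound: "\<bar>\<Sum>j<K'. \<beta> j * hier_surplus node \<nu> (out_coeff j) y\<bar> \<le>
      M * sqrt (\<Sum>j<K'. (\<beta> j * w j powr t)\<^sup>2) * a \<nu>"
    if \<nu>: "\<nu> \<in> multiindices" and y: "y \<in> unit_cube" for \<nu> y \<beta> K'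
  proof -
    define S where "S = supp \<nu>"
    have fin: "finite S" "finite (T \<nu>)" using \<nu> finite_tail_supp by (auto simp: S_def T_def multiindices_def)
    have S: "S = (S \<inter> {..<J}) \<union> T \<nu>" "(S \<inter> {..<J}) \<inter> T \<nu> = {}"
      by (auto simp: S_def T_def tail_supp_def)
    \<comment> \<open>The summand 1 makes the crude bound applicable. The other part distributes
      \<epsilon>' over the tail in proportion to the entries of \<nu>: weighted by
      \<open>b j\<close>, it sums to \<epsilon>' for a nonempty tail.\<close>
    define \<kappa> where "\<kappa> j = (if j < J then k0 else 1 + \<epsilon>' * real (\<nu> j) / (real (n \<nu>) * b j))" for j
    have \<kappa>pos: "\<kappa> j > 0" for j
      using k0 \<epsilon>' b[of j] by (auto simp: \<kappa>_def intro!: add_pos_nonneg divide_nonneg_nonneg mult_nonneg_nonneg)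
    have T\<kappa>: "\<kappa> j = 1 + \<epsilon>' * real (\<nu> j) / (real (n \<nu>) * b j)" "n \<nu> > 0" if "j \<in> T \<nu>" for j
    proof -
      show "\<kappa> j = 1 + \<epsilon>' * real (\<nu> j) / (real (n \<nu>) * b j)"
        using that by (auto simp: \<kappa>_def T_def tail_supp_def)
      have "\<nu> j \<le> n \<nu>" unfolding n_def tail_size_def T_def[symmetric]
        using that fin by (intro member_le_sum) auto
      then show "n \<nu> > 0" using Tpos[OF that] by simp
    qed
    have "(\<Sum>j\<in>S. b j * \<kappa> j) = (\<Sum>j\<in>S \<inter> {..<J}. b j * \<kappa> j) + (\<Sum>j\<in>T \<nu>. b j * \<kappa> j)"
      using S fin by (metis finite_Int sum.union_disjoint)
    also have "(\<Sum>j\<in>S \<inter> {..<J}. b j * \<kappa> j) \<le> \<epsilon>'"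
    proof -
      have "(\<Sum>j\<in>S \<inter> {..<J}. b j * \<kappa> j) = (\<Sum>j\<in>S \<inter> {..<J}. b j) * k0"
        by (simp add: \<kappa>_def sum_distrib_right)
      also have "\<dots> \<le> suminf b * k0"
        using sb b k0 fin by (intro mult_right_mono sum_le_suminf) (auto simp: less_imp_le)
      also have "\<dots> \<le> \<epsilon>'" using sb0 \<epsilon>' by (simp add: k0_def field_simps)
      finally show ?thesis .
    qed
    also have "(\<Sum>j\<in>T \<nu>. b j * \<kappa> j) \<le> \<epsilon>' + \<epsilon>'"
    proof -
      have "(\<Sum>j\<in>T \<nu>. b j * \<kappa> j) = (\<Sum>j\<in>T \<nu>. b j + \<epsilon>' / real (n \<nu>) * real (\<nu> j))"
        using T\<kappa>(1) b by (intro sum.cong refl) (simp add: field_simps less_imp_neq[OF b, symmetric])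
      also have "\<dots> = (\<Sum>j\<in>T \<nu>. b j) + \<epsilon>' / real (n \<nu>) * real (n \<nu>)"
        by (simp add: sum.distrib sum_distrib_left n_def tail_size_def T_def)
      also have "\<dots> \<le> \<epsilon>' + \<epsilon>'"
      proof (rule add_mono)
        obtain m where m: "T \<nu> \<subseteq> {..<m}" using fin(2) unfolding finite_nat_iff_bounded by (elim exE)
        have "(\<Sum>j\<in>T \<nu>. b j) \<le> (\<Sum>j\<in>{J..<m}. b j)"
          using m b by (intro sum_mono2) (auto simp: T_def tail_supp_def less_imp_le)
        then show "(\<Sum>j\<in>T \<nu>. b j) \<le> \<epsilon>'" using bJ[of m] by simp
        show "\<epsilon>' / real (n \<nu>) * real (n \<nu>) \<le> \<epsilon>'" using \<epsilon>' by simp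
      qed
      finally show ?thesis .
    qed
    finally have "(\<Sum>j\<in>S. b j * \<kappa> j) \<le> 3 * \<epsilon>'" by simp
    then have "K * (\<Sum>j\<in>S. b j * \<kappa> j) \<le> K * (3 * \<epsilon>')" using K by (rule mult_left_mono)
    also have "\<dots> < \<epsilon>" using \<epsilon>(1) K mult_nonneg_nonneg[OF K less_imp_le[OF \<epsilon>(1)]]
      by (simp add: \<epsilon>'_def field_simps add_nonneg_pos)
    finally have small: "2 * r * B * (\<Sum>j\<in>S. w j powr s * \<kappa> j) < \<epsilon>" by (simp add: K_def b_def)
    define g where "g j = (if j < J then C * \<theta> ^ \<nu> j else (real (n \<nu>) * c j / real (\<nu> j)) ^ \<nu> j)" for j
    have yin: "y j \<in> {-1..1}" for j using y by (simp add: unit_cube_def)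
    have gb: "norm (newton_term node (\<nu> j) (\<lambda>x. f (of_real x)) (y j)) \<le> M' * g j"
      if j: "j \<in> S" and f: "f holomorphic_on rectangle (\<kappa> j)"
        "\<And>z. z \<in> rectangle (\<kappa> j) \<Longrightarrow> norm (f z) \<le> M'" for j f M'
    proof (cases "j < J")
      case True
      then show ?thesis using C(4)[OF _ _ yin, of f M' "\<nu> j" j] f by (simp add: \<kappa>_def g_def)
    next
      case False
      then have jT: "j \<in> T \<nu>" using j by (auto simp: S_def T_def tail_supp_def)
      note k = T\<kappa>[OF jT]
      have \<kappa>1: "\<kappa> j \<ge> 1" using k \<epsilon>' b[of j] by simp
      have M'0: "0 \<le> M'"
        using order_trans[OF norm_ge_zero f(2)[of 0]] \<kappa>1 by (simp add: in_rectangle_iff)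
      have "norm (newton_term node (\<nu> j) (\<lambda>x. f (of_real x)) (y j)) \<le> M' * (6 / \<kappa> j) ^ \<nu> j"
        using Tpos[OF jT] by (intro norm_newton_term_le_crude f \<kappa>1 inj_node rng yin) auto
      also have "\<dots> \<le> M' * (real (n \<nu>) * c j / real (\<nu> j)) ^ \<nu> j"
      proof (intro mult_left_mono power_mono M'0)
        have "\<epsilon>' * real (\<nu> j) / (real (n \<nu>) * b j) > 0" "\<epsilon>' * real (\<nu> j) / (real (n \<nu>) * b j) \<le> \<kappa> j"
          using Tpos[OF jT] k \<epsilon>' b[of j] by auto
        then have "6 / \<kappa> j \<le> 6 / (\<epsilon>' * real (\<nu> j) / (real (n \<nu>) * b j))"
          by (intro frac_le) auto
        also have "\<dots> = real (n \<nu>) * c j / real (\<nu> j)" by (simp add: c_def)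
        finally show "6 / \<kappa> j \<le> real (n \<nu>) * c j / real (\<nu> j)" .
        show "0 \<le> 6 / \<kappa> j" using \<kappa>1 by simp
      qed
      finally show ?thesis using False by (simp add: g_def)
    qed
    note M0 = M_nonneg
    have "\<bar>\<Sum>j<K'. \<beta> j * hier_surplus node \<nu> (out_coeff j) y\<bar> \<le>
        M * sqrt (\<Sum>j<K'. (\<beta> j * w j powr t)\<^sup>2) * (\<Prod>j\<in>S. g j)"
      by (rule abs_sum_hier_surplus_le[OF \<epsilon>(2) rng \<nu> S_def \<kappa>pos small gb])
    also have "(\<Prod>j\<in>S. g j) = (\<Prod>j\<in>S \<inter> {..<J}. g j) * (\<Prod>j\<in>T \<nu>. g j)"
      using S fin by (metis finite_Int prod.union_disjoint)
    also have "(\<Prod>j\<in>T \<nu>. g j) = (\<Prod>j\<in>T \<nu>. (real (n \<nu>) * c j / real (\<nu> j)) ^ \<nu> j)"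
      by (rule prod.cong) (auto simp: g_def T_def tail_supp_def)
    also have "(\<Prod>j\<in>S \<inter> {..<J}. g j) * \<dots> \<le> a \<nu>"
      unfolding a_def
    proof (rule mult_right_mono)
      have "(\<Prod>j\<in>S \<inter> {..<J}. g j) = (\<Prod>j\<in>S \<inter> {..<J}. C * \<theta> ^ \<nu> j)"
        by (rule prod.cong) (auto simp: g_def)
      also have "\<dots> = (\<Prod>j\<in>S \<inter> {..<J}. C) * (\<Prod>j\<in>S \<inter> {..<J}. \<theta> ^ \<nu> j)" by (rule prod.distrib)
      also have "(\<Prod>j\<in>S \<inter> {..<J}. \<theta> ^ \<nu> j) = (\<Prod>j<J. \<theta> ^ \<nu> j)"
      proof (rule prod.mono_neutral_left)
        show "\<forall>j\<in>{..<J} - S \<inter> {..<J}. \<theta> ^ \<nu> j = 1"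
        proof
          fix j assume "j \<in> {..<J} - S \<inter> {..<J}"
          then have "\<nu> j = 0" by (auto simp: S_def)
          then show "\<theta> ^ \<nu> j = 1" by simp
        qed
      qed auto
      also have "(\<Prod>j\<in>S \<inter> {..<J}. C) \<le> C ^ J"
        using C card_mono[of "{..<J}" "S \<inter> {..<J}"] by (simp add: power_increasing)
      finally show "(\<Prod>j\<in>S \<inter> {..<J}. g j) \<le> C ^ J * (\<Prod>j<J. \<theta> ^ \<nu> j)"
        using C by (simp add: mult_right_mono prod_nonneg)
      show "0 \<le> (\<Prod>j\<in>T \<nu>. (real (n \<nu>) * c j / real (\<nu> j)) ^ \<nu> j)"
        using c by (intro prod_nonneg) (auto simp: less_imp_le)
    qed
    finally show ?thesis using M0 by (simp add: mult_left_mono sum_nonneg)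
  qed
  \<comment> \<open>In the head coordinates the geometric decay absorbs the cardinality factor k +
    1.\<close>
  define h where "h k = real (Suc k) * (\<theta> powr q) ^ k" for k
  have \<theta>q: "0 < \<theta> powr q" "\<theta> powr q < 1" using C powr_less_mono2[of q \<theta> 1] q by auto
  have sh: "summable h"
  proof -
    have "summable (\<lambda>k. diffs (\<lambda>_. 1) k * (\<theta> powr q) ^ k)"
      by (rule termdiff_converges[where K = 1]) (use \<theta>q in \<open>auto intro!: summable_geometric\<close>)
    then show ?thesis by (simp add: diffs_def h_def[abs_def])
  qed
  have W: "(\<lambda>\<nu>. (\<Prod>j<J. h (\<nu> j)) * (real (tail_size J \<nu>) ^ tail_size J \<nu> *
      (\<Prod>j\<in>tail_supp J \<nu>. \<gamma> j ^ \<nu> j / fact (\<nu> j)))) summable_on multiindices"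
    by (rule multinomial_weight_summable[OF _ sh \<gamma>0 \<gamma>J \<Gamma>]) (simp add: h_def)
  have "(\<lambda>\<nu>. real (card {..\<nu>}) * a \<nu> powr q) summable_on multiindices"
  proof (rule summable_on_comparison_test[OF summable_on_cmult_right[OF W, of "(C ^ J) powr q"]])
    fix \<nu> assume \<nu>: "\<nu> \<in> multiindices"
    have fin: "finite (T \<nu>)" using \<nu> finite_tail_supp by (auto simp: T_def)
    have disj: "{..<J} \<inter> T \<nu> = {}" by (auto simp: T_def tail_supp_def)
    have "card {..\<nu>} = (\<Prod>j\<in>{..<J} \<union> T \<nu>. Suc (\<nu> j))"
      by (rule card_atMost_multiindex) (use fin in \<open>auto simp: T_def tail_supp_def\<close>)
    also have "\<dots> = (\<Prod>j<J. Suc (\<nu> j)) * (\<Prod>j\<in>T \<nu>. Suc (\<nu> j))"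
      using fin disj by (intro prod.union_disjoint) auto
    also have "\<dots> \<le> (\<Prod>j<J. Suc (\<nu> j)) * (\<Prod>j\<in>T \<nu>. 2 ^ \<nu> j)"
      by (intro mult_left_mono prod_mono) (auto simp: Suc_le_eq)
    finally have "real (card {..\<nu>}) \<le> real ((\<Prod>j<J. Suc (\<nu> j)) * (\<Prod>j\<in>T \<nu>. 2 ^ \<nu> j))"
      by (rule of_nat_mono)
    then have card: "real (card {..\<nu>}) \<le> (\<Prod>j<J. real (Suc (\<nu> j))) * (\<Prod>j\<in>T \<nu>. 2 ^ \<nu> j)"
      by simp
    have "a \<nu> powr q = (C ^ J) powr q * (\<Prod>j<J. \<theta> ^ \<nu> j) powr q *
        (\<Prod>j\<in>T \<nu>. (real (n \<nu>) * c j / real (\<nu> j)) ^ \<nu> j) powr q"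
      unfolding a_def using C c by (simp add: powr_mult prod_nonneg less_imp_le)
    also have "(\<Prod>j<J. \<theta> ^ \<nu> j) powr q = (\<Prod>j<J. (\<theta> powr q) ^ \<nu> j)"
    proof -
      have "(\<theta> ^ k) powr q = (\<theta> powr q) ^ k" for k
        using C by (simp add: powr_powr mult.commute flip: powr_realpow)
      then show ?thesis by (simp add: prod_powr_distrib)
    qed
    also have "(\<Prod>j\<in>T \<nu>. (real (n \<nu>) * c j / real (\<nu> j)) ^ \<nu> j) powr q \<le>
        real (n \<nu>) ^ n \<nu> * (\<Prod>j\<in>T \<nu>. (c j powr q) ^ \<nu> j / fact (\<nu> j))"
      by (rule prod_power_powr_le_multinomial[OF fin Tpos _ c q]) (auto simp: n_def tail_size_def T_def)
    finally have aq: "a \<nu> powr q \<le> (C ^ J) powr q * (\<Prod>j<J. (\<theta> powr q) ^ \<nu> j) *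
        (real (n \<nu>) ^ n \<nu> * (\<Prod>j\<in>T \<nu>. (c j powr q) ^ \<nu> j / fact (\<nu> j)))"
      by (simp add: mult_left_mono prod_nonneg)
    have "real (card {..\<nu>}) * a \<nu> powr q \<le> ((\<Prod>j<J. real (Suc (\<nu> j))) * (\<Prod>j\<in>T \<nu>. 2 ^ \<nu> j)) *
      ((C ^ J) powr q * (\<Prod>j<J. (\<theta> powr q) ^ \<nu> j) *
        (real (n \<nu>) ^ n \<nu> * (\<Prod>j\<in>T \<nu>. (c j powr q) ^ \<nu> j / fact (\<nu> j))))"
      by (intro mult_mono card aq mult_nonneg_nonneg prod_nonneg) auto
    also have "\<dots> = (C ^ J) powr q * (((\<Prod>j<J. real (Suc (\<nu> j))) * (\<Prod>j<J. (\<theta> powr q) ^ \<nu> j)) *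
        (real (n \<nu>) ^ n \<nu> * ((\<Prod>j\<in>T \<nu>. 2 ^ \<nu> j) * (\<Prod>j\<in>T \<nu>. (c j powr q) ^ \<nu> j / fact (\<nu> j)))))"
      by (simp only: mult_ac)
    also have "\<dots> = (C ^ J) powr q * ((\<Prod>j<J. h (\<nu> j)) *
        (real (n \<nu>) ^ n \<nu> * (\<Prod>j\<in>T \<nu>. \<gamma> j ^ \<nu> j / fact (\<nu> j))))"
      by (simp only: h_def \<gamma>_def prod.distrib[symmetric] power_mult_distrib times_divide_eq_right)
    finally show "real (card {..\<nu>}) * a \<nu> powr q \<le> (C ^ J) powr q * ((\<Prod>j<J. h (\<nu> j)) *
        (real (tail_size J \<nu>) ^ tail_size J \<nu> * (\<Prod>j\<in>tail_supp J \<nu>. \<gamma> j ^ \<nu> j / fact (\<nu> j))))"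
      by (simp add: n_def T_def)
  qed simp
  then show ?thesis using that[of a] a0 bound by (simp add: surplus_bound_def)
qed

end

section \<open>Interpolation spaces\<close>

lemma sum_fun_apply: "(\<Sum>a\<in>A. f a) x = (\<Sum>a\<in>A. f a x)"
  by (induction A rule: infinite_finite_induct) auto

text \<open>Allows a sum over arbitrary labels in which exponents may repeat; equal monomials are
  merged.\<close>

lemma polynomial_funI:
  assumes "finite K" "\<And>x. f x = (\<Sum>k\<in>K. c k * (\<Prod>i<n. x i ^ e k i))"
  shows "polynomial_fun n f"
  unfolding polynomial_fun_def
proof (intro exI conjI allI)
  show "finite (e ` K)" using assms(1) by simp
  fix x
  have "f x = (\<Sum>\<nu>\<in>e ` K. \<Sum>k\<in>{k\<in>K. e k = \<nu>}. c k * (\<Prod>i<n. x i ^ e k i))"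
    unfolding assms(2) by (rule sum.image_gen[OF assms(1)])
  also have "\<dots> = (\<Sum>\<nu>\<in>e ` K. (\<Sum>k\<in>{k\<in>K. e k = \<nu>}. c k) * (\<Prod>i<n. x i ^ \<nu> i))"
    by (simp add: sum_distrib_right)
  finally show "f x = (\<Sum>\<nu>\<in>e ` K. (\<Sum>k\<in>{k\<in>K. e k = \<nu>}. c k) * (\<Prod>i<n. x i ^ \<nu> i))" .
qed

lemma polynomial_fun_const: "polynomial_fun n (\<lambda>_. c)"
  by (rule polynomial_funI[where K = "{0::nat}" and c = "\<lambda>_. c" and e = "\<lambda>_ _. 0"]) auto

lemma polynomial_fun_coord: "l < n \<Longrightarrow> polynomial_fun n (\<lambda>x. x l)"
  by (rule polynomial_funI[where K = "{0::nat}" and c = "\<lambda>_. 1" and e = "\<lambda>_ i. if i = l then 1 else 0"])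
    (auto simp: if_distrib[of "\<lambda>k. _ ^ k"] prod.delta cong: if_cong)

lemma polynomial_fun_add:
  assumes "polynomial_fun n f" "polynomial_fun n g"
  shows "polynomial_fun n (\<lambda>x. f x + g x)"
proof -
  obtain A c where A: "finite A" "\<And>x. f x = (\<Sum>\<nu>\<in>A. c \<nu> * (\<Prod>i<n. x i ^ \<nu> i))"
    using assms(1) unfolding polynomial_fun_def by blast
  obtain A' c' where A': "finite A'" "\<And>x. g x = (\<Sum>\<nu>\<in>A'. c' \<nu> * (\<Prod>i<n. x i ^ \<nu> i))"
    using assms(2) unfolding polynomial_fun_def by blast
  show ?thesis
    by (rule polynomial_funI[where K = "A <+> A'" and c = "case_sum c c'" and e = "case_sum id id"])
      (use A A' in \<open>simp_all add: sum.Plus\<close>)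
qed

lemma polynomial_fun_mult:
  assumes "polynomial_fun n f" "polynomial_fun n g"
  shows "polynomial_fun n (\<lambda>x. f x * g x)"
proof -
  obtain A c where A: "finite A" "\<And>x. f x = (\<Sum>\<nu>\<in>A. c \<nu> * (\<Prod>i<n. x i ^ \<nu> i))"
    using assms(1) unfolding polynomial_fun_def by blast
  obtain A' c' where A': "finite A'" "\<And>x. g x = (\<Sum>\<nu>\<in>A'. c' \<nu> * (\<Prod>i<n. x i ^ \<nu> i))"
    using assms(2) unfolding polynomial_fun_def by blast
  show ?thesis
    by (rule polynomial_funI[where K = "A \<times> A'" and c = "\<lambda>(\<nu>, \<mu>). c \<nu> * c' \<mu>" and e = "\<lambda>(\<nu>, \<mu>) i. \<nu> i + \<mu> i"])
      (use A A' in \<open>simp_all add: sum_product sum.cartesian_product, intro sum.cong,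
        auto simp: power_add prod.distrib\<close>)
qed

lemma polynomial_fun_prod:
  "(\<And>k. k \<in> K \<Longrightarrow> polynomial_fun n (f k)) \<Longrightarrow> polynomial_fun n (\<lambda>x. \<Prod>k\<in>K. f k x)"
  by (induction K rule: infinite_finite_induct) (auto intro: polynomial_fun_const polynomial_fun_mult)

lemma subspace_polynomial_map: "subspace {p. polynomial_map n m p}"
proof (rule subspaceI)
  show "0 \<in> {p. polynomial_map n m p}"
    by (simp add: polynomial_map_def polynomial_fun_const)
  show "p + q \<in> {p. polynomial_map n m p}"
    if "p \<in> {p. polynomial_map n m p}" "q \<in> {p. polynomial_map n m p}" for p q
    using that by (simp add: polynomial_map_def polynomial_fun_add)
  show "c *\<^sub>R p \<in> {p. polynomial_map n m p}" if "p \<in> {p. polynomial_map n m p}" for c p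
    using that by (simp add: polynomial_map_def scaleR_fun_def polynomial_fun_mult polynomial_fun_const)
qed

text \<open>An infinite independent set cannot lie in the span of a finite set, so a vector can
  always be added. This brings the interpolation space to dimension exactly N.\<close>

lemma independent_extend_card:
  assumes "finite B" "independent B" "infinite I" "independent I" "card B \<le> N"
  obtains B' where "B \<subseteq> B'" "B' \<subseteq> B \<union> I" "finite B'" "independent B'" "card B' = N"
proof -
  have "\<exists>B'. B \<subseteq> B' \<and> B' \<subseteq> B \<union> I \<and> finite B' \<and> independent B' \<and> card B' = card B + k" for k
  proof (induction k)
    case 0
    then show ?case using assms by auto
  next
    case (Suc k)
    then obtain B' where B': "B \<subseteq> B'" "B' \<subseteq> B \<union> I" "finite B'" "independent B'" "card B' = card B + k"
      by (elim exE conjE)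
    have "\<not> I \<subseteq> span B'"
      using independent_span_bound[OF B'(3) assms(4)] assms(3) by auto
    then obtain v where v: "v \<in> I" "v \<notin> span B'" by auto
    then have "v \<notin> B'" using span_base by blast
    then show ?case
      using B' v independent_insertI[OF v(2) B'(4)]
      by (intro exI[of _ "insert v B'"]) auto
  qed
  from this[of "N - card B"] obtain B' where
    "B \<subseteq> B'" "B' \<subseteq> B \<union> I" "finite B'" "independent B'" "card B' = card B + (N - card B)"
    by (elim exE conjE)
  then show ?thesis using that assms(5) by simp
qed

text \<open>Filler for raising the dimension: monomials of the first variable in the first output
  component, polynomial for any positive numbers of inputs and outputs.\<close>

definition pure_power :: "nat \<Rightarrow> (nat \<Rightarrow> real) \<Rightarrow> nat \<Rightarrow> real"
  where "pure_power k = (\<lambda>x j. if j = 0 then x 0 ^ k else 0)"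

lemma inj_pure_power: "inj pure_power"
proof (rule injI)
  fix k l assume "pure_power k = pure_power l"
  then have "pure_power k (\<lambda>_. 2) 0 = pure_power l (\<lambda>_. 2) 0" by simp
  then show "k = l" by (simp add: pure_power_def)
qed

text \<open>Evaluating the first component of a vanishing combination at constant sequences gives a
  real polynomial that is zero everywhere.\<close>

lemma independent_pure_power: "independent (range pure_power)"
proof
  assume "dependent (range pure_power)"
  then obtain T u v where T: "T \<subseteq> range pure_power" "finite T"
    and eq: "(\<Sum>v\<in>T. u v *\<^sub>R v) = 0" and v: "v \<in> T" "u v \<noteq> 0"
    unfolding real_vector.dependent_explicit by (elim exE conjE bexE) (rule that)
  define K where "K = pure_power -` T"
  have K: "T = pure_power ` K" "finite K"
    unfolding K_def using T by (simp_all add: image_vimage_eq Int_absorb2 finite_vimageI inj_pure_power)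
  define d where "d = Max (insert 0 K)"
  define c where "c k = (if k \<in> K then u (pure_power k) else 0)" for k
  have sub: "K \<subseteq> {..d}" unfolding d_def using K by auto
  have "(\<Sum>k\<le>d. c k * x ^ k) = 0" for x
  proof -
    have "(\<Sum>k\<le>d. c k * x ^ k) = (\<Sum>k\<in>K. u (pure_power k) * x ^ k)"
      by (rule sum.mono_neutral_cong_right) (use sub in \<open>auto simp: c_def\<close>)
    also have "\<dots> = (\<Sum>v\<in>T. u v * v (\<lambda>_. x) 0)"
      unfolding K(1) sum.reindex[OF inj_on_subset[OF inj_pure_power subset_UNIV]]
      by (simp add: pure_power_def)
    also have "\<dots> = (\<Sum>v\<in>T. u v *\<^sub>R v) (\<lambda>_. x) 0" by (simp add: sum_fun_apply scaleR_fun_def)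
    finally show ?thesis by (simp add: eq)
  qed
  then have c0: "\<forall>k\<le>d. c k = 0" using polyfun_eq_0[of c d] by blast
  obtain k where k: "k \<in> K" "v = pure_power k" using v(1) K(1) by blast
  then have "k \<le> d" using sub by blast
  then have "c k = 0" using c0 by blast
  with k v(2) show False by (simp add: c_def)
qed

text \<open>Separates the data from the variable: for fixed \<nu> all surpluses are multiples of one
  product of nodal polynomials, so \<nu> accounts for a single dimension.\<close>

lemma hier_surplus_eq_nodal:
  "hier_surplus \<xi> \<nu> u y =
    hier_surplus_const * (\<Prod>j\<in>supp \<nu>. nodal \<xi> (\<nu> j) (y j))"
  if "hier_surplus_const = (\<Sum>\<mu>\<in>{..\<nu>}. u (\<lambda>j. \<xi> (\<mu> j)) *
    (\<Prod>j\<in>supp \<nu>. if \<mu> j \<le> \<nu> j then 1 / (\<Prod>l\<in>{..\<nu> j} - {\<mu> j}. \<xi> (\<mu> j) - \<xi> l) else 0))"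
proof -
  have "newton_basis \<xi> k i x = (if i \<le> k then 1 / (\<Prod>l\<in>{..k} - {i}. \<xi> i - \<xi> l) else 0) * nodal \<xi> k x" for k i x
    by (simp add: newton_basis_def)
  then show ?thesis
    unfolding that hier_surplus_def by (simp only: prod.distrib sum_distrib_right mult.assoc)
qed

text \<open>The maps \<open>E (j, \<nu>)\<close> put a nodal product into component
  \<open>j\<close>; they span every interpolant, whatever \<open>H\<close> is, and there are at most
  N of them. A basis of their span is then padded with pure powers.\<close>

lemma interpolation_space:
  fixes \<psi> :: "nat \<Rightarrow> 'x::real_inner" and \<eta> :: "nat \<Rightarrow> 'y::real_inner"
  assumes inj: "inj \<xi>" and \<Lambda>: "\<And>j. j < m \<Longrightarrow> multiindex_set (\<Lambda> j)"
    and card: "(\<Sum>j<m. card (\<Lambda> j)) \<le> N" and m: "1 \<le> m"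
  obtains n V where "1 \<le> n" "subspace V" "dim V = N" "\<And>q. q \<in> V \<Longrightarrow> polynomial_map n m q"
    "\<And>H :: 'x \<Rightarrow> 'y. interpolation_map \<xi> m \<Lambda> r s w \<psi> \<eta> H \<in> V"
proof -
  define E where "E = (\<lambda>(j :: nat, \<nu>) x i. if i = j then
    \<Prod>l\<in>supp \<nu>. nodal \<xi> (\<nu> l) (x l / (r * w l powr s)) else 0)"
  define I where "I = Sigma {..<m} \<Lambda>"
  have finL: "finite (\<Lambda> j)" and mi: "\<And>\<nu>. \<nu> \<in> \<Lambda> j \<Longrightarrow> finite (supp \<nu>)" if "j < m" for j
    using \<Lambda>[OF that] by (auto simp: multiindex_set_def)
  have finI: "finite I" unfolding I_def using finL by auto
  have cardI: "card I \<le> N" using card finL unfolding I_def by simp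
  have "finite (\<Union>(j, \<nu>)\<in>I. supp \<nu>)"
    using finI mi by (auto simp: I_def)
  then obtain n0 where n0: "(\<Union>(j, \<nu>)\<in>I. supp \<nu>) \<subseteq> {..<n0}"
    unfolding finite_nat_iff_bounded by (elim exE)
  define n where "n = Suc n0"
  have Epoly: "polynomial_map n m (E (j, \<nu>))" if "(j, \<nu>) \<in> I" for j \<nu>
  proof -
    have "l < n" if "\<nu> l \<noteq> 0" for l
    proof -
      have "l \<in> (\<Union>(j, \<nu>)\<in>I. supp \<nu>)" using that \<open>(j, \<nu>) \<in> I\<close> by auto
      then show ?thesis using n0 by (auto simp: n_def)
    qed
    then have "polynomial_fun n (\<lambda>x. \<Prod>l\<in>supp \<nu>. nodal \<xi> (\<nu> l) (x l / (r * w l powr s)))"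
      unfolding nodal_def diff_conv_add_uminus divide_inverse
      by (intro polynomial_fun_prod polynomial_fun_add polynomial_fun_mult polynomial_fun_coord
          polynomial_fun_const) auto
    then have "polynomial_fun n (\<lambda>x. E (j, \<nu>) x i)" for i
      by (cases "i = j") (simp_all add: E_def polynomial_fun_const)
    then show ?thesis
      using that by (simp add: polynomial_map_def) (simp add: E_def I_def)
  qed
  have ppoly: "polynomial_map n m (pure_power k)" for k
  proof -
    have "polynomial_fun n (\<lambda>x. \<Prod>i<k. x 0)"
      by (intro polynomial_fun_prod polynomial_fun_coord) (simp add: n_def)
    then have "polynomial_fun n (\<lambda>x. pure_power k x i)" for i
      by (cases "i = 0") (simp_all add: pure_power_def polynomial_fun_const)
    then show ?thesis
      using m by (simp add: polynomial_map_def) (simp add: pure_power_def)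
  qed
  obtain B where B: "B \<subseteq> E ` I" "independent B" "E ` I \<subseteq> span B"
    using maximal_independent_subset by metis
  have finB: "finite B" using B finI finite_subset by blast
  have "card B \<le> card (E ` I)" using B finI by (intro card_mono) auto
  also have "\<dots> \<le> N" using card_image_le[OF finI, of E] cardI by simp
  finally have cardB: "card B \<le> N" .
  have "infinite (range pure_power)" using inj_pure_power by (rule range_inj_infinite)
  then obtain B' where B': "B \<subseteq> B'" "B' \<subseteq> B \<union> range pure_power" "finite B'" "independent B'" "card B' = N"
    using independent_extend_card[OF finB B(2) _ independent_pure_power cardB] by metis
  show ?thesis
  proof (rule that[of n "span B'"])
    show "1 \<le> n" by (simp add: n_def)
    show "subspace (span B')" by simp
    show "dim (span B') = N" using dim_span_eq_card_independent[OF B'(4)] B'(5) by simp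
    have "B' \<subseteq> {q. polynomial_map n m q}"
    proof -
      have "E ` I \<subseteq> {q. polynomial_map n m q}" "range pure_power \<subseteq> {q. polynomial_map n m q}"
        using Epoly ppoly by auto
      then show ?thesis using B'(2) B(1) by blast
    qed
    then have "span B' \<subseteq> {q. polynomial_map n m q}"
      by (rule span_minimal[OF _ subspace_polynomial_map])
    then show "polynomial_map n m q" if "q \<in> span B'" for q using that by auto
    fix H :: "'x \<Rightarrow> 'y"
    define D where "D j \<nu> = (\<Sum>\<mu>\<in>{..\<nu>}. (H (sigma_map r s w \<psi> (\<lambda>j. \<xi> (\<mu> j))) \<bullet> canonical_dual \<eta> j) *
      (\<Prod>j\<in>supp \<nu>. if \<mu> j \<le> \<nu> j then 1 / (\<Prod>l\<in>{..\<nu> j} - {\<mu> j}. \<xi> (\<mu> j) - \<xi> l) else 0))" for j \<nu>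
    have "interpolation_map \<xi> m \<Lambda> r s w \<psi> \<eta> H = (\<Sum>(j, \<nu>)\<in>I. D j \<nu> *\<^sub>R E (j, \<nu>))"
    proof (intro ext)
      fix x i
      define y where "y k = x k / (r * w k powr s)" for k
      define u where "u j y = H (sigma_map r s w \<psi> y) \<bullet> canonical_dual \<eta> j" for j y
      have hs: "hier_surplus \<xi> \<nu> (u j) y = D j \<nu> * (\<Prod>l\<in>supp \<nu>. nodal \<xi> (\<nu> l) (y l))" for j \<nu>
        by (rule hier_surplus_eq_nodal) (simp add: D_def u_def)
      have "(\<Sum>(j, \<nu>)\<in>I. D j \<nu> *\<^sub>R E (j, \<nu>)) x i = (\<Sum>(j, \<nu>)\<in>I. if i = j then hier_surplus \<xi> \<nu> (u j) y else 0)"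
        by (simp add: sum_fun_apply case_prod_unfold scaleR_fun_def E_def hs y_def if_distrib cong: if_cong)
      also have "\<dots> = (\<Sum>j<m. \<Sum>\<nu>\<in>\<Lambda> j. if i = j then hier_surplus \<xi> \<nu> (u j) y else 0)"
        unfolding I_def by (rule sum.Sigma[symmetric]) (use finL in auto)
      also have "\<dots> = (\<Sum>j<m. if i = j then \<Sum>\<nu>\<in>\<Lambda> j. hier_surplus \<xi> \<nu> (u j) y else 0)"
        by (intro sum.cong refl) auto
      also have "\<dots> = (if i < m then \<Sum>\<nu>\<in>\<Lambda> i. hier_surplus \<xi> \<nu> (u i) y else 0)"
        by (simp add: sum.delta)
      also have "\<dots> = interpolation_map \<xi> m \<Lambda> r s w \<psi> \<eta> H x i"
        by (simp add: interpolation_map_def sparse_interp_eq_sum_hier_surplus[OF inj \<Lambda>] u_def[abs_def] y_def[abs_def])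
      finally show "interpolation_map \<xi> m \<Lambda> r s w \<psi> \<eta> H x i = (\<Sum>(j, \<nu>)\<in>I. D j \<nu> *\<^sub>R E (j, \<nu>)) x i" ..
    qed
    also have "\<dots> \<in> span B"
      by (intro span_sum) (use B(3) in \<open>auto intro!: span_scale\<close>)
    also have "span B \<subseteq> span B'" using B'(1) by (rule span_mono)
    finally show "interpolation_map \<xi> m \<Lambda> r s w \<psi> \<eta> H \<in> span B'" .
  qed
qed

text \<open>By downward closedness each grid index \<mu> below a member of
  \<open>\<Lambda> j\<close> is itself a member, so the nested grid has no more points than
  \<open>\<Lambda> j\<close> has elements.\<close>

lemma evaluation_tuples_finite_card:
  assumes "\<And>j. j < m \<Longrightarrow> multiindex_set (\<Lambda> j)"
  shows "finite (evaluation_tuples \<xi> m \<Lambda> r s w \<psi>)"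
    and "card (evaluation_tuples \<xi> m \<Lambda> r s w \<psi>) \<le> (\<Sum>j<m. card (\<Lambda> j))"
proof -
  have fin: "finite (\<Lambda> j)" and down: "\<And>\<nu> \<mu>. \<nu> \<in> \<Lambda> j \<Longrightarrow> \<mu> \<le> \<nu> \<Longrightarrow> \<mu> \<in> \<Lambda> j" if "j < m" for j
    using assms[OF that] by (auto simp: multiindex_set_def)
  have sub: "evaluation_tuples \<xi> m \<Lambda> r s w \<psi> \<subseteq>
      (\<lambda>(j, \<mu>). (sigma_map r s w \<psi> (\<lambda>k. \<xi> (\<mu> k)), j)) ` Sigma {..<m} \<Lambda>"
  proof
    fix x assume "x \<in> evaluation_tuples \<xi> m \<Lambda> r s w \<psi>"
    then obtain \<mu> \<nu> j where x: "x = (sigma_map r s w \<psi> (\<lambda>k. \<xi> (\<mu> k)), j)"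
      and "j < m" "\<nu> \<in> \<Lambda> j" "\<mu> \<le> \<nu>"
      unfolding evaluation_tuples_def by (elim CollectE exE conjE) (rule that)
    then have "(j, \<mu>) \<in> Sigma {..<m} \<Lambda>" using down[of j \<nu> \<mu>]
      by (simp only: mem_Sigma_iff lessThan_iff)
    then show "x \<in> (\<lambda>(j, \<mu>). (sigma_map r s w \<psi> (\<lambda>k. \<xi> (\<mu> k)), j)) ` Sigma {..<m} \<Lambda>"
      by (rule rev_image_eqI) (simp add: x)
  qed
  have fS: "finite (Sigma {..<m} \<Lambda>)" using fin by auto
  show "finite (evaluation_tuples \<xi> m \<Lambda> r s w \<psi>)" using finite_subset[OF sub] fS by simp
  have "card (evaluation_tuples \<xi> m \<Lambda> r s w \<psi>) \<le> card (Sigma {..<m} \<Lambda>)"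
    using surj_card_le[OF fS sub] .
  then show "card (evaluation_tuples \<xi> m \<Lambda> r s w \<psi>) \<le> (\<Sum>j<m. card (\<Lambda> j))"
    using fin by simp
qed

section \<open>Error of sparse interpolation\<close>

lemma has_sum_sum:
  fixes f :: "'i \<Rightarrow> 'a \<Rightarrow> 'b::topological_comm_monoid_add"
  assumes "\<And>i. i \<in> I \<Longrightarrow> (f i has_sum S i) A"
  shows "((\<lambda>x. \<Sum>i\<in>I. f i x) has_sum (\<Sum>i\<in>I. S i)) A"
  using assms
  by (induction I rule: infinite_finite_induct) (auto intro: has_sum_add)

context holomorphic_parametrization
begin

text \<open>Biorthogonality lets the canonical dual read off the individual coefficients of the
  series.\<close>

lemma sigma_in_C_cube:
  assumes "biorthogonal_to_dual \<psi>" "y \<in> unit_cube"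
  shows "\<sigma> y \<in> C_cube r s w \<psi>"
  unfolding C_cube_def
proof (intro CollectI allI)
  fix j
  have "(\<lambda>k. (w k powr s * y k) *\<^sub>R \<psi> k) sums (\<Sum>k. (w k powr s * y k) *\<^sub>R \<psi> k)"
    using sigma_summable[OF assms(2)] by (rule summable_sums)
  from bounded_linear.sums[OF bounded_linear_inner_left this]
  have "(\<lambda>k. w k powr s * y k * (\<psi> k \<bullet> canonical_dual \<psi> j)) sums
      ((\<Sum>k. (w k powr s * y k) *\<^sub>R \<psi> k) \<bullet> canonical_dual \<psi> j)" by simp
  moreover have "(\<lambda>k. w k powr s * y k * (\<psi> k \<bullet> canonical_dual \<psi> j)) =
      (\<lambda>k. if k = j then w k powr s * y k else 0)"
    using assms(1) by (auto simp: biorthogonal_to_dual_def)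
  moreover have "(\<lambda>k. if k = j then w k powr s * y k else 0) sums (w j powr s * y j)"
    by (rule sums_single)
  ultimately have "(\<Sum>k. (w k powr s * y k) *\<^sub>R \<psi> k) \<bullet> canonical_dual \<psi> j = w j powr s * y j"
    by (simp add: sums_iff)
  then have "\<bar>\<sigma> y \<bullet> canonical_dual \<psi> j\<bar> * w j powr (- s) = r * \<bar>y j\<bar> * (w j powr s * w j powr (- s))"
    using r_pos by (simp add: sigma_map_def abs_mult)
  also have "w j powr s * w j powr (- s) = 1" using w_pos[of j] by (simp flip: powr_add)
  also have "r * \<bar>y j\<bar> * 1 \<le> r"
    using assms(2) r_pos by (simp add: unit_cube_def abs_le_iff minus_le_iff)
  finally show "\<bar>\<sigma> y \<bullet> canonical_dual \<psi> j\<bar> * w j powr (- s) \<le> r" .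
qed

text \<open>The weights in \<open>C_cube\<close> are exactly those that bring the rescaled encoder
  into the cube, and frame reconstruction shows that \<open>\<sigma>\<close> undoes it, even for a
  redundant frame.\<close>

lemma C_cube_coordinates:
  assumes "is_frame \<psi>" "x \<in> C_cube r s w \<psi>"
  defines "y \<equiv> \<lambda>k. encoder \<psi> x k / (r * w k powr s)"
  shows "y \<in> unit_cube" "\<sigma> y = x"
proof -
  have p: "w k powr s > 0" for k using w_pos[of k] by simp
  have "\<bar>encoder \<psi> x k\<bar> \<le> r * w k powr s" for k
  proof -
    have "\<bar>encoder \<psi> x k\<bar> * w k powr (- s) \<le> r"
      using assms(2) by (simp add: C_cube_def encoder_def)
    then have "\<bar>encoder \<psi> x k\<bar> * w k powr (- s) * w k powr s \<le> r * w k powr s"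
      by (intro mult_right_mono) auto
    moreover have "w k powr (- s) * w k powr s = 1" using w_pos[of k] by (simp flip: powr_add)
    ultimately show ?thesis by (simp add: mult.assoc)
  qed
  then have "\<bar>y k\<bar> \<le> 1" for k using r_pos p[of k] by (simp add: y_def abs_divide)
  then show "y \<in> unit_cube" by (simp add: unit_cube_def abs_le_iff minus_le_iff)
  have "(\<lambda>k. (w k powr s * y k) *\<^sub>R \<psi> k) = (\<lambda>k. (1 / r) *\<^sub>R ((x \<bullet> canonical_dual \<psi> k) *\<^sub>R \<psi> k))"
    using w_pos r_pos by (auto simp: y_def encoder_def less_imp_neq[THEN not_sym])
  moreover have "(\<lambda>k. (1 / r) *\<^sub>R ((x \<bullet> canonical_dual \<psi> k) *\<^sub>R \<psi> k)) sums ((1 / r) *\<^sub>R x)"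
    by (intro sums_scaleR_right frame_reconstruction assms)
  ultimately show "\<sigma> y = x" using r_pos by (simp add: sigma_map_def sums_iff)
qed

text \<open>The surplus expansion of the error in component j contains just the indices with
  \<open>J \<nu>\<close> at most j. Testing the error \<open>e\<close> against itself writes its
  squared norm as a sum over \<nu>, each term being at most \<open>M * e2 * E \<nu>\<close>; one
  factor \<open>e2\<close> cancels. The bound is uniform in \<open>K\<close>.\<close>

lemma sparse_interp_error:
  assumes dec: "decseq w" and t: "0 < t" and y: "y \<in> unit_cube"
    and sb: "surplus_bound a" and a_sum: "a summable_on multiindices"
    and \<Lambda>: "\<forall>j. multiindex_set (\<Lambda> j)" "\<forall>\<nu>\<in>multiindices. \<forall>j. \<nu> \<in> \<Lambda> j \<longleftrightarrow> j < J \<nu>"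
    and E: "\<And>\<nu>. \<nu> \<in> multiindices \<Longrightarrow> w (J \<nu>) powr t * a \<nu> \<le> E \<nu>" "E summable_on multiindices"
  shows "sqrt (\<Sum>j<K. (out_coeff j y - sparse_interp node (\<Lambda> j) (out_coeff j) y)\<^sup>2)
    \<le> M * (\<Sum>\<^sub>\<infinity>\<nu>\<in>multiindices. E \<nu>)"
proof -
  have rng: "range node \<subseteq> {-1..1}" using node_in by blast
  note M0 = M_nonneg
  have a: "0 \<le> a \<nu>"
    and bound: "\<bar>\<Sum>j<K. \<beta> j * hier_surplus node \<nu> (out_coeff j) y\<bar> \<le> M * sqrt (\<Sum>j<K. (\<beta> j * w j powr t)\<^sup>2) * a \<nu>"
    if "\<nu> \<in> multiindices" for \<nu> \<beta> K
    using sb y that by (simp_all add: surplus_bound_def)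
  define d where "d \<nu> j = hier_surplus node \<nu> (out_coeff j) y" for \<nu> j
  define e where "e j = out_coeff j y - sparse_interp node (\<Lambda> j) (out_coeff j) y" for j
  define e2 where "e2 = sqrt (\<Sum>j<K. (e j)\<^sup>2)"
  have e2: "e2\<^sup>2 = (\<Sum>j<K. (e j)\<^sup>2)" "0 \<le> e2" by (simp_all add: e2_def sum_nonneg)
  have \<Lambda>mi: "\<Lambda> j \<subseteq> multiindices" "finite (\<Lambda> j)" for j
    using \<Lambda>(1)[rule_format, of j] by (auto simp: multiindex_set_def multiindices_def)
  obtain \<epsilon> where \<epsilon>: "\<epsilon> > 0" "tube \<epsilon>"
    using ball_radius by metis
  have dsum: "((\<lambda>\<nu>. d \<nu> j) has_sum out_coeff j y) multiindices" for j
    unfolding d_def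
  proof (rule hier_surplus_has_sum[OF rng y])
    show "(\<lambda>k. \<Sum>i\<le>k. newton_basis node k i (y m) * out_coeff j (y(m := node i))) sums out_coeff j y"
      if "y \<in> unit_cube" for y m
      by (rule out_coeff_newton_sums[OF \<epsilon> that])
    show "(\<lambda>n. out_coeff j (\<lambda>j. if j < n then y j else node 0)) \<longlonglongrightarrow> out_coeff j y"
      by (rule out_coeff_truncation_tendsto[OF y node_in])
    have "(\<lambda>\<nu>. norm (d \<nu> j)) summable_on multiindices"
    proof (rule summable_on_comparison_test[OF summable_on_cmult_right[OF a_sum, of "M * w j powr t"]])
      fix \<nu> assume "\<nu> \<in> multiindices"
      from bound[OF this, where K = "Suc j" and \<beta> = "\<lambda>i. if i = j then 1 else 0"]
      show "norm (d \<nu> j) \<le> M * w j powr t * a \<nu>"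
        by (simp add: d_def if_distrib[of "\<lambda>x. x * _"] if_distrib[of "\<lambda>x. x\<^sup>2"] sum.delta cong: if_cong)
    qed simp
    then show "(\<lambda>\<nu>. hier_surplus node \<nu> (out_coeff j) y) summable_on multiindices"
      unfolding d_def by (rule abs_summable_summable)
  qed
  have esum: "((\<lambda>\<nu>. if j < J \<nu> then 0 else d \<nu> j) has_sum e j) multiindices" for j
  proof -
    have "((\<lambda>\<nu>. if j < J \<nu> then d \<nu> j else 0) has_sum (\<Sum>\<nu>\<in>\<Lambda> j. d \<nu> j)) multiindices"
    proof (rule has_sum_finite_neutralI)
      show "(\<Sum>\<nu>\<in>\<Lambda> j. d \<nu> j) = (\<Sum>\<nu>\<in>\<Lambda> j. if j < J \<nu> then d \<nu> j else 0)"
        using \<Lambda>(2) \<Lambda>mi by (intro sum.cong) auto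
    qed (use \<Lambda>(2) \<Lambda>mi in auto)
    from has_sum_add[OF dsum has_sum_uminusI[OF this]]
    have "((\<lambda>\<nu>. d \<nu> j + - (if j < J \<nu> then d \<nu> j else 0)) has_sum e j) multiindices"
      by (simp add: e_def d_def sparse_interp_eq_sum_hier_surplus[OF inj_node \<Lambda>(1)[rule_format]])
    then show ?thesis by (rule back_subst[of "\<lambda>f. (f has_sum e j) multiindices"]) auto
  qed
  have "((\<lambda>\<nu>. \<Sum>j<K. e j * (if j < J \<nu> then 0 else d \<nu> j)) has_sum (\<Sum>j<K. e j * e j)) multiindices"
    by (intro has_sum_sum has_sum_cmult_right esum)
  then have "((\<lambda>\<nu>. \<Sum>j<K. e j * (if j < J \<nu> then 0 else d \<nu> j)) has_sum e2\<^sup>2) multiindices"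
    unfolding e2(1) by (simp add: power2_eq_square)
  moreover have "((\<lambda>\<nu>. M * e2 * E \<nu>) has_sum M * e2 * (\<Sum>\<^sub>\<infinity>\<nu>\<in>multiindices. E \<nu>)) multiindices"
    by (intro has_sum_cmult_right has_sum_infsum E)
  ultimately have "e2\<^sup>2 \<le> M * e2 * (\<Sum>\<^sub>\<infinity>\<nu>\<in>multiindices. E \<nu>)"
  proof (rule has_sum_mono)
    fix \<nu> assume \<nu>: "\<nu> \<in> multiindices"
    \<comment> \<open>With the components below \<open>J \<nu>\<close> cut off, monotonicity bounds
      all remaining weights by the one at \<open>J \<nu>\<close>.\<close>
    define \<beta> where "\<beta> j = (if j < J \<nu> then 0 else e j)" for j
    have "(\<Sum>j<K. e j * (if j < J \<nu> then 0 else d \<nu> j)) = (\<Sum>j<K. \<beta> j * d \<nu> j)"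
      by (rule sum.cong) (auto simp: \<beta>_def)
    also have "\<dots> \<le> M * sqrt (\<Sum>j<K. (\<beta> j * w j powr t)\<^sup>2) * a \<nu>"
      using bound[OF \<nu>, where K = K and \<beta> = \<beta>] by (simp add: d_def)
    also have "\<dots> \<le> M * (w (J \<nu>) powr t * e2) * a \<nu>"
    proof (intro mult_right_mono mult_left_mono M0 a \<nu>)
      have "(\<Sum>j<K. (\<beta> j * w j powr t)\<^sup>2) \<le> (\<Sum>j<K. (w (J \<nu>) powr t)\<^sup>2 * (e j)\<^sup>2)"
      proof (rule sum_mono)
        fix j
        show "(\<beta> j * w j powr t)\<^sup>2 \<le> (w (J \<nu>) powr t)\<^sup>2 * (e j)\<^sup>2"
        proof (cases "j < J \<nu>")
          case False
          then have "w j powr t \<le> w (J \<nu>) powr t"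
            using dec w_pos[of j] t by (intro powr_mono2) (auto simp: decseq_def)
          then have "(w j powr t)\<^sup>2 \<le> (w (J \<nu>) powr t)\<^sup>2" by (intro power_mono) auto
          then have "(w j powr t)\<^sup>2 * (e j)\<^sup>2 \<le> (w (J \<nu>) powr t)\<^sup>2 * (e j)\<^sup>2" by (rule mult_right_mono) auto
          then show ?thesis using False by (simp add: \<beta>_def power_mult_distrib mult.commute)
        qed (simp add: \<beta>_def)
      qed
      also have "\<dots> = (w (J \<nu>) powr t * e2)\<^sup>2" by (simp add: power_mult_distrib e2 sum_distrib_left)
      finally show "sqrt (\<Sum>j<K. (\<beta> j * w j powr t)\<^sup>2) \<le> w (J \<nu>) powr t * e2"
        using e2 by (intro real_le_lsqrt) auto
    qed
    also have "\<dots> = M * e2 * (w (J \<nu>) powr t * a \<nu>)" by simp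
    also have "\<dots> \<le> M * e2 * E \<nu>" using M0 e2 E(1)[OF \<nu>] by (intro mult_left_mono) auto
    finally show "(\<Sum>j<K. e j * (if j < J \<nu> then 0 else d \<nu> j)) \<le> M * e2 * E \<nu>" .
  qed
  then have "e2 * e2 \<le> (M * (\<Sum>\<^sub>\<infinity>\<nu>\<in>multiindices. E \<nu>)) * e2"
    by (simp add: power2_eq_square mult_ac)
  moreover have "0 \<le> E \<nu>" if "\<nu> \<in> multiindices" for \<nu>
    using order_trans[OF mult_nonneg_nonneg[OF powr_ge_zero a[OF that]] E(1)[OF that]] .
  then have "0 \<le> M * (\<Sum>\<^sub>\<infinity>\<nu>\<in>multiindices. E \<nu>)"
    using M_nonneg by (intro mult_nonneg_nonneg infsum_nonneg)
  ultimately have "e2 \<le> M * (\<Sum>\<^sub>\<infinity>\<nu>\<in>multiindices. E \<nu>)"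
    using e2(2) by (cases "e2 = 0") auto
  then show ?thesis by (simp add: e2_def e_def)
qed

end

theorem theorem3p11:
  fixes \<psi> :: "nat \<Rightarrow> 'x::{real_inner, banach, second_countable_topology}"
    and \<eta> :: "nat \<Rightarrow> 'y::{real_inner, banach, second_countable_topology}"
    and w :: "nat \<Rightarrow> real"
    and r s t M \<delta> :: real
    and A :: "'x set"
    and G :: "'x \<Rightarrow> 'y"
    and Om :: "('x \<times> 'x) set"
    and GC :: "'x \<times> 'x \<Rightarrow> 'y \<times> 'y"
  assumes "is_frame \<psi>" and "is_frame \<eta>"
    and "admissible_weights w"
    and "r > 0" and "s > 1" and "t > 0"
    and "C_tilde r s w \<psi> \<subseteq> A"
    and "open Om"
    and "\<forall>a \<in> C_tilde r s w \<psi>. (a, 0) \<in> Om"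
    and "\<forall>a \<in> A. (a, 0) \<in> Om \<longrightarrow> GC (a, 0) = (G a, 0)"
    and "holomorphic_map_on GC Om"
    and "\<forall>a \<in> Om. GC a \<in> Yt_complex w \<eta> t \<and> Yt_complex_norm w \<eta> t (GC a) \<le> M"
    and "\<delta> > 0"
  shows "\<exists>\<xi> :: nat \<Rightarrow> real. inj \<xi> \<and> range \<xi> \<subseteq> {-1..1} \<and>
    (\<exists>C>0. \<forall>N::nat. 1 \<le> N \<longrightarrow>
      (\<exists>n m (p :: (nat \<Rightarrow> real) \<Rightarrow> (nat \<Rightarrow> real)).
         1 \<le> n \<and> 1 \<le> m \<and> polynomial_map n m p \<and>
         (\<forall>a \<in> C_cube r s w \<psi>.
            norm (G a - decoder \<eta> (p (encoder \<psi> a))) \<le> C * real N powr (- min (s - 1) t + \<delta>)) \<and>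
         (\<exists>V \<Lambda>.
            subspace V \<and> dim V = N \<and> (\<forall>q\<in>V. polynomial_map n m q) \<and> p \<in> V \<and>
            (\<forall>j<m. multiindex_set (\<Lambda> j)) \<and> (\<Sum>j<m. card (\<Lambda> j)) \<le> N \<and>
            (\<forall>H :: 'x \<Rightarrow> 'y. interpolation_map \<xi> m \<Lambda> r s w \<psi> \<eta> H \<in> V) \<and>
            p = interpolation_map \<xi> m \<Lambda> r s w \<psi> \<eta> G \<and>
            finite (evaluation_tuples \<xi> m \<Lambda> r s w \<psi>) \<and>
            card (evaluation_tuples \<xi> m \<Lambda> r s w \<psi>) \<le> N \<and>
            evaluation_tuples \<xi> m \<Lambda> r s w \<psi> \<subseteq> C_tilde r s w \<psi> \<times> UNIV \<and>
            (biorthogonal_to_dual \<psi> \<longrightarrow>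
               evaluation_tuples \<xi> m \<Lambda> r s w \<psi> \<subseteq> C_cube r s w \<psi> \<times> UNIV))))"
proof -
  note frame_\<psi> = assms(1) and frame_\<eta> = assms(2) and weights = assms(3)
  obtain Bx where Bx: "bessel_bound \<psi> Bx" using is_frame_imp_bessel_bound[OF frame_\<psi>] .
  obtain By where By: "bessel_bound \<eta> By" using is_frame_imp_bessel_bound[OF frame_\<eta>] .
  have By0: "0 \<le> By" using By by (simp add: bessel_bound_def)
  have w_pos: "0 < w j" for j using weights by (simp add: admissible_weights_def)
  have dec: "decseq w" using weights by (simp add: admissible_weights_def)
  have w_sum: "summable (\<lambda>j. w j powr p)" if "p > 1" for p
  proof -
    have "summable (\<lambda>j. w j powr (1 + (p - 1)))"
      using weights that unfolding admissible_weights_def by (meson diff_gt_0_iff_gt)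
    then show ?thesis by simp
  qed
  define \<rho> where "\<rho> = min (s - 1) t"
  have \<rho>: "0 < \<rho>" "\<rho> \<le> s - 1" "\<rho> \<le> t" using assms(5,6) by (auto simp: \<rho>_def)
  \<comment> \<open>The rate to be achieved: below \<rho> by at most \<delta>, and kept positive by
    the second argument when \<delta> is large.\<close>
  define \<alpha> where "\<alpha> = max (\<rho> - \<delta>) (\<rho> / 2)"
  have \<alpha>: "0 < \<alpha>" "\<alpha> < t" "\<alpha> < s - 1" "- \<alpha> \<le> - \<rho> + \<delta>"
    using \<rho> assms(13) by (auto simp: \<alpha>_def)
  define q where "q = 1 / (1 + \<alpha>)"
  have q: "0 < q" "q \<le> 1" using \<alpha> by (auto simp: q_def)
  have sq: "s * q > 1" using \<alpha> by (simp add: q_def field_simps)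
  interpret holomorphic_parametrization \<psi> \<eta> w r s t M Bx G Om GC
  proof
    show "GC (x, 0) = (G x, 0)" if "x \<in> C_tilde r s w \<psi>" for x
      using assms(7,9,10) that by blast
  qed (use assms Bx w_pos w_sum in auto)
  obtain a where sb: "surplus_bound a"
    and card_sum: "(\<lambda>\<nu>. real (card {..\<nu>}) * a \<nu> powr q) summable_on multiindices"
    by (rule surplus_majorant[OF q w_sum[OF sq]]) (rule that)
  have a: "0 \<le> a \<nu>" if "\<nu> \<in> multiindices" for \<nu> using sb that by (simp add: surplus_bound_def)
  obtain g where ag: "\<And>\<nu>. \<nu> \<in> multiindices \<Longrightarrow> a \<nu> powr q \<le> g \<nu>"
    and g_mono: "\<And>\<mu> \<nu>. \<nu> \<in> multiindices \<Longrightarrow> \<mu> \<le> \<nu> \<Longrightarrow> g \<nu> \<le> g \<mu>"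
    and g_sum: "g summable_on multiindices"
    using monotone_majorant_summable[OF powr_ge_zero card_sum] by metis
  have g0: "0 \<le> g \<nu>" if "\<nu> \<in> multiindices" for \<nu>
    using ag[OF that] powr_ge_zero[of "a \<nu>" q] by linarith
  define S where "S = (\<Sum>\<^sub>\<infinity>\<nu>\<in>multiindices. g \<nu>)"
  have S0: "0 \<le> S" unfolding S_def using g0 by (rule infsum_nonneg)
  \<comment> \<open>Adding 1 allows division by \<open>D\<close> even if \<open>g\<close> sums to
    0.\<close>
  define D where "D = 1 + S"
  have D: "D > 0" "S \<le> D" using S0 by (auto simp: D_def)
  have a_le: "a \<nu> \<le> g \<nu> powr (1 + \<alpha>)" if "\<nu> \<in> multiindices" for \<nu>
  proof -
    have "a \<nu> = (a \<nu> powr q) powr (1 + \<alpha>)"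
      using a[OF that] \<alpha> by (simp add: powr_powr q_def)
    also have "\<dots> \<le> g \<nu> powr (1 + \<alpha>)"
      using ag[OF that] \<alpha> by (intro powr_mono2) auto
    finally show ?thesis .
  qed
  \<comment> \<open>As g is bounded by its sum, the power 1 + \<alpha> of g is at most a constant
    times g.\<close>
  have a_sum: "a summable_on multiindices"
  proof (rule summable_on_comparison_test[OF summable_on_cmult_right[OF g_sum, of "D powr \<alpha>"]])
    fix \<nu> assume \<nu>: "\<nu> \<in> multiindices"
    have "g \<nu> \<le> D"
      using finite_sum_le_infsum[OF g_sum, of "{\<nu>}"] \<nu> g0 D by (simp add: S_def)
    then have "g \<nu> powr \<alpha> \<le> D powr \<alpha>" using g0[OF \<nu>] \<alpha> by (intro powr_mono2) auto
    then have "g \<nu> powr (1 + \<alpha>) \<le> D powr \<alpha> * g \<nu>"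
      using g0[OF \<nu>] by (simp add: powr_add mult.commute mult_left_mono)
    then show "a \<nu> \<le> D powr \<alpha> * g \<nu>" using a_le[OF \<nu>] by simp
  qed (use a in auto)
  obtain C0 where C0: "C0 > 0" "\<And>j. w j powr t \<le> C0 * real (Suc j) powr (- \<alpha>)"
    using admissible_weights_decay[OF weights \<alpha>(1,2)] by metis
  define C where "C = By * (M * (C0 * D powr \<alpha> * S)) + 1"
  have C: "C > 0"
    using By0 M_nonneg C0(1) S0 by (auto simp: C_def intro!: add_nonneg_pos mult_nonneg_nonneg)
  have rng: "node i \<in> {-1..1}" for i by (rule node_in)
  show ?thesis
  proof (intro exI[of _ node] exI[of _ C] conjI allI impI inj_node C, goal_cases)
    case 1
    show ?case using rng by blast
  next
    case (2 N)
    then have N: "1 \<le> N" .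
    obtain \<Lambda> J where \<Lambda>: "\<forall>j. multiindex_set (\<Lambda> j)"
      and J: "\<forall>\<nu>\<in>multiindices. \<forall>j. \<nu> \<in> \<Lambda> j \<longleftrightarrow> j < J \<nu>"
        "\<forall>\<nu>\<in>multiindices. real N * g \<nu> / D \<le> real (Suc (J \<nu>))"
      and \<Lambda>N: "\<forall>j\<ge>N. \<Lambda> j = {}" and card: "(\<Sum>j<N. card (\<Lambda> j)) \<le> N"
      by (rule sparse_levels[OF _ _ g_sum D(1) D(2)[unfolded S_def] N], erule g0, erule (1) g_mono)
        (rule that)
    note \<Lambda>' = \<Lambda>[rule_format]
    \<comment> \<open>The share of \<nu> turns the weight decay into (N g / D) to the power
      -\<alpha>; multiplied by the bound on \<open>a \<nu>\<close>, which is g to the power 1 +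
      \<alpha>, exactly one power of g survives.\<close>
    define E where "E \<nu> = C0 * D powr \<alpha> * real N powr (- \<alpha>) * g \<nu>" for \<nu>
    have E_sum: "E summable_on multiindices"
      unfolding E_def by (intro summable_on_cmult_right g_sum)
    have E_inf: "(\<Sum>\<^sub>\<infinity>\<nu>\<in>multiindices. E \<nu>) = C0 * D powr \<alpha> * real N powr (- \<alpha>) * S"
      unfolding E_def S_def by (rule infsum_cmult_right) (rule g_sum)
    have E: "w (J \<nu>) powr t * a \<nu> \<le> E \<nu>" if \<nu>: "\<nu> \<in> multiindices" for \<nu>
    \<comment> \<open>Negative powers of g are monotone only for positive g; at 0 the surplus bound
      itself vanishes.\<close>
    proof (cases "g \<nu> = 0")
      case True
      then have "a \<nu> \<le> 0" using a_le[OF \<nu>] by simp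
      then show ?thesis using a[OF \<nu>] True by (simp add: E_def)
    next
      case False
      then have g: "g \<nu> > 0" using g0[OF \<nu>] by simp
      have "w (J \<nu>) powr t \<le> C0 * real (Suc (J \<nu>)) powr (- \<alpha>)" by (rule C0)
      also have "\<dots> \<le> C0 * (real N * g \<nu> / D) powr (- \<alpha>)"
        using C0(1) \<alpha> g D N by (intro mult_left_mono powr_mono2' J(2)[rule_format] \<nu>) auto
      also have "(real N * g \<nu> / D) powr (- \<alpha>) = real N powr (- \<alpha>) * g \<nu> powr (- \<alpha>) * D powr \<alpha>"
        using g D N by (simp add: powr_divide powr_mult powr_minus_divide)
      finally have "w (J \<nu>) powr t * a \<nu> \<le>
          C0 * (real N powr (- \<alpha>) * g \<nu> powr (- \<alpha>) * D powr \<alpha>) * g \<nu> powr (1 + \<alpha>)"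
        using a[OF \<nu>] a_le[OF \<nu>] C0(1) by (intro mult_mono) auto
      also have "\<dots> = C0 * D powr \<alpha> * real N powr (- \<alpha>) * (g \<nu> powr (- \<alpha>) * g \<nu> powr (1 + \<alpha>))"
        by (simp only: mult_ac)
      also have "g \<nu> powr (- \<alpha>) * g \<nu> powr (1 + \<alpha>) = g \<nu>"
        using g by (simp flip: powr_add)
      finally show ?thesis by (simp add: E_def)
    qed
    \<comment> \<open>N output components suffice, since every level from N on is empty.\<close>
    define p where "p = interpolation_map node N \<Lambda> r s w \<psi> \<eta> G"
    obtain n V where n: "1 \<le> n" and V: "subspace V" "dim V = N" "\<And>q. q \<in> V \<Longrightarrow> polynomial_map n N q"
      "\<And>H :: 'x \<Rightarrow> 'y. interpolation_map node N \<Lambda> r s w \<psi> \<eta> H \<in> V"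
      using interpolation_space[OF inj_node \<Lambda>' card N] by metis
    have error: "norm (G x - decoder \<eta> (p (encoder \<psi> x))) \<le> C * real N powr (- min (s - 1) t + \<delta>)"
      if x: "x \<in> C_cube r s w \<psi>" for x
    proof -
      define y where "y = (\<lambda>k. encoder \<psi> x k / (r * w k powr s))"
      have y: "y \<in> unit_cube" "\<sigma> y = x"
        unfolding y_def by (rule C_cube_coordinates[OF frame_\<psi> x])+
      define e where "e j = out_coeff j y - sparse_interp node (\<Lambda> j) (out_coeff j) y" for j
      define P where "P = p (encoder \<psi> x)"
      have Pj: "P j = sparse_interp node (\<Lambda> j) (out_coeff j) y" for j
      proof (cases "j < N")
        case True
        then show ?thesis
          by (simp add: P_def p_def interpolation_map_def y_def out_coeff_def[abs_def])
      next
        case False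
        then show ?thesis by (simp add: P_def p_def interpolation_map_def \<Lambda>N sparse_interp_def)
      qed
      have "(\<lambda>j. P j *\<^sub>R \<eta> j) sums (\<Sum>j<N. P j *\<^sub>R \<eta> j)"
        by (rule sums_finite) (auto simp: Pj \<Lambda>N sparse_interp_def not_less)
      then have "(\<lambda>j. P j *\<^sub>R \<eta> j) sums decoder \<eta> P" by (simp add: decoder_def sums_iff)
      moreover have "(\<lambda>j. out_coeff j y *\<^sub>R \<eta> j) sums G x"
        using frame_reconstruction[OF frame_\<eta>, of "G x"] by (simp add: out_coeff_def y)
      ultimately have "(\<lambda>j. out_coeff j y *\<^sub>R \<eta> j - P j *\<^sub>R \<eta> j) sums (G x - decoder \<eta> P)"
        by (rule sums_diff[rotated])
      then have "(\<lambda>j. e j *\<^sub>R \<eta> j) sums (G x - decoder \<eta> P)"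
        by (simp add: e_def Pj scaleR_diff_left)
      then have lim: "(\<lambda>K. norm (\<Sum>j<K. e j *\<^sub>R \<eta> j)) \<longlonglongrightarrow> norm (G x - decoder \<eta> P)"
        unfolding sums_def by (rule tendsto_norm)
      have "norm (G x - decoder \<eta> P) \<le> By * (M * (\<Sum>\<^sub>\<infinity>\<nu>\<in>multiindices. E \<nu>))"
      proof (rule LIMSEQ_le_const2[OF lim], intro exI allI impI)
        fix K
        have "norm (\<Sum>j<K. e j *\<^sub>R \<eta> j) \<le> By * sqrt (\<Sum>j<K. (e j)\<^sup>2)"
          by (rule bessel_bound_sum[OF By]) simp
        also have "sqrt (\<Sum>j<K. (e j)\<^sup>2) \<le> M * (\<Sum>\<^sub>\<infinity>\<nu>\<in>multiindices. E \<nu>)"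
          unfolding e_def
          by (rule sparse_interp_error[OF dec assms(6) y(1) sb a_sum \<Lambda> J(1) E E_sum])
        finally show "norm (\<Sum>j<K. e j *\<^sub>R \<eta> j) \<le> By * (M * (\<Sum>\<^sub>\<infinity>\<nu>\<in>multiindices. E \<nu>))"
          using By0 by (simp add: mult_left_mono)
      qed
      also have "\<dots> = By * (M * (C0 * D powr \<alpha> * S)) * real N powr (- \<alpha>)"
        by (simp add: E_inf)
      also have "\<dots> \<le> C * real N powr (- \<alpha>)"
        by (intro mult_right_mono) (auto simp: C_def)
      also have "\<dots> \<le> C * real N powr (- \<rho> + \<delta>)"
        using C N \<alpha>(4) by (intro mult_left_mono powr_mono) auto
      finally show ?thesis by (simp add: P_def \<rho>_def)
    qed
    have tuples: "evaluation_tuples node N \<Lambda> r s w \<psi> \<subseteq> (\<sigma> ` unit_cube) \<times> UNIV"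
      using rng by (auto simp: evaluation_tuples_def unit_cube_def intro!: imageI)
    show ?case
    proof (rule exI[of _ n], rule exI[of _ N], rule exI[of _ p],
        intro conjI ballI exI[of _ V] exI[of _ \<Lambda>] allI impI)
      show "evaluation_tuples node N \<Lambda> r s w \<psi> \<subseteq> C_tilde r s w \<psi> \<times> UNIV"
        using tuples by (simp add: C_tilde_def)
      show "evaluation_tuples node N \<Lambda> r s w \<psi> \<subseteq> C_cube r s w \<psi> \<times> UNIV"
        if "biorthogonal_to_dual \<psi>"
        using tuples sigma_in_C_cube[OF that] by (meson image_subsetI Sigma_mono order_refl order_trans)
      show "card (evaluation_tuples node N \<Lambda> r s w \<psi>) \<le> N"
        using evaluation_tuples_finite_card(2)[OF \<Lambda>'] card by (rule order_trans)
      show "finite (evaluation_tuples node N \<Lambda> r s w \<psi>)"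
        by (rule evaluation_tuples_finite_card(1)[OF \<Lambda>'])
      show "interpolation_map node N \<Lambda> r s w \<psi> \<eta> H \<in> V" for H :: "'x \<Rightarrow> 'y" by (rule V(4))
      show "p \<in> V" "p = interpolation_map node N \<Lambda> r s w \<psi> \<eta> G"
        unfolding p_def by (rule V(4) refl)+
      then show "polynomial_map n N p" using V(3) by blast
    qed (use n N V \<Lambda> card error in auto)
  qed
qed

end
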